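(* Let $S=k[x_1,\ldots,x_m]$ be a polynomial ring over a field $k$, let $I=(m_1,\ldots,m_r)\subseteq S$ be an ideal generated by monomials, and let $R=S/I$. Assume that $R$ is simplicially resolvable and that the Taylor resolution $T$ of $R$ admits a standard matching. Then all higher Massey products on $\operatorname{Tor}^S(R,k)$ are trivial.
   Context: Simplicial resolutions: For $J\subseteq\{1,\ldots,r\}$ put $m_J=\operatorname{lcm}\{m_j\mid j\in J\}$ (so $m_\emptyset=1$). For a simplicial complex $\Delta$ on vertex set $\{1,\ldots,r\}$ let $F_\Delta$ be the complex whose degree $n$ part is the free $S$-module on generators $u_J$, $J\in\Delta$, $|J|=n$, with $d(u_J)=\sum_{i=1}^{|J|}(-1)^{i+1}\frac{m_J}{m_{J^i}}u_{J^i}$, where $J=\{j_1<\cdots<j_n\}$, $J^i=J\setminus\{j_i\}$. A free resolution $F$ of $R$ is minimal if $d(F)\subseteq(x_1,\ldots,x_m)F$. $R$ is simplicially resolvable if its minimal free resolution is of the form $F_\Delta$ for some simplicial complex $\Delta$. The Taylor resolution $T$ is $F_\Delta$ for $\Delta$ the full simplex of all subsets of $\{1,\ldots,r\}$. Massey products: for a dga $(A,d)$ write $\bar a=(-1)^{\deg(a)+1}a$. For $\alpha_1,\alpha_2\in HA$, the length 2 Massey product $\langle\alpha_1,\alpha_2\rangle$ is the product $\alpha_1\alpha_2$. Let $\alpha_1,\ldots,\alpha_n\in HA$ be such that each $\langle\alpha_i,\ldots,\alpha_j\rangle$ with $i<j$ and $j-i<n-1$ is defined and contains zero. A defining system $\{a_{ij}\}$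 consists of cycles $a_{i-1,i}$ representing $\alpha_i$ ($i=1,\ldots,n$) and, for $0\le i$, $i+1<j\le n$, $(i,j)\ne(0,n)$, elements $a_{ij}$ with $da_{ij}=\sum_{i<l<j}\bar a_{il}a_{lj}$. The length $n$ Massey product $\langle\alpha_1,\ldots,\alpha_n\rangle$ is the set of all classes $[\sum_{0<i<n}\bar a_{0i}a_{in}]$ over all defining systems. It is trivial if it contains zero. Higher Massey products are those of length $n\ge3$. Massey products on $\operatorname{Tor}^S(R,k)$ are those of the Koszul dga $K_R=R\otimes_SK_S$, where $K_S$ is the Koszul resolution of $k$ over $S$, so that $H(K_R)=\operatorname{Tor}^S(R,k)$. Morse matchings: a based complex is a chain complex $(K,d)$ with decompositions $K_n=\bigoplus_{\alpha\in I_n}K_\alpha$, the $I_n$ pairwise disjoint; $d_{\beta,\alpha}\colon K_\alpha\to K_\beta$ denotes the component of $d$. $G_K$ is the directed graph with vertex set $\bigcup_nI_n$ and an edge $\alpha\to\beta$ if $d_{\beta,\alpha}\neq0$. A Morse (acyclic) matching on $K$ is a set $\mathcal{N}$ of edges of $G_K$ such that no vertex is incident to more than one edge of $\mathcal{N}$, $d_{\beta,\alpha}$ is an isomorphism for each $\alpha\to\beta$ in $\mathcal{N}$, and the graph $G_K^{\mathcal{N}}$ obtained from $G_K$ by reversing the edges in $\mathcal{N}$ has no directed cycles. Vertices not incident to $\mathcal{N}$ are critical. Define $\phi\colon K\to K$ of degree $1$ recursively along $G_K^{\mathcal{N}}$ (finite and acyclic): for $x\in K_\alpha$, $\phi(x)=d_{\alpha,\beta}^{-1}(x)-\sum_{\beta\to\gamma,\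 \gamma\neq\alpha}\phi d_{\gamma,\beta}d_{\alpha,\beta}^{-1}(x)$ if $\beta\to\alpha\in\mathcal{N}$ for some $\beta$, and $\phi(x)=0$ otherwise. The Morse complex $K^{\mathcal{N}}$ is the direct sum of the $K_\alpha$ over critical $\alpha$, with differential $\tilde d=q(d-d\phi d)$ restricted to it, where $q$ is the projection on the critical components; it is again a based complex. The Taylor resolution is a based complex with one component $Su_J$ for each cell $u_J$; cells are identified with subsets $J\subseteq\{1,\dots,r\}$. For a sequence of matchings, where each is a matching on the Morse complex of the previous ones, the Morse complex of their union is the iterated Morse complex. For a cell $u=u_J$ write $m_u=m_J$ and $|u|=|J|$. Define $\operatorname{cl}(u)$ as the number of equivalence classes on $J$ under the transitive closure of the relation $i\sim j\iff\gcd(m_i,m_j)\ne1$. Standard matching: a sequence of matchings $\mathcal{M}=\bigcup_{i\ge0}\mathcal{M}_i$ on $T$ such that 1. for all arrows $u\to v$ in $\mathcal{M}$, $m_u=m_v$; 2. for all arrows $u\to v$ in (the graph of) the Morse complex $T^{\mathcal{M}}$, $m_u\neq m_v$; 3. $\mathcal{M}_i$ is an acyclic matching on the Morse complex $T^{\mathcal{M}_{<i}}$, where $\mathcal{M}_{<i}=\bigcup_{j<i}\mathcal{M}_j$; 4. for all arrows $u\to v$ in $\mathcal{M}_i$, $\operatorname{cl}(v)-\operatorname{cl}(u)=i-1$ and $|v|+1=|u|$; 5. there exist $\mathcal{B}_i\subset\mathcal{M}_i$ such that (a) $\mathcal{M}_i=\mathcal{B}_i\cup\{u\cup w\to v\cup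 w\mid \gcd(m_u,m_w)=1\text{ and }u\to v\in\mathcal{B}_i\}$ (with $w$ ranging over cells), and (b) for all arrows $u\to v$ in $\mathcal{B}_i$, $\operatorname{cl}(u)=1$ and $\operatorname{cl}(v)=i$. *)

theory Defs
  imports "HOL-Library.Poly_Mapping" "HOL-Algebra.QuotRing"
begin

section \<open>Polynomial rings and monomials\<close>

text \<open>
  The variables are the elements of a finite linearly ordered type \<open>'x\<close>, so that
  \<open>m = CARD('x)\<close>.  A monomial is represented by its exponent vector, so the monomial
  \<open>1\<close> is the exponent vector \<open>0\<close>, and products and exact quotients of monomials are sums
  and differences of exponent vectors.
\<close>

type_synonym 'x mon = "'x \<Rightarrow>\<^sub>0 nat"

type_synonym ('x, 'k) mpoly = "'x mon \<Rightarrow>\<^sub>0 'k"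

definition mon_poly :: "'x mon \<Rightarrow> ('x, 'k::field) mpoly" where
  "mon_poly a = Poly_Mapping.single a 1"

definition var :: "'x \<Rightarrow> ('x, 'k::field) mpoly" where
  "var x = mon_poly (Poly_Mapping.single x 1)"

lift_definition mon_gcd :: "'x mon \<Rightarrow> 'x mon \<Rightarrow> 'x mon" is
  "\<lambda>a b x. min (a x) (b x)"
  by (rule rev_finite_subset) auto

lift_definition mon_lcm :: "(nat \<Rightarrow> 'x::finite mon) \<Rightarrow> nat set \<Rightarrow> 'x mon" is
  "\<lambda>\<mu> J x. Max (insert 0 ((\<lambda>j. \<mu> j x) ` J))"
  by simp

definition poly_ring :: "('x::{finite,linorder}, 'k::field) mpoly ring" where
  "poly_ring = \<lparr>carrier = UNIV, mult = (*), one = 1, zero = 0, add = (+)\<rparr>"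

definition mon_ideal :: "nat \<Rightarrow> (nat \<Rightarrow> 'x mon) \<Rightarrow> ('x::{finite,linorder}, 'k::field) mpoly set" where
  "mon_ideal r \<mu> = Idl\<^bsub>poly_ring\<^esub> ((\<lambda>j. mon_poly (\<mu> j)) ` {1..r})"

definition irrelevant_ideal :: "('x::{finite,linorder}, 'k::field) mpoly set" where
  "irrelevant_ideal = Idl\<^bsub>poly_ring\<^esub> (range var)"


section \<open>Based complexes and algebraic Morse matchings\<close>

text \<open>
  Based complexes all of whose components are free of rank one.  A homomorphism between two
  such components is multiplication by a ring element, and \<open>bc_diff K \<beta> \<alpha>\<close> is the element
  that gives the component of the differential from \<open>\<alpha>\<close> to \<open>\<beta>\<close>.  It is an isomorphism iff
  that element is a unit.  Only the entries with \<open>\<alpha>\<close> and \<open>\<beta>\<close> in \<open>bc_cells K\<close> matter.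
\<close>

record ('v, 'a) based_complex =
  bc_cells :: "'v set"
  bc_deg :: "'v \<Rightarrow> nat"
  bc_diff :: "'v \<Rightarrow> 'v \<Rightarrow> 'a"

definition bc_edges :: "('v, 'a::comm_ring_1) based_complex \<Rightarrow> ('v \<times> 'v) set" where
  "bc_edges K = {(\<alpha>, \<beta>). \<alpha> \<in> bc_cells K \<and> \<beta> \<in> bc_cells K \<and> bc_diff K \<beta> \<alpha> \<noteq> 0}"

definition morse_graph ::
  "('v, 'a::comm_ring_1) based_complex \<Rightarrow> ('v \<times> 'v) set \<Rightarrow> ('v \<times> 'v) set" where
  "morse_graph K N = (bc_edges K - N) \<union> N\<inverse>"

definition morse_matching ::
  "('v, 'a::comm_ring_1) based_complex \<Rightarrow> ('v \<times> 'v) set \<Rightarrow> bool" where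
  "morse_matching K N \<longleftrightarrow>
     N \<subseteq> bc_edges K \<and>
     (\<forall>(\<alpha>, \<beta>) \<in> N. \<forall>(\<alpha>', \<beta>') \<in> N. (\<alpha>, \<beta>) \<noteq> (\<alpha>', \<beta>') \<longrightarrow> {\<alpha>, \<beta>} \<inter> {\<alpha>', \<beta>'} = {}) \<and>
     (\<forall>(\<alpha>, \<beta>) \<in> N. bc_diff K \<beta> \<alpha> dvd 1) \<and>
     acyclic (morse_graph K N)"

definition unit_inv :: "'a::comm_ring_1 \<Rightarrow> 'a" where
  "unit_inv a = (THE c. c * a = 1)"

text \<open>
  \<open>morse_phi K N \<delta> \<alpha>\<close> is the component from \<open>\<alpha>\<close> to \<open>\<delta>\<close> of the homotopy \<open>\<phi>\<close>.  The
  recursion runs along the reversed graph; its defining equations are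
  \<open>morse_phi_matched\<close> and \<open>morse_phi_unmatched\<close> below.
\<close>

definition morse_phi ::
  "('v, 'a::comm_ring_1) based_complex \<Rightarrow> ('v \<times> 'v) set \<Rightarrow> 'v \<Rightarrow> 'v \<Rightarrow> 'a" where
  "morse_phi K N \<delta> \<alpha> =
     wfrec (((morse_graph K N)\<^sup>+)\<inverse>)
       (\<lambda>f \<alpha> \<delta>.
          if \<exists>\<beta>. (\<beta>, \<alpha>) \<in> N then
            let \<beta> = (THE \<beta>. (\<beta>, \<alpha>) \<in> N); c = unit_inv (bc_diff K \<alpha> \<beta>) in
              (if \<delta> = \<beta> then c else 0) -
              (\<Sum>\<gamma> | (\<beta>, \<gamma>) \<in> bc_edges K \<and> \<gamma> \<noteq> \<alpha>. f \<gamma> \<delta> * bc_diff K \<gamma> \<beta> * c)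
          else 0) \<alpha> \<delta>"

definition morse_complex ::
  "('v, 'a::comm_ring_1) based_complex \<Rightarrow> ('v \<times> 'v) set \<Rightarrow> ('v, 'a) based_complex" where
  "morse_complex K N =
     \<lparr>bc_cells = bc_cells K - Field N,
      bc_deg = bc_deg K,
      bc_diff = (\<lambda>\<beta> \<alpha>. bc_diff K \<beta> \<alpha> -
        (\<Sum>\<gamma>\<in>bc_cells K. \<Sum>\<delta>\<in>bc_cells K.
            bc_diff K \<beta> \<delta> * morse_phi K N \<delta> \<gamma> * bc_diff K \<gamma> \<alpha>))\<rparr>"

text \<open>\<open>morse_iter K M i\<close> is the Morse complex of \<open>M 0, \<dots>, M (i - 1)\<close>.\<close>

primrec morse_iter ::
  "('v, 'a::comm_ring_1) based_complex \<Rightarrow> (nat \<Rightarrow> ('v \<times> 'v) set) \<Rightarrow> nat \<Rightarrow> ('v, 'a) based_complex"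
where
  "morse_iter K M 0 = K"
| "morse_iter K M (Suc i) = morse_complex (morse_iter K M i) (M i)"

text \<open>
  The iterated Morse complex of a whole sequence of matchings, only finitely many of which are
  nonempty (as is always the case when there are finitely many cells).
\<close>

definition morse_iter_all ::
  "('v, 'a::comm_ring_1) based_complex \<Rightarrow> (nat \<Rightarrow> ('v \<times> 'v) set) \<Rightarrow> ('v, 'a) based_complex"
where
  "morse_iter_all K M = morse_iter K M (LEAST n. \<forall>i\<ge>n. M i = {})"

lemma wf_morse_graph:
  assumes "finite (bc_cells K)" "morse_matching K N"
  shows "wf (((morse_graph K N)\<^sup>+)\<inverse>)"
proof -
  have "bc_edges K \<subseteq> bc_cells K \<times> bc_cells K"
    by (auto simp: bc_edges_def)
  moreover have "N \<subseteq> bc_edges K"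
    using assms(2) by (simp add: morse_matching_def)
  ultimately have "morse_graph K N \<subseteq> bc_cells K \<times> bc_cells K"
    unfolding morse_graph_def by auto
  then have "finite (morse_graph K N)"
    using assms(1) by (meson finite_SigmaI finite_subset)
  moreover have "acyclic (morse_graph K N)"
    using assms(2) by (simp add: morse_matching_def)
  ultimately have "wf ((morse_graph K N)\<inverse>)"
    by (rule finite_acyclic_wf_converse)
  then show ?thesis
    by (simp add: wf_trancl flip: trancl_converse)
qed

lemma morse_matching_source_unique:
  assumes "morse_matching K N" "(\<beta>, \<alpha>) \<in> N" "(\<beta>', \<alpha>') \<in> N" "\<beta> = \<beta>' \<or> \<alpha> = \<alpha>'"
  shows "\<beta> = \<beta>' \<and> \<alpha> = \<alpha>'"
  using assms unfolding morse_matching_def by fastforce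

lemma morse_phi_unmatched:
  assumes "finite (bc_cells K)" "morse_matching K N" "\<nexists>\<beta>. (\<beta>, \<alpha>) \<in> N"
  shows "morse_phi K N \<delta> \<alpha> = 0"
  using assms(3) unfolding morse_phi_def
  by (subst wfrec[OF wf_morse_graph[OF assms(1,2)]]) simp

lemma morse_phi_matched:
  assumes "finite (bc_cells K)" "morse_matching K N" "(\<beta>, \<alpha>) \<in> N"
  shows "morse_phi K N \<delta> \<alpha> =
    (if \<delta> = \<beta> then unit_inv (bc_diff K \<alpha> \<beta>) else 0) -
    (\<Sum>\<gamma> | (\<beta>, \<gamma>) \<in> bc_edges K \<and> \<gamma> \<noteq> \<alpha>.
       morse_phi K N \<delta> \<gamma> * bc_diff K \<gamma> \<beta> * unit_inv (bc_diff K \<alpha> \<beta>))"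
proof -
  have the: "(THE \<beta>. (\<beta>, \<alpha>) \<in> N) = \<beta>"
    using morse_matching_source_unique[OF assms(2,3)] assms(3) by blast
  have ex: "\<exists>\<beta>. (\<beta>, \<alpha>) \<in> N"
    using assms(3) by blast
  have rel: "(\<gamma>, \<alpha>) \<in> ((morse_graph K N)\<^sup>+)\<inverse>" if "(\<beta>, \<gamma>) \<in> bc_edges K" "\<gamma> \<noteq> \<alpha>" for \<gamma>
  proof -
    have "(\<beta>, \<gamma>) \<notin> N"
      using morse_matching_source_unique[OF assms(2,3)] that(2) by blast
    then have "(\<beta>, \<gamma>) \<in> morse_graph K N" "(\<alpha>, \<beta>) \<in> morse_graph K N"
      using that(1) assms(3) by (auto simp: morse_graph_def)
    then show ?thesis
      by (meson converse_iff r_into_trancl trancl_into_trancl2)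
  qed
  show ?thesis
    unfolding morse_phi_def
    by (subst wfrec[OF wf_morse_graph[OF assms(1,2)]])
       (use rel in \<open>auto simp: ex the Let_def cut_def intro!: sum.cong\<close>)
qed


section \<open>Simplicial resolutions\<close>

text \<open>
  \<open>simplicial_res \<mu> \<Delta>\<close> is \<open>F\<^sub>\<Delta>\<close> for the monomials \<open>\<mu> 1, \<dots>, \<mu> r\<close>: if \<open>j\<close> is the \<open>i\<close>-th element
  of \<open>J\<close>, then \<open>J\<close> has \<open>i - 1\<close> elements below \<open>j\<close>, and \<open>(-1)^(i + 1) = (-1)^(i - 1)\<close>.
\<close>

definition simplicial_coeff ::
  "(nat \<Rightarrow> 'x::{finite,linorder} mon) \<Rightarrow> nat set \<Rightarrow> nat set \<Rightarrow> ('x, 'k::field) mpoly" where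
  "simplicial_coeff \<mu> L J =
     (\<Sum>j | j \<in> J \<and> L = J - {j}. (-1) ^ card {l \<in> J. l < j} * mon_poly (mon_lcm \<mu> J - mon_lcm \<mu> L))"

definition simplicial_res ::
  "(nat \<Rightarrow> 'x mon) \<Rightarrow> nat set set \<Rightarrow> (nat set, ('x::{finite,linorder}, 'k::field) mpoly) based_complex" where
  "simplicial_res \<mu> \<Delta> = \<lparr>bc_cells = \<Delta>, bc_deg = card, bc_diff = simplicial_coeff \<mu>\<rparr>"

abbreviation taylor_res ::
  "nat \<Rightarrow> (nat \<Rightarrow> 'x mon) \<Rightarrow> (nat set, ('x::{finite,linorder}, 'k::field) mpoly) based_complex" where
  "taylor_res r \<mu> \<equiv> simplicial_res \<mu> (Pow {1..r})"

definition simplicial_complex_on :: "nat set \<Rightarrow> nat set set \<Rightarrow> bool" where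
  "simplicial_complex_on V \<Delta> \<longleftrightarrow> \<Delta> \<subseteq> Pow V \<and> (\<forall>J\<in>\<Delta>. \<forall>L. L \<subseteq> J \<longrightarrow> L \<in> \<Delta>)"

text \<open>
  The chain modules: an element is a family of coefficients indexed by the cells, extended by zero.
\<close>

definition bc_chains :: "('v, 'a::comm_ring_1) based_complex \<Rightarrow> nat \<Rightarrow> ('v \<Rightarrow> 'a) set" where
  "bc_chains K n = {f. \<forall>\<alpha>. f \<alpha> \<noteq> 0 \<longrightarrow> \<alpha> \<in> bc_cells K \<and> bc_deg K \<alpha> = n}"

definition bc_boundary :: "('v, 'a::comm_ring_1) based_complex \<Rightarrow> ('v \<Rightarrow> 'a) \<Rightarrow> 'v \<Rightarrow> 'a" where
  "bc_boundary K f = (\<lambda>\<beta>. if \<beta> \<in> bc_cells K then \<Sum>\<alpha>\<in>bc_cells K. bc_diff K \<beta> \<alpha> * f \<alpha> else 0)"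

text \<open>
  \<open>K\<close> is a (free) resolution of \<open>S/I\<close>: exact in positive degrees, with an \<open>S\<close>-linear surjection
  \<open>\<epsilon>\<close> from degree \<open>0\<close> onto \<open>S/I\<close> whose kernel is the image of degree \<open>1\<close>.
\<close>

definition free_resolution ::
  "('v, ('x::{finite,linorder}, 'k::field) mpoly) based_complex \<Rightarrow> ('x, 'k) mpoly set \<Rightarrow> bool" where
  "free_resolution K I \<longleftrightarrow>
     (\<forall>n. {f \<in> bc_chains K (Suc n). bc_boundary K f = (\<lambda>_. 0)}
            = bc_boundary K ` bc_chains K (Suc (Suc n))) \<and>
     (\<exists>\<epsilon>.
        (\<forall>f\<in>bc_chains K 0. \<forall>g\<in>bc_chains K 0.
            \<epsilon> (\<lambda>\<alpha>. f \<alpha> + g \<alpha>) = \<epsilon> f \<oplus>\<^bsub>poly_ring Quot I\<^esub> \<epsilon> g) \<and>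
        (\<forall>f\<in>bc_chains K 0. \<forall>s.
            \<epsilon> (\<lambda>\<alpha>. s * f \<alpha>) = (I +>\<^bsub>poly_ring\<^esub> s) \<otimes>\<^bsub>poly_ring Quot I\<^esub> \<epsilon> f) \<and>
        \<epsilon> ` bc_chains K 0 = carrier (poly_ring Quot I) \<and>
        {f \<in> bc_chains K 0. \<epsilon> f = \<zero>\<^bsub>poly_ring Quot I\<^esub>} = bc_boundary K ` bc_chains K 1)"

definition minimal_complex ::
  "('v, ('x::{finite,linorder}, 'k::field) mpoly) based_complex \<Rightarrow> bool" where
  "minimal_complex K \<longleftrightarrow>
     (\<forall>n. \<forall>f\<in>bc_chains K n. \<forall>\<beta>. bc_boundary K f \<beta> \<in> irrelevant_ideal)"

definition simplicially_resolvable ::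
  "'k::field itself \<Rightarrow> nat \<Rightarrow> (nat \<Rightarrow> 'x::{finite,linorder} mon) \<Rightarrow> bool" where
  "simplicially_resolvable _ r \<mu> \<longleftrightarrow>
     (\<exists>\<Delta>. simplicial_complex_on {1..r} \<Delta> \<and>
        (let F = simplicial_res \<mu> \<Delta> :: (nat set, ('x, 'k) mpoly) based_complex in
           free_resolution F (mon_ideal r \<mu>) \<and> minimal_complex F))"


section \<open>Standard matchings\<close>

text \<open>
  The equivalence relation is taken to be reflexive on \<open>J\<close>, which only matters for
  generators equal to \<open>1\<close>.
\<close>

definition cl :: "(nat \<Rightarrow> 'x mon) \<Rightarrow> nat set \<Rightarrow> nat" where
  "cl \<mu> J = card (J // {(i, j). i \<in> J \<and> j \<in> J \<and> mon_gcd (\<mu> i) (\<mu> j) \<noteq> 0}\<^sup>*)"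

definition standard_matching ::
  "'k::field itself \<Rightarrow> nat \<Rightarrow> (nat \<Rightarrow> 'x::{finite,linorder} mon) \<Rightarrow>
   (nat \<Rightarrow> (nat set \<times> nat set) set) \<Rightarrow> bool" where
  "standard_matching _ r \<mu> M \<longleftrightarrow>
     (let T = taylor_res r \<mu> :: (nat set, ('x, 'k) mpoly) based_complex in
       (\<forall>i. \<forall>(u, v) \<in> M i. mon_lcm \<mu> u = mon_lcm \<mu> v) \<and>
       (\<forall>(u, v) \<in> bc_edges (morse_iter_all T M). mon_lcm \<mu> u \<noteq> mon_lcm \<mu> v) \<and>
       (\<forall>i. morse_matching (morse_iter T M i) (M i)) \<and>
       (\<forall>i. \<forall>(u, v) \<in> M i.
          int (cl \<mu> v) - int (cl \<mu> u) = int i - 1 \<and> card v + 1 = card u) \<and>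
       (\<forall>i. \<exists>B \<subseteq> M i.
          M i = B \<union> {(u \<union> w, v \<union> w) | u v w.
                       w \<subseteq> {1..r} \<and> mon_gcd (mon_lcm \<mu> u) (mon_lcm \<mu> w) = 0 \<and> (u, v) \<in> B} \<and>
          (\<forall>(u, v) \<in> B. cl \<mu> u = 1 \<and> cl \<mu> v = i)))"


section \<open>Differential graded algebras and Massey products\<close>

text \<open>
  Homologically graded: \<open>dg_diff\<close> maps \<open>dg_part (n + 1)\<close> to \<open>dg_part n\<close>.
\<close>

record 'a dga = "'a ring" +
  dg_part :: "nat \<Rightarrow> 'a set"
  dg_diff :: "'a \<Rightarrow> 'a"

definition sign_power :: "('a, 'b) ring_scheme \<Rightarrow> nat \<Rightarrow> 'a \<Rightarrow> 'a" where
  "sign_power R n a = (if even n then a else \<ominus>\<^bsub>R\<^esub> a)"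

definition dg_cycles :: "('a, 'b) dga_scheme \<Rightarrow> nat \<Rightarrow> 'a set" where
  "dg_cycles A n = {a \<in> dg_part A n. dg_diff A a = \<zero>\<^bsub>A\<^esub>}"

definition dg_boundaries :: "('a, 'b) dga_scheme \<Rightarrow> nat \<Rightarrow> 'a set" where
  "dg_boundaries A n = dg_diff A ` dg_part A (Suc n)"

text \<open>Homology classes are cosets of the boundaries.\<close>

definition dg_class :: "('a, 'b) dga_scheme \<Rightarrow> nat \<Rightarrow> 'a \<Rightarrow> 'a set" where
  "dg_class A n a = dg_boundaries A n +>\<^bsub>A\<^esub> a"

definition dg_homology :: "('a, 'b) dga_scheme \<Rightarrow> nat \<Rightarrow> 'a set set" where
  "dg_homology A n = dg_class A n ` dg_cycles A n"

text \<open>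
  Below, \<open>\<alpha> l\<close> is a class of degree \<open>p l\<close>, and the indices \<open>s < t\<close> stand for the sequence
  \<open>\<alpha> (s + 1), \<dots>, \<alpha> t\<close>.  An element \<open>a i j\<close> of a defining system has degree
  \<open>p (i + 1) + \<dots> + p j + (j - i - 1)\<close>.
\<close>

definition massey_elem_deg :: "(nat \<Rightarrow> nat) \<Rightarrow> nat \<Rightarrow> nat \<Rightarrow> nat" where
  "massey_elem_deg p i j = (\<Sum>l\<in>{i<..j}. p l) + (j - i - 1)"

definition massey_sum ::
  "('a, 'b) dga_scheme \<Rightarrow> (nat \<Rightarrow> nat) \<Rightarrow> (nat \<Rightarrow> nat \<Rightarrow> 'a) \<Rightarrow> nat \<Rightarrow> nat \<Rightarrow> 'a" where
  "massey_sum A p a i j =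
     (\<Oplus>\<^bsub>A\<^esub>l\<in>{i<..<j}. sign_power A (massey_elem_deg p i l + 1) (a i l) \<otimes>\<^bsub>A\<^esub> a l j)"

definition defining_system ::
  "('a, 'b) dga_scheme \<Rightarrow> (nat \<Rightarrow> nat) \<Rightarrow> (nat \<Rightarrow> 'a set) \<Rightarrow> nat \<Rightarrow> nat \<Rightarrow>
   (nat \<Rightarrow> nat \<Rightarrow> 'a) \<Rightarrow> bool" where
  "defining_system A p \<alpha> s t a \<longleftrightarrow>
     (\<forall>i\<in>{s<..t}. a (i - 1) i \<in> dg_cycles A (p i) \<and> dg_class A (p i) (a (i - 1) i) = \<alpha> i) \<and>
     (\<forall>i j. s \<le> i \<and> i + 1 < j \<and> j \<le> t \<and> (i, j) \<noteq> (s, t) \<longrightarrow>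
        a i j \<in> dg_part A (massey_elem_deg p i j) \<and> dg_diff A (a i j) = massey_sum A p a i j)"

definition massey_deg :: "(nat \<Rightarrow> nat) \<Rightarrow> nat \<Rightarrow> nat \<Rightarrow> nat" where
  "massey_deg p s t = (\<Sum>l\<in>{s<..t}. p l) + (t - s - 2)"

text \<open>
  The length 2 product is the product in homology, without the sign that the general formula
  would introduce.
\<close>

definition massey_product ::
  "('a, 'b) dga_scheme \<Rightarrow> (nat \<Rightarrow> nat) \<Rightarrow> (nat \<Rightarrow> 'a set) \<Rightarrow> nat \<Rightarrow> nat \<Rightarrow> 'a set set" where
  "massey_product A p \<alpha> s t =
     (if t = s + 2
      then {dg_class A (massey_deg p s t) (a \<otimes>\<^bsub>A\<^esub> b) | a b. a \<in> \<alpha> (s + 1) \<and> b \<in> \<alpha> (s + 2)}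
      else {dg_class A (massey_deg p s t) (massey_sum A p a s t) | a. defining_system A p \<alpha> s t a})"

definition massey_trivial ::
  "('a, 'b) dga_scheme \<Rightarrow> (nat \<Rightarrow> nat) \<Rightarrow> (nat \<Rightarrow> 'a set) \<Rightarrow> nat \<Rightarrow> nat \<Rightarrow> bool" where
  "massey_trivial A p \<alpha> s t \<longleftrightarrow> dg_class A (massey_deg p s t) \<zero>\<^bsub>A\<^esub> \<in> massey_product A p \<alpha> s t"

inductive massey_defined ::
  "('a, 'b) dga_scheme \<Rightarrow> (nat \<Rightarrow> nat) \<Rightarrow> (nat \<Rightarrow> 'a set) \<Rightarrow> nat \<Rightarrow> nat \<Rightarrow> bool"
  for A :: "('a, 'b) dga_scheme" and p :: "nat \<Rightarrow> nat" and \<alpha> :: "nat \<Rightarrow> 'a set"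
where
  massey_defined_2: "massey_defined A p \<alpha> s (s + 2)"
| massey_defined_higher: "s + 3 \<le> t \<Longrightarrow>
    (\<And>i j. s \<le> i \<Longrightarrow> i + 2 \<le> j \<Longrightarrow> j \<le> t \<Longrightarrow> (i, j) \<noteq> (s, t) \<Longrightarrow>
       massey_defined A p \<alpha> i j \<and> massey_trivial A p \<alpha> i j) \<Longrightarrow>
    massey_defined A p \<alpha> s t"


section \<open>The Koszul dga\<close>

text \<open>
  The exterior algebra over a commutative ring \<open>R\<close> on generators \<open>e\<^sub>x\<close> indexed by \<open>'x\<close>, with
  \<open>d e\<^sub>x = y x\<close>.  An element is the family of its coefficients with respect to the basis
  \<open>e\<^sub>A = e\<^bsub>x\<^sub>1\<^esub> \<cdots> e\<^bsub>x\<^sub>n\<^esub>\<close> for \<open>A = {x\<^sub>1 < \<cdots> < x\<^sub>n}\<close>.  For disjoint \<open>A\<close> and \<open>B\<close> one has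
  \<open>e\<^sub>A e\<^sub>B = (-1)^(koszul_inv A B) e\<^bsub>A \<union> B\<^esub>\<close>.
\<close>

definition koszul_inv :: "'x::linorder set \<Rightarrow> 'x set \<Rightarrow> nat" where
  "koszul_inv A B = card {(a, b). a \<in> A \<and> b \<in> B \<and> b < a}"

definition koszul_dga ::
  "('r, 'b) ring_scheme \<Rightarrow> ('x::{finite,linorder} \<Rightarrow> 'r) \<Rightarrow> ('x set \<Rightarrow> 'r) dga" where
  "koszul_dga R y =
     \<lparr>carrier = {f. \<forall>A. f A \<in> carrier R},
      mult = (\<lambda>f g C. \<Oplus>\<^bsub>R\<^esub>A\<in>Pow C. sign_power R (koszul_inv A (C - A)) (f A \<otimes>\<^bsub>R\<^esub> g (C - A))),
      one = (\<lambda>A. if A = {} then \<one>\<^bsub>R\<^esub> else \<zero>\<^bsub>R\<^esub>),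
      zero = (\<lambda>A. \<zero>\<^bsub>R\<^esub>),
      add = (\<lambda>f g A. f A \<oplus>\<^bsub>R\<^esub> g A),
      dg_part = (\<lambda>n. {f. (\<forall>A. f A \<in> carrier R) \<and> (\<forall>A. card A \<noteq> n \<longrightarrow> f A = \<zero>\<^bsub>R\<^esub>)}),
      dg_diff = (\<lambda>f B. \<Oplus>\<^bsub>R\<^esub>x\<in>- B. sign_power R (card {b \<in> B. b < x}) (y x \<otimes>\<^bsub>R\<^esub> f (insert x B)))\<rparr>"

text \<open>
  For \<open>R = S/I\<close>, the tensor product of \<open>R\<close> with the Koszul resolution \<open>koszul_dga poly_ring var\<close>
  of \<open>k\<close> over \<open>S\<close> is the Koszul dga over \<open>R\<close> on the residue classes of the variables, since the
  underlying \<open>S\<close>-modules are free on the \<open>e\<^sub>A\<close>.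
\<close>

definition koszul_quot ::
  "('x::{finite,linorder}, 'k::field) mpoly set \<Rightarrow> ('x set \<Rightarrow> ('x, 'k) mpoly set) dga" where
  "koszul_quot I = koszul_dga (poly_ring Quot I) (\<lambda>x. I +>\<^bsub>poly_ring\<^esub> var x)"

end

theory Submission
  imports Defs "HOL-Library.Function_Algebras"
begin

text \<open>
  Let \<open>A = T \<otimes> k\<close> for the Taylor resolution \<open>T\<close>.  It is a dga over \<open>k\<close> with basis the cells
  \<open>u\<^sub>J\<close>: the product of \<open>u\<^sub>J\<close> and \<open>u\<^sub>L\<close> is \<open>\<plusminus> u\<^bsub>J \<union> L\<^esub>\<close> if \<open>J\<close> and \<open>L\<close> are disjoint and
  \<open>m\<^sub>J\<close> and \<open>m\<^sub>L\<close> are coprime, and \<open>0\<close> otherwise, and the differential retains the faces that have the same lcm.  A standard matching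
  singles out the span \<open>U\<close> of the sources of its arrows, and the theorem rests on two properties
  of \<open>U\<close>.

  \<^item> \<open>U\<close> is an ideal of \<open>A\<close>, because every \<open>\<M>\<^sub>i\<close> is closed under adding a coprime cell to both ends
    of an arrow (\<open>standard_matching_union\<close>, \<open>source_ideal_mult\<close>).

  \<^item> \<open>U\<close> is a complement of the space of cycles of \<open>A\<close>.  Passing to a Morse complex is Gaussian
    elimination: it splits off the sources together with their boundaries.  Once all matchings have
    been used, the remaining differential vanishes modulo the variables
    (\<open>iterated_sources_complement_cycles\<close>, \<open>standard_matching_sources\<close>).

  Hence \<open>U + dU\<close> is an acyclic dg ideal whose quotient has zero differential, so \<open>A\<close> is formal.  For
  Massey products this can be used without forming the quotient.  If the products of consecutive
  cycles bound, then they bound elements of \<open>U\<close>.  From then on, every sum that the next element of a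
  defining system has to bound lies in the ideal \<open>U\<close> and is a cycle.  A cycle in \<open>U\<close> is zero, so the
  defining system can be completed, and its last sum bounds as well (\<open>massey_system_exists\<close>).

  The algebra \<open>A\<close> is related to the Koszul dga of \<open>R = S/I\<close> by the dga \<open>D = T \<otimes>\<^sub>S K\<^sub>S\<close>, which maps onto
  both with acyclic kernels.  The argument is carried out in \<open>D\<close>, with \<open>U\<close> replaced by its preimage
  (\<open>source_ideal\<close>), and its outcome is then projected to the Koszul dga.  All of \<open>D\<close> lives in one
  exterior algebra over \<open>S\<close>, with a generator for each \<open>m\<^sub>j\<close> and for each variable and with \<open>d = 1\<close> on
  every generator: \<open>u\<^sub>J \<otimes> e\<^sub>A\<close> becomes the exterior monomial on \<open>J\<close> and \<open>A\<close> multiplied by \<open>m\<^sub>J\<close> and by the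
  product of the variables in \<open>A\<close>.  In each multidegree, \<open>D\<close> and the two kernels are then ordinary
  chain complexes of finite simplicial complexes.  Those belonging to the kernels are cones, as soon
  as one of the two groups of vertices is held fixed, which makes the kernels acyclic
  (\<open>cone_acyclic\<close>).
\<close>

section \<open>The exterior algebra and its contraction\<close>

text \<open>
  Elements of the exterior algebra are families of coefficients indexed by sets of vertices.  The
  sign \<open>esign A B\<close> is the one in the product of the basis elements of \<open>A\<close> and \<open>B\<close>, and \<open>esign {x} B\<close> is
  at the same time the sign with which the contraction maps \<open>B \<union> {x}\<close> to \<open>B\<close>.
\<close>

definition esign :: "'v::linorder set \<Rightarrow> 'v set \<Rightarrow> 'a::comm_ring_1" where
  "esign A B = (-1) ^ koszul_inv A B"

definition ext_mult :: "('v::linorder set \<Rightarrow> 'a::comm_ring_1) \<Rightarrow> ('v set \<Rightarrow> 'a) \<Rightarrow> 'v set \<Rightarrow> 'a" where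
  "ext_mult f g C = (\<Sum>A\<in>Pow C. esign A (C - A) * (f A * g (C - A)))"

definition ext_diff :: "'v::linorder set \<Rightarrow> ('v set \<Rightarrow> 'a::comm_ring_1) \<Rightarrow> 'v set \<Rightarrow> 'a" where
  "ext_diff V f C = (\<Sum>x\<in>V - C. esign {x} C * f (insert x C))"

lemma esign_square: "esign A B * esign A B = 1"
  by (simp add: esign_def flip: power_add mult_2)

lemma esign_square_left: "esign A B * (esign A B * c) = c"
  by (simp add: esign_square flip: mult.assoc)

lemma koszul_inv_un_left:
  assumes "finite A" "finite B" "finite C" "A \<inter> B = {}"
  shows "koszul_inv (A \<union> B) C = koszul_inv A C + koszul_inv B C"
proof -
  have "{(a, b). a \<in> A \<union> B \<and> b \<in> C \<and> b < a}
      = {(a, b). a \<in> A \<and> b \<in> C \<and> b < a} \<union> {(a, b). a \<in> B \<and> b \<in> C \<and> b < a}"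
    by auto
  moreover have "finite {(a, b). a \<in> X \<and> b \<in> C \<and> b < a}" if "finite X" for X
    by (rule finite_subset[of _ "X \<times> C"]) (use that assms in auto)
  moreover have "{(a, b). a \<in> A \<and> b \<in> C \<and> b < a} \<inter> {(a, b). a \<in> B \<and> b \<in> C \<and> b < a} = {}"
    using assms(4) by auto
  ultimately show ?thesis
    unfolding koszul_inv_def using assms by (simp add: card_Un_disjoint)
qed

lemma koszul_inv_un_right:
  assumes "finite A" "finite B" "finite C" "B \<inter> C = {}"
  shows "koszul_inv A (B \<union> C) = koszul_inv A B + koszul_inv A C"
proof -
  have "{(a, b). a \<in> A \<and> b \<in> B \<union> C \<and> b < a}
      = {(a, b). a \<in> A \<and> b \<in> B \<and> b < a} \<union> {(a, b). a \<in> A \<and> b \<in> C \<and> b < a}"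
    by auto
  moreover have "finite {(a, b). a \<in> A \<and> b \<in> X \<and> b < a}" if "finite X" for X
    by (rule finite_subset[of _ "A \<times> X"]) (use that assms in auto)
  moreover have "{(a, b). a \<in> A \<and> b \<in> B \<and> b < a} \<inter> {(a, b). a \<in> A \<and> b \<in> C \<and> b < a} = {}"
    using assms(4) by auto
  ultimately show ?thesis
    unfolding koszul_inv_def using assms by (simp add: card_Un_disjoint)
qed

lemma koszul_inv_singleton_left: "koszul_inv {x} B = card {b \<in> B. b < x}"
proof -
  have "{(a, b). a \<in> {x} \<and> b \<in> B \<and> b < a} = Pair x ` {b \<in> B. b < x}" by auto
  then show ?thesis unfolding koszul_inv_def by (simp add: card_image inj_on_def)
qed

lemma koszul_inv_singleton_right: "koszul_inv A {x} = card {a \<in> A. x < a}"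
proof -
  have "{(a, b). a \<in> A \<and> b \<in> {x} \<and> b < a} = (\<lambda>a. (a, x)) ` {a \<in> A. x < a}" by auto
  then show ?thesis unfolding koszul_inv_def by (simp add: card_image inj_on_def)
qed

lemma esign_un_left:
  assumes "finite A" "finite B" "finite C" "A \<inter> B = {}"
  shows "esign (A \<union> B) C = esign A C * esign B C"
  using assms by (simp add: esign_def koszul_inv_un_left power_add)

lemma esign_un_right:
  assumes "finite A" "finite B" "finite C" "B \<inter> C = {}"
  shows "esign A (B \<union> C) = esign A B * esign A C"
  using assms by (simp add: esign_def koszul_inv_un_right power_add)

lemma esign_insert_left:
  assumes "finite A" "finite C" "x \<notin> A"
  shows "esign (insert x A) C = esign {x} C * esign A C"
  using esign_un_left[of "{x}" A C] assms by simp

lemma esign_insert_right: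
  assumes "finite A" "finite B" "x \<notin> B"
  shows "esign A (insert x B) = esign A {x} * esign A B"
  using esign_un_right[of A "{x}" B] assms by simp

lemma esign_swap_singleton:
  assumes "finite A" "x \<notin> A"
  shows "esign A {x} = (-1) ^ card A * esign {x} A"
proof -
  have "card A = card ({a \<in> A. x < a} \<union> {a \<in> A. a < x})"
    using assms(2) by (intro arg_cong[of _ _ card]) (auto dest: not_less_iff_gr_or_eq[THEN iffD1])
  also have "\<dots> = koszul_inv A {x} + koszul_inv {x} A"
    unfolding koszul_inv_singleton_left koszul_inv_singleton_right
    using assms(1) by (intro card_Un_disjoint) auto
  finally have "(-1) ^ card A * esign {x} A = esign A {x} * (esign {x} A * esign {x} A)"
    by (simp add: esign_def power_add mult.assoc)
  from this[symmetric] show ?thesis by (simp only: esign_square mult_1_right)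
qed

lemma esign_singletons:
  assumes "x \<noteq> y"
  shows "esign {x} {y} = - esign {y} {x}"
  using esign_swap_singleton[of "{x}" y] assms by simp

lemma ext_mult_add_left: "ext_mult (f + g) h = ext_mult f h + ext_mult g h"
  by (rule ext) (simp add: ext_mult_def algebra_simps sum.distrib)

lemma ext_mult_add_right: "ext_mult h (f + g) = ext_mult h f + ext_mult h g"
  by (rule ext) (simp add: ext_mult_def algebra_simps sum.distrib)

lemma ext_diff_add: "ext_diff V (f + g) = ext_diff V f + ext_diff V g"
  by (rule ext) (simp add: ext_diff_def algebra_simps sum.distrib)

text \<open>
  Both sides are sums over the ordered partitions of \<open>C\<close> into three parts.  The signs agree because
  inversions are counted additively over disjoint unions.
\<close>

lemma ext_mult_assoc: "ext_mult (ext_mult f g) h = ext_mult f (ext_mult g h)"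
proof
  fix C :: "'a set"
  show "ext_mult (ext_mult f g) h C = ext_mult f (ext_mult g h) C"
  proof (cases "finite C")
    case False
    then show ?thesis by (simp add: ext_mult_def)
  next
    case fin: True
    let ?L = "\<lambda>B A. esign B (C - B) * (esign A (B - A) * (f A * g (B - A)) * h (C - B))"
    let ?R = "\<lambda>A E. esign A (C - A) * (f A * (esign E (C - A - E) * (g E * h (C - A - E))))"
    have "ext_mult (ext_mult f g) h C = (\<Sum>B\<in>Pow C. \<Sum>A\<in>Pow B. ?L B A)"
      by (simp add: ext_mult_def sum_distrib_left sum_distrib_right)
    also have "\<dots> = (\<Sum>(B, A)\<in>Sigma (Pow C) Pow. ?L B A)"
      using fin by (intro sum.Sigma) (auto intro: finite_subset)
    also have "\<dots> = (\<Sum>(A, E)\<in>Sigma (Pow C) (\<lambda>A. Pow (C - A)). ?R A E)"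
    proof (rule sum.reindex_bij_witness[of _ "\<lambda>(A, E). (A \<union> E, A)" "\<lambda>(B, A). (A, B - A)"])
      fix z assume "z \<in> Sigma (Pow C) (Pow :: 'a set \<Rightarrow> 'a set set)"
      then obtain B A where z: "z = (B, A)" "B \<subseteq> C" "A \<subseteq> B" by auto
      define E F where "E = B - A" and "F = C - B"
      have eqs: "B = A \<union> E" "C - A = E \<union> F" "C - A - E = F" "B - A = E" "C - B = F"
        using z by (auto simp: E_def F_def)
      have f: "finite A" "finite E" "finite F" "A \<inter> E = {}" "E \<inter> F = {}"
        using z fin by (auto simp: E_def F_def intro: finite_subset)
      have L: "?L B A = esign B F * (esign A E * (f A * g E) * h F)"
        unfolding E_def F_def ..
      have R: "?R A E = esign A (E \<union> F) * (f A * (esign E F * (g E * h F)))"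
        by (simp only: eqs(3), simp only: eqs(2))
      have "?R A E = ?L B A"
        unfolding L R unfolding eqs(1) by (simp add: esign_un_left[OF f(1,2,3,4)] esign_un_right[OF f(1,2,3,5)] ac_simps)
      then show "(case (case z of (B, A) \<Rightarrow> (A, B - A)) of (A, E) \<Rightarrow> ?R A E) = (case z of (B, A) \<Rightarrow> ?L B A)"
        by (simp add: z E_def)
    qed auto
    also have "\<dots> = (\<Sum>A\<in>Pow C. \<Sum>E\<in>Pow (C - A). ?R A E)"
      using fin by (intro sum.Sigma[symmetric]) auto
    also have "\<dots> = ext_mult f (ext_mult g h) C"
      by (simp add: ext_mult_def sum_distrib_left)
    finally show ?thesis .
  qed
qed

text \<open>
  The terms that remove \<open>x\<close> and \<open>y\<close> in the two possible orders cancel.  Summing over pairs with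
  \<open>x < y\<close> keeps the argument valid in characteristic two.
\<close>

lemma ext_diff_diff:
  assumes "finite V" "finite C"
  shows "ext_diff V (ext_diff V f) C = 0"
proof -
  define G where "G = (\<lambda>x y. esign {x} C * (esign {y} (insert x C) * f (insert y (insert x C))))"
  have swap: "G y x = - G x y" if "x < y" "x \<notin> C" "y \<notin> C" for x y
  proof -
    have e: "esign {y} (insert x C) = - esign {x} {y} * (esign {y} C :: 'b)"
      "esign {x} (insert y C) = esign {x} {y} * (esign {x} C :: 'b)"
      using that assms esign_insert_right[of "{y}" C x] esign_insert_right[of "{x}" C y]
      by (simp_all add: esign_singletons[of y x])
    show ?thesis
      unfolding G_def e by (simp add: insert_commute ac_simps)
  qed
  have "ext_diff V (ext_diff V f) C = (\<Sum>x\<in>V - C. \<Sum>y\<in>V - insert x C. G x y)"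
    by (simp add: ext_diff_def G_def sum_distrib_left)
  also have "\<dots> = (\<Sum>(x, y)\<in>Sigma (V - C) (\<lambda>x. V - insert x C). G x y)"
    using assms by (intro sum.Sigma) auto
  also have "Sigma (V - C) (\<lambda>x. V - insert x C)
      = {(x, y). x \<in> V - C \<and> y \<in> V - C \<and> x < y} \<union> {(x, y). x \<in> V - C \<and> y \<in> V - C \<and> y < x}"
    (is "_ = ?P \<union> ?Q") by (auto dest: not_less_iff_gr_or_eq[THEN iffD1])
  also have "(\<Sum>(x, y)\<in>?P \<union> ?Q. G x y) = (\<Sum>(x, y)\<in>?P. G x y) + (\<Sum>(x, y)\<in>?Q. G x y)"
  proof (rule sum.union_disjoint)
    show "finite ?P" "finite ?Q" by (rule finite_subset[of _ "V \<times> V"]; use assms in auto)+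
  qed auto
  also have "(\<Sum>(x, y)\<in>?Q. G x y) = (\<Sum>(x, y)\<in>?P. - G x y)"
    by (rule sum.reindex_bij_witness[of _ prod.swap prod.swap]) (auto simp: swap)
  also have "(\<Sum>(x, y)\<in>?P. G x y) + (\<Sum>(x, y)\<in>?P. - G x y) = 0"
    by (simp add: case_prod_unfold sum_negf)
  finally show ?thesis .
qed

lemma ext_diff_diff_0:
  assumes "finite V" "\<And>C. f C \<noteq> 0 \<Longrightarrow> finite C"
  shows "ext_diff V (ext_diff V f) = 0"
proof
  fix C :: "'a set"
  have "ext_diff V (ext_diff V f) C = 0" if "infinite C"
  proof -
    have "f (insert y (insert x C)) = 0" for x y
      using assms(2)[of "insert y (insert x C)"] that by auto
    then show ?thesis by (simp add: ext_diff_def)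
  qed
  then show "ext_diff V (ext_diff V f) C = 0 C"
    using ext_diff_diff[OF assms(1)] by auto
qed

text \<open>
  On the right, a vertex \<open>x\<close> that is contracted in one factor may occur in the other factor.  These
  terms are absent on the left; they occur once in each of the two summands, with opposite signs.
\<close>

lemma ext_diff_mult:
  assumes "finite V" "finite C" and hom: "\<And>A. f A \<noteq> 0 \<Longrightarrow> card A = m"
  shows "ext_diff V (ext_mult f g) C
       = ext_mult (ext_diff V f) g C + (-1) ^ m * ext_mult f (ext_diff V g) C"
proof -
  have finS: "finite A" if "A \<subseteq> C" for A using that assms(2) finite_subset by blast
  define P where "P = (\<lambda>A x. esign A (C - A) * (esign {x} A * f (insert x A) * g (C - A)))"
  define Q where "Q = (\<lambda>A x. (-1) ^ card A * esign A (C - A) * (f A * (esign {x} (C - A) * g (insert x (C - A)))))"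
  have L: "ext_mult (ext_diff V f) g C = (\<Sum>A\<in>Pow C. \<Sum>x\<in>V - A. P A x)"
    by (simp add: ext_mult_def ext_diff_def P_def sum_distrib_left sum_distrib_right)
  have sg: "(-1) ^ m * (a * (f A * b)) = (-1) ^ card A * a * (f A * b)" for A a b
    using hom[of A] by (cases "f A = 0") (auto simp: algebra_simps)
  have R: "(-1) ^ m * ext_mult f (ext_diff V g) C = (\<Sum>A\<in>Pow C. \<Sum>x\<in>V - (C - A). Q A x)"
    by (simp add: ext_mult_def ext_diff_def Q_def sum_distrib_left sg)
  have "ext_diff V (ext_mult f g) C = (\<Sum>x\<in>V - C. \<Sum>A\<in>Pow C. P A x + Q A x)"
    unfolding ext_diff_def
  proof (rule sum.cong[OF refl])
    fix x assume x: "x \<in> V - C"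
    have "ext_mult f g (insert x C)
      = (\<Sum>A\<in>Pow C. esign A (insert x C - A) * (f A * g (insert x C - A)))
       + (\<Sum>A\<in>insert x ` Pow C. esign A (insert x C - A) * (f A * g (insert x C - A)))"
      unfolding ext_mult_def Pow_insert using x assms(2) by (intro sum.union_disjoint) auto
    also have "(\<Sum>A\<in>insert x ` Pow C. esign A (insert x C - A) * (f A * g (insert x C - A)))
        = (\<Sum>A\<in>Pow C. esign (insert x A) (C - A) * (f (insert x A) * g (C - A)))"
    proof (subst sum.reindex)
      show "inj_on (insert x) (Pow C)" using x by (auto simp: inj_on_def)
    next
      have "insert x C - insert x A = C - A" if "A \<subseteq> C" for A using x that by auto
      then show "sum ((\<lambda>A. esign A (insert x C - A) * (f A * g (insert x C - A))) \<circ> insert x) (Pow C)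
          = (\<Sum>A\<in>Pow C. esign (insert x A) (C - A) * (f (insert x A) * g (C - A)))"
        by (intro sum.cong) auto
    qed
    finally have "esign {x} C * ext_mult f g (insert x C)
      = (\<Sum>A\<in>Pow C. esign {x} C * (esign (insert x A) (C - A) * (f (insert x A) * g (C - A)))
          + esign {x} C * (esign A (insert x C - A) * (f A * g (insert x C - A))))"
      by (simp add: sum.distrib sum_distrib_left algebra_simps)
    also have "\<dots> = (\<Sum>A\<in>Pow C. P A x + Q A x)"
    proof (rule sum.cong[OF refl])
      fix A assume A: "A \<in> Pow C"
      have xC: "esign {x} C = esign {x} A * esign {x} (C - A)"
        using esign_un_right[of "{x}" A "C - A"] A finS[of A] assms(2)
        by (simp add: Un_absorb1)
      have ins: "insert x C - A = insert x (C - A)" using A x by auto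
      have "x \<notin> A" using A x by auto
      then have s1: "esign {x} C * esign (insert x A) (C - A) = (esign {x} A * esign A (C - A) :: 'b)"
        unfolding xC using A finS[of A] assms(2)
        by (simp add: esign_insert_left[of A "C - A" x] ac_simps esign_square)
      have s2: "esign {x} C * esign A (insert x (C - A)) = ((-1) ^ card A * esign A (C - A) * esign {x} (C - A) :: 'b)"
        unfolding xC using A finS[of A] assms(2) x \<open>x \<notin> A\<close>
        by (simp add: esign_insert_right[of A "C - A" x] esign_swap_singleton[of A x] ac_simps
            esign_square_left)
      show "esign {x} C * (esign (insert x A) (C - A) * (f (insert x A) * g (C - A)))
          + esign {x} C * (esign A (insert x C - A) * (f A * g (insert x C - A))) = P A x + Q A x"
        unfolding ins P_def Q_def by (simp only: mult.assoc[symmetric] s1 s2) (simp only: ac_simps)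
    qed
    finally show "esign {x} C * ext_mult f g (insert x C) = (\<Sum>A\<in>Pow C. P A x + Q A x)" .
  qed
  also have "\<dots> = (\<Sum>A\<in>Pow C. (\<Sum>x\<in>V - C. P A x) + (\<Sum>x\<in>V - C. Q A x))"
    by (subst sum.swap) (simp add: sum.distrib)
  finally have D: "ext_diff V (ext_mult f g) C = (\<Sum>A\<in>Pow C. (\<Sum>x\<in>V - C. P A x) + (\<Sum>x\<in>V - C. Q A x))" .
  have Psplit: "(\<Sum>x\<in>V - A. P A x) = (\<Sum>x\<in>V - C. P A x) + (\<Sum>x\<in>V \<inter> (C - A). P A x)" if "A \<subseteq> C" for A
  proof -
    have eq: "V - A = (V - C) \<union> V \<inter> (C - A)" using that by auto
    show ?thesis unfolding eq by (intro sum.union_disjoint) (use assms(1) in auto)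
  qed
  have Qsplit: "(\<Sum>x\<in>V - (C - A). Q A x) = (\<Sum>x\<in>V - C. Q A x) + (\<Sum>x\<in>V \<inter> A. Q A x)" if "A \<subseteq> C" for A
  proof -
    have eq: "V - (C - A) = (V - C) \<union> V \<inter> A" using that by auto
    show ?thesis unfolding eq by (intro sum.union_disjoint) (use assms(1) that in auto)
  qed
  have "(\<Sum>A\<in>Pow C. \<Sum>x\<in>V \<inter> A. Q A x) = (\<Sum>(A, x)\<in>Sigma (Pow C) (\<lambda>A. V \<inter> A). Q A x)"
    using assms by (intro sum.Sigma) auto
  also have "\<dots> = (\<Sum>(A, x)\<in>Sigma (Pow C) (\<lambda>A. V \<inter> (C - A)). - P A x)"
  proof (rule sum.reindex_bij_witness[of _ "\<lambda>(A, x). (insert x A, x)" "\<lambda>(A, x). (A - {x}, x)"], goal_cases)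
    case (5 z)
    then obtain A x where z: "z = (A, x)" "A \<subseteq> C" "x \<in> V" "x \<in> A" by auto
    define B where "B = A - {x}"
    define E where "E = C - A"
    have eqs: "A = insert x B" "C - A = E" "C - B = insert x E" "A - {x} = B"
      using z by (auto simp: B_def E_def)
    have f: "finite B" "finite E" "x \<notin> B" "x \<notin> E"
      using z assms(2) finS[of A] by (auto simp: B_def E_def)
    have "- P B x = Q A x"
      unfolding P_def Q_def eqs(2-4)
      unfolding eqs(1) using f
      by (simp add: esign_insert_left[of B] esign_insert_right[of _ E] esign_swap_singleton
            esign_square esign_square_left algebra_simps)
    then show ?case by (simp add: z eqs(4))
  qed auto
  also have "\<dots> = (\<Sum>A\<in>Pow C. \<Sum>x\<in>V \<inter> (C - A). - P A x)"
    using assms by (intro sum.Sigma[symmetric]) auto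
  finally have X: "(\<Sum>A\<in>Pow C. \<Sum>x\<in>V \<inter> A. Q A x) = - (\<Sum>A\<in>Pow C. \<Sum>x\<in>V \<inter> (C - A). P A x)"
    by (simp add: sum_negf)
  show ?thesis
    unfolding L R D using X by (simp add: Psplit Qsplit sum.distrib)
qed


section \<open>Massey products and an ideal complementary to the cycles\<close>

text \<open>
  In the following locale the operations live on a whole type, while \<open>part n\<close> is the subset of the
  homogeneous elements of degree \<open>n\<close> of the dga in question.
\<close>

definition sign_by :: "nat \<Rightarrow> 'a::ab_group_add \<Rightarrow> 'a" where
  "sign_by n a = (if even n then a else - a)"

locale graded_dga =
  fixes part :: "nat \<Rightarrow> 'a::ab_group_add set"
    and mult :: "'a \<Rightarrow> 'a \<Rightarrow> 'a" (infixl "\<odot>" 70)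
    and d :: "'a \<Rightarrow> 'a"
  assumes part_0: "0 \<in> part n"
    and part_add: "a \<in> part n \<Longrightarrow> b \<in> part n \<Longrightarrow> a + b \<in> part n"
    and part_uminus: "a \<in> part n \<Longrightarrow> - a \<in> part n"
    and part_mult: "a \<in> part m \<Longrightarrow> b \<in> part n \<Longrightarrow> a \<odot> b \<in> part (m + n)"
    and part_d: "a \<in> part (Suc n) \<Longrightarrow> d a \<in> part n"
    and mult_add_left: "(a + b) \<odot> c = a \<odot> c + b \<odot> c"
    and mult_add_right: "c \<odot> (a + b) = c \<odot> a + c \<odot> b"
    and mult_assoc: "(a \<odot> b) \<odot> c = a \<odot> (b \<odot> c)"
    and d_add: "d (a + b) = d a + d b"
    and d_d: "a \<in> part n \<Longrightarrow> d (d a) = 0"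
    and leibniz: "a \<in> part m \<Longrightarrow> b \<in> part n \<Longrightarrow> d (a \<odot> b) = d a \<odot> b + sign_by m (a \<odot> d b)"
begin

definition msum :: "(nat \<Rightarrow> nat) \<Rightarrow> (nat \<Rightarrow> nat \<Rightarrow> 'a) \<Rightarrow> nat \<Rightarrow> nat \<Rightarrow> 'a" where
  "msum p a i j = (\<Sum>l\<in>{i<..<j}. sign_by (massey_elem_deg p i l + 1) (a i l) \<odot> a l j)"

lemma d_0: "d 0 = 0"
  using d_add[of 0 0] by simp

lemma d_uminus: "d (- a) = - d a"
  using d_add[of a "- a"] by (simp add: d_0 add_eq_0_iff)

lemma d_diff: "d (a - b) = d a - d b"
  using d_add[of a "- b"] by (simp add: d_uminus)

lemma d_sum: "d (sum f A) = (\<Sum>x\<in>A. d (f x))"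
  by (induction A rule: infinite_finite_induct) (simp_all add: d_0 d_add)

lemma mult_0_left: "0 \<odot> a = 0" and mult_0_right: "a \<odot> 0 = 0"
  using mult_add_left[of 0 0 a] mult_add_right[of a 0 0] by simp_all

lemma mult_uminus_left: "(- a) \<odot> b = - (a \<odot> b)"
  using mult_add_left[of a "- a" b] by (simp add: mult_0_left add_eq_0_iff)

lemma mult_uminus_right: "a \<odot> (- b) = - (a \<odot> b)"
  using mult_add_right[of a b "- b"] by (simp add: mult_0_right add_eq_0_iff)

lemma mult_sum_left: "sum f A \<odot> b = (\<Sum>x\<in>A. f x \<odot> b)"
  by (induction A rule: infinite_finite_induct) (simp_all add: mult_0_left mult_add_left)

lemma mult_sum_right: "b \<odot> sum f A = (\<Sum>x\<in>A. b \<odot> f x)"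
  by (induction A rule: infinite_finite_induct) (simp_all add: mult_0_right mult_add_right)

lemma sign_by_mult_left: "sign_by n a \<odot> b = sign_by n (a \<odot> b)"
  by (simp add: sign_by_def mult_uminus_left)

lemma sign_by_mult_right: "a \<odot> sign_by n b = sign_by n (a \<odot> b)"
  by (simp add: sign_by_def mult_uminus_right)

lemma d_sign_by: "d (sign_by n a) = sign_by n (d a)"
  by (simp add: sign_by_def d_uminus)

lemma sign_by_sign_by: "sign_by m (sign_by n a) = sign_by (m + n) a"
  by (auto simp: sign_by_def)

lemma sign_by_sum: "sign_by n (sum f A) = (\<Sum>x\<in>A. sign_by n (f x))"
  by (simp add: sign_by_def sum_negf)

lemma sign_by_cong: "even (m + n) \<Longrightarrow> sign_by m a = sign_by n a"
  by (auto simp: sign_by_def)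

lemma part_sign_by: "a \<in> part n \<Longrightarrow> sign_by k a \<in> part n"
  by (simp add: sign_by_def part_uminus)

lemma part_diff: "a \<in> part n \<Longrightarrow> b \<in> part n \<Longrightarrow> a - b \<in> part n"
  using part_add[of a n "- b"] by (simp add: part_uminus)

lemma part_sum: "(\<And>x. x \<in> A \<Longrightarrow> f x \<in> part n) \<Longrightarrow> sum f A \<in> part n"
  by (induction A rule: infinite_finite_induct) (simp_all add: part_0 part_add)

text \<open>
  Whether the product of two cycles bounds depends on their homology classes alone.
\<close>

lemma boundary_mult_cong:
  assumes "a \<in> part m" "b \<in> part n" "d a = 0" "d b = 0" "x \<in> part (Suc m)" "y \<in> part (Suc n)"
    and "(d x + a) \<odot> (d y + b) \<in> d ` part (Suc (m + n))"
  shows "a \<odot> b \<in> d ` part (Suc (m + n))"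
proof -
  obtain e where e: "(d x + a) \<odot> (d y + b) = d e" "e \<in> part (Suc (m + n))"
    using assms(7) by auto
  have dxb: "d (x \<odot> (d y + b)) = d x \<odot> (d y + b)"
    using leibniz[of x "Suc m" "d y + b" n] assms
    by (simp add: d_add d_d part_add part_d sign_by_def mult_0_right)
  have ady: "d (sign_by m (a \<odot> y)) = a \<odot> d y"
    using leibniz[of a m y "Suc n"] assms by (simp add: d_sign_by mult_0_left sign_by_sign_by)
      (simp add: sign_by_def)
  have "a \<odot> b = d (e - x \<odot> (d y + b) - sign_by m (a \<odot> y))"
    unfolding d_diff dxb ady e(1)[symmetric] by (simp add: mult_add_left mult_add_right)
  moreover have "x \<odot> (d y + b) \<in> part (Suc (m + n))" "a \<odot> y \<in> part (Suc (m + n))"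
    using part_mult[of x "Suc m" "d y + b" n] part_mult[of a m y "Suc n"] assms
    by (simp_all add: part_add part_d)
  ultimately show ?thesis
    using e(2) by (auto intro!: image_eqI part_diff part_sign_by)
qed

lemma massey_elem_deg_split:
  assumes "i < l" "l < j"
  shows "massey_elem_deg p i l + massey_elem_deg p l j + 1 = massey_elem_deg p i j"
proof -
  have "{i<..j} = {i<..l} \<union> {l<..j}" using assms by auto
  then have "(\<Sum>k\<in>{i<..j}. p k) = (\<Sum>k\<in>{i<..l}. p k) + (\<Sum>k\<in>{l<..j}. p k)"
    using assms by (simp add: sum.union_disjoint)
  then show ?thesis using assms by (simp add: massey_elem_deg_def)
qed

lemma massey_elem_deg_step: "massey_elem_deg p i (Suc i) = p (Suc i)"
proof -
  have "{i<..Suc i} = {Suc i}" by auto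
  then show ?thesis by (simp add: massey_elem_deg_def)
qed

lemma part_msum:
  assumes "\<And>l. i < l \<Longrightarrow> l < j \<Longrightarrow> a i l \<in> part (massey_elem_deg p i l)"
    and "\<And>l. i < l \<Longrightarrow> l < j \<Longrightarrow> a l j \<in> part (massey_elem_deg p l j)"
  shows "msum p a i j \<in> part (massey_elem_deg p i j - 1)"
  unfolding msum_def
proof (rule part_sum)
  fix l assume "l \<in> {i<..<j}"
  then have l: "i < l" "l < j" by auto
  have "massey_elem_deg p i l + massey_elem_deg p l j = massey_elem_deg p i j - 1"
    using massey_elem_deg_split[OF l, of p] by simp
  then show "sign_by (massey_elem_deg p i l + 1) (a i l) \<odot> a l j \<in> part (massey_elem_deg p i j - 1)"
    using part_mult[OF part_sign_by[OF assms(1)[OF l]] assms(2)[OF l]] by simp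
qed

text \<open>
  Expanding by the Leibniz rule yields each triple product \<open>a i h \<odot> a h l \<odot> a l j\<close> once from either
  factor, with opposite signs.
\<close>

lemma d_msum:
  assumes deg: "\<And>k l. i \<le> k \<Longrightarrow> k < l \<Longrightarrow> l \<le> j \<Longrightarrow> (k, l) \<noteq> (i, j) \<Longrightarrow> a k l \<in> part (massey_elem_deg p k l)"
    and cyc: "\<And>k. i \<le> k \<Longrightarrow> k < j \<Longrightarrow> d (a k (Suc k)) = 0"
    and sys: "\<And>k l. i \<le> k \<Longrightarrow> k + 1 < l \<Longrightarrow> l \<le> j \<Longrightarrow> (k, l) \<noteq> (i, j) \<Longrightarrow> d (a k l) = msum p a k l"
  shows "d (msum p a i j) = 0"
proof -
  let ?D = "massey_elem_deg p"
  have dm: "d (a k l) = msum p a k l" if "i \<le> k" "k < l" "l \<le> j" "(k, l) \<noteq> (i, j)" for k l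
  proof (cases "l = Suc k")
    case True
    have "{k<..<Suc k} = {}" by auto
    then have "msum p a k l = 0" unfolding msum_def True by simp
    then show ?thesis using cyc[of k] that True by simp
  next
    case False
    then show ?thesis using sys[of k l] that by simp
  qed
  let ?t = "\<lambda>h l. sign_by (?D h l + 1) (a i h \<odot> (a h l \<odot> a l j))"
  have summand: "d (sign_by (?D i l + 1) (a i l) \<odot> a l j)
      = (\<Sum>h\<in>{i<..<l}. ?t h l) - (\<Sum>h\<in>{l<..<j}. ?t l h)" if l: "l \<in> {i<..<j}" for l
  proof -
    have "d (sign_by (?D i l + 1) (a i l) \<odot> a l j)
        = sign_by (?D i l + 1) (msum p a i l \<odot> a l j)
          + sign_by (?D i l + 1 + ?D i l) (a i l \<odot> msum p a l j)"
      using leibniz[OF deg deg, of i l l j] l dm[of i l] dm[of l j]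
      unfolding sign_by_mult_left d_sign_by by (auto simp: sign_by_def)
    also have "sign_by (?D i l + 1 + ?D i l) (a i l \<odot> msum p a l j) = - (\<Sum>h\<in>{l<..<j}. ?t l h)"
    proof -
      have "sign_by (?D i l + 1 + ?D i l) x = - x" for x :: 'a by (simp add: sign_by_def)
      then show ?thesis
        by (simp only: msum_def mult_sum_right sign_by_mult_left sign_by_mult_right)
    qed
    also have "sign_by (?D i l + 1) (msum p a i l \<odot> a l j) = (\<Sum>h\<in>{i<..<l}. ?t h l)"
      unfolding msum_def mult_sum_left sign_by_sum
    proof (rule sum.cong[OF refl])
      fix h assume h: "h \<in> {i<..<l}"
      have "even (?D i l + 1 + (?D i h + 1) + (?D h l + 1))"
        using massey_elem_deg_split[of i h l p] h by (metis greaterThanLessThan_iff even_add odd_one add.assoc add.commute even_plus_one_iff)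
      then show "sign_by (?D i l + 1) (sign_by (?D i h + 1) (a i h) \<odot> a h l \<odot> a l j) = ?t h l"
        unfolding sign_by_mult_left sign_by_sign_by mult_assoc by (rule sign_by_cong)
    qed
    finally show ?thesis by simp
  qed
  have "d (msum p a i j) = (\<Sum>l\<in>{i<..<j}. \<Sum>h\<in>{i<..<l}. ?t h l) - (\<Sum>l\<in>{i<..<j}. \<Sum>h\<in>{l<..<j}. ?t l h)"
    unfolding msum_def d_sum by (simp only: summand cong: sum.cong) (simp add: sum_subtractf)
  also have "(\<Sum>l\<in>{i<..<j}. \<Sum>h\<in>{i<..<l}. ?t h l) = (\<Sum>(l, h)\<in>Sigma {i<..<j} (\<lambda>l. {i<..<l}). ?t h l)"
    by (intro sum.Sigma) auto
  also have "\<dots> = (\<Sum>(l, h)\<in>Sigma {i<..<j} (\<lambda>l. {l<..<j}). ?t l h)"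
    by (rule sum.reindex_bij_witness[of _ prod.swap prod.swap]) auto
  also have "\<dots> = (\<Sum>l\<in>{i<..<j}. \<Sum>h\<in>{l<..<j}. ?t l h)"
    by (intro sum.Sigma[symmetric]) auto
  finally show ?thesis by simp
qed

text \<open>
  The set \<open>U\<close> is an ideal that contains a preimage of every boundary, and its cycles are boundaries of
  its own elements.  The system is built by induction on \<open>j - i\<close>.  For \<open>j - i = 2\<close>, the bounding
  element can be moved into \<open>U\<close>.  For \<open>j - i > 2\<close>, the prescribed boundary is a cycle in \<open>U\<close>.  The entry
  with index \<open>(0, n)\<close> is included, so that the Massey product itself bounds.
\<close>

lemma massey_system_exists:
  assumes U_0: "0 \<in> U"
    and U_add: "\<And>a b. a \<in> U \<Longrightarrow> b \<in> U \<Longrightarrow> a + b \<in> U"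
    and U_uminus: "\<And>a. a \<in> U \<Longrightarrow> - a \<in> U"
    and U_left: "\<And>a b m n. a \<in> part m \<Longrightarrow> b \<in> part n \<Longrightarrow> a \<in> U \<Longrightarrow> a \<odot> b \<in> U"
    and U_right: "\<And>a b m n. a \<in> part m \<Longrightarrow> b \<in> part n \<Longrightarrow> b \<in> U \<Longrightarrow> a \<odot> b \<in> U"
    and U_boundary: "\<And>e n. e \<in> part (Suc n) \<Longrightarrow> \<exists>b\<in>part (Suc n) \<inter> U. d b = d e"
    and U_cycle: "\<And>z n. z \<in> part n \<Longrightarrow> z \<in> U \<Longrightarrow> d z = 0 \<Longrightarrow> \<exists>y\<in>part (Suc n) \<inter> U. d y = z"
    and c_deg: "\<And>i. i < n \<Longrightarrow> c i \<in> part (p (Suc i))"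
    and c_cycle: "\<And>i. i < n \<Longrightarrow> d (c i) = 0"
    and c_prod: "\<And>i. Suc i < n \<Longrightarrow> c i \<odot> c (Suc i) \<in> d ` part (Suc (p (Suc i) + p (Suc (Suc i))))"
  shows "\<exists>a. (\<forall>i<n. a i (Suc i) = c i) \<and>
    (\<forall>i j. i < j \<and> j \<le> n \<longrightarrow> a i j \<in> part (massey_elem_deg p i j)) \<and>
    (\<forall>i j. i + 1 < j \<and> j \<le> n \<longrightarrow> d (a i j) = msum p a i j)"
proof -
  let ?D = "massey_elem_deg p"
  have U_sum: "sum f A \<in> U" if "\<And>x. x \<in> A \<Longrightarrow> f x \<in> U" for f :: "nat \<Rightarrow> 'a" and A
    using that
  proof (induction A rule: infinite_finite_induct)
    case (insert x F)
    then have "f x + sum f F \<in> U" by (intro U_add) auto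
    then show ?case using insert.hyps by simp
  qed (simp_all add: U_0)
  have U_sign_by: "sign_by k x \<in> U" if "x \<in> U" for k x
    using that by (simp add: sign_by_def U_uminus)
  have "\<exists>a. (\<forall>i<n. a i (Suc i) = c i) \<and>
    (\<forall>i j. i < j \<and> j \<le> n \<and> j - i \<le> Suc L \<longrightarrow> a i j \<in> part (?D i j)) \<and>
    (\<forall>i j. i + 1 < j \<and> j \<le> n \<and> j - i \<le> Suc L \<longrightarrow> a i j \<in> U \<and> d (a i j) = msum p a i j)" for L
  proof (induction L)
    case 0
    have "c i \<in> part (?D i j)" if "i < j \<and> j \<le> n \<and> j - i \<le> Suc 0" for i j
    proof -
      have "j = Suc i" using that by linarith
      then show ?thesis using c_deg[of i] that by (simp only: massey_elem_deg_step) simp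
    qed
    moreover have "\<not> (i + 1 < j \<and> j \<le> n \<and> j - i \<le> Suc 0)" for i j by linarith
    ultimately show ?case by (intro exI[of _ "\<lambda>i j. c i"]) blast
  next
    case (Suc L)
    then obtain a where a1: "\<forall>i<n. a i (Suc i) = c i"
      and a2: "\<forall>i j. i < j \<and> j \<le> n \<and> j - i \<le> Suc L \<longrightarrow> a i j \<in> part (?D i j)"
      and a3: "\<forall>i j. i + 1 < j \<and> j \<le> n \<and> j - i \<le> Suc L \<longrightarrow> a i j \<in> U \<and> d (a i j) = msum p a i j"
      by (elim exE conjE) (rule that)
    have a_c: "a i (Suc i) = c i" if "i < n" for i
      using a1 that by simp
    have a_deg: "a i j \<in> part (?D i j)" if "i < j" "j \<le> n" "j - i \<le> Suc L" for i j
      using a2 that by simp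
    have a_U: "a i j \<in> U" and a_d: "d (a i j) = msum p a i j"
      if "i + 1 < j" "j \<le> n" "j - i \<le> Suc L" for i j
      using a3 that by simp_all
    have ex: "\<exists>y. y \<in> part (?D i j) \<and> y \<in> U \<and> d y = msum p a i j"
      if ij: "j = i + Suc (Suc L)" "j \<le> n" for i j
    proof -
      define q where "q = ?D i (Suc i) + ?D (Suc i) j"
      have q: "?D i j = Suc q"
        unfolding q_def by (subst massey_elem_deg_split[of i "Suc i" j p, symmetric]) (use ij in auto)
      have "msum p a i j \<in> part (?D i j - 1)"
        using ij by (intro part_msum a_deg) auto
      then have deg: "msum p a i j \<in> part q" by (simp add: q)
      have cyc: "d (msum p a i j) = 0"
      proof (rule d_msum)
        fix k l assume "i \<le> k" "k < l" "l \<le> j" "(k, l) \<noteq> (i, j)"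
        then show "a k l \<in> part (?D k l)" using ij by (intro a_deg) auto
      next
        fix k assume "i \<le> k" "k < j"
        then show "d (a k (Suc k)) = 0" using ij by (simp add: a_c c_cycle)
      next
        fix k l assume "i \<le> k" "k + 1 < l" "l \<le> j" "(k, l) \<noteq> (i, j)"
        then show "d (a k l) = msum p a k l" using ij by (intro a_d) auto
      qed
      show ?thesis
      proof (cases "L = 0")
        case True
        \<comment> \<open>length two: the product of consecutive cycles bounds by assumption\<close>
        have "{i<..<j} = {Suc i}" using ij True by auto
        then have ms: "msum p a i j = sign_by (?D i (Suc i) + 1) (c i \<odot> c (Suc i))"
          using ij True by (simp add: msum_def a_c sign_by_mult_left)
        have D: "?D i j = Suc (p (Suc i) + p (Suc (Suc i)))"
          using massey_elem_deg_split[of i "Suc i" j p] ij True by (simp add: massey_elem_deg_step)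
        obtain e where e: "e \<in> part (?D i j)" "c i \<odot> c (Suc i) = d e"
          using c_prod[of i] ij True D by auto
        obtain b where "b \<in> part (?D i j)" "b \<in> U" "d b = d e"
          using U_boundary[of e q] e(1) q by auto
        then show ?thesis
          by (intro exI[of _ "sign_by (?D i (Suc i) + 1) b"])
             (simp add: part_sign_by U_sign_by d_sign_by ms e(2))
      next
        case False
        \<comment> \<open>in every product one of the two factors has length at least two, hence lies in U\<close>
        have "msum p a i j \<in> U"
          unfolding msum_def
        proof (rule U_sum)
          fix l assume l: "l \<in> {i<..<j}"
          have p1: "sign_by (?D i l + 1) (a i l) \<in> part (?D i l)" and p2: "a l j \<in> part (?D l j)"
            using l ij by (auto intro!: part_sign_by a_deg)
          show "sign_by (?D i l + 1) (a i l) \<odot> a l j \<in> U"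
          proof (cases "i + 1 < l")
            case True
            then show ?thesis using l ij by (intro U_left[OF p1 p2] U_sign_by a_U) auto
          next
            case False
            then show ?thesis using l ij \<open>L \<noteq> 0\<close> by (intro U_right[OF p1 p2] a_U) auto
          qed
        qed
        from U_cycle[OF deg this cyc] show ?thesis
          using q by auto
      qed
    qed
    define b where "b = (\<lambda>i j. if j = i + Suc (Suc L) then
      (SOME y. y \<in> part (?D i j) \<and> y \<in> U \<and> d y = msum p a i j) else a i j)"
    have b_new: "b i j \<in> part (?D i j) \<and> b i j \<in> U \<and> d (b i j) = msum p a i j"
      if "j = i + Suc (Suc L)" "j \<le> n" for i j
      using someI_ex[OF ex[OF that]] that(1) by (simp add: b_def)
    have b_old: "b i j = a i j" if "j - i \<le> Suc L" for i j
      using that by (auto simp: b_def)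
    have ms: "msum p b i j = msum p a i j" if "j - i \<le> Suc (Suc L)" for i j
      unfolding msum_def by (rule sum.cong) (use that b_old in auto)
    have new: "j = i + Suc (Suc L) \<or> j - i \<le> Suc L" if "j - i \<le> Suc (Suc L)" "i < j" for i j
      using that by auto
    show ?case
    proof (intro exI[of _ b] conjI allI impI; (elim conjE)?)
      fix i assume "i < n" then show "b i (Suc i) = c i" using a_c b_old by simp
    next
      fix i j assume ij: "i < j" "j \<le> n" "j - i \<le> Suc (Suc L)"
      from new[OF ij(3,1)] show "b i j \<in> part (?D i j)"
        using b_new[of j i] b_old[of j i] a_deg[of i j] ij by auto
    next
      fix i j assume ij: "i + 1 < j" "j \<le> n" "j - i \<le> Suc (Suc L)"
      show "b i j \<in> U"
        using new[of j i] b_new[of j i] b_old[of j i] a_U[of i j] ij by auto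
      show "d (b i j) = msum p b i j"
        using new[of j i] b_new[of j i] b_old[of j i] a_d[of i j] ms[OF ij(3)] ij by auto
    qed
  qed
  from this[of n] show ?thesis
  proof (elim exE conjE, goal_cases)
    case (1 a)
    then show ?case by (intro exI[of _ a]) auto
  qed
qed

end


section \<open>Simplicial complexes that are cones along one group of vertices\<close>

text \<open>
  If the cone vertex \<open>v\<close> were the same for all simplices, multiplication by \<open>v\<close> would be a contracting
  homotopy.  Here it may depend on the part of the simplex in \<open>W\<close>, but it lies outside of \<open>W\<close>.  So
  multiplication by \<open>v\<close> contracts the part of the differential that leaves the intersection with \<open>W\<close>
  unchanged, and the other part decreases this intersection: a cycle is bounded up to a cycle whose
  simplices have a smaller intersection with \<open>W\<close>, and induction applies.
\<close>

lemma cone_acyclic: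
  fixes z :: "'v::linorder set \<Rightarrow> 'a::comm_ring_1"
  assumes fin: "finite V"
    and sub: "\<And>C. C \<in> Q \<Longrightarrow> C \<subseteq> V"
    and down: "\<And>C x. C \<in> Q \<Longrightarrow> C - {x} \<in> Q"
    and cone: "\<And>C. C \<in> Q \<Longrightarrow> v (C \<inter> W) \<in> V - W \<and> insert (v (C \<inter> W)) C \<in> Q"
    and supp: "\<And>C. z C \<noteq> 0 \<Longrightarrow> C \<in> Q \<and> card C = n"
    and cyc: "ext_diff V z = 0"
  shows "\<exists>y. (\<forall>C. y C \<noteq> 0 \<longrightarrow> C \<in> Q \<and> card C = Suc n) \<and> ext_diff V y = z"
proof -
  have finQ: "finite C" if "C \<in> Q" for C
    using sub[OF that] fin finite_subset by blast
  have "\<exists>y. (\<forall>C. y C \<noteq> 0 \<longrightarrow> C \<in> Q \<and> card C = Suc n) \<and> ext_diff V y = z"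
    if "\<And>C. z C \<noteq> 0 \<Longrightarrow> C \<in> Q \<and> card C = n" "ext_diff V z = 0"
      "\<And>C. z C \<noteq> 0 \<Longrightarrow> card (C \<inter> W) < N"
    for N and z :: "'v set \<Rightarrow> 'a"
    using that
  proof (induction N arbitrary: z)
    case 0
    then have "z = 0" by (intro ext) fastforce
    then show ?case by (intro exI[of _ 0]) (auto simp: ext_diff_def)
  next
    case (Suc N)
    note z_supp = Suc.prems(1) and z_cyc = Suc.prems(2) and z_bound = Suc.prems(3)
    \<comment> \<open>the product of the cone vertices with the top component of \<open>z\<close>\<close>
    define y where "y = (\<lambda>C. let w = v (C \<inter> W) in
      if card (C \<inter> W) = N \<and> w \<in> C - W then esign {w} (C - {w}) * z (C - {w}) else 0)"
    have y_supp: "C \<in> Q \<and> card C = Suc n" if "y C \<noteq> 0" for C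
    proof -
      let ?w = "v (C \<inter> W)"
      have w: "?w \<in> C" "?w \<notin> W" and zc: "z (C - {?w}) \<noteq> 0"
        using that by (auto simp: y_def Let_def split: if_splits)
      have E: "C - {?w} \<in> Q" "card (C - {?w}) = n" using z_supp[OF zc] by auto
      have "(C - {?w}) \<inter> W = C \<inter> W" using w by auto
      with cone[OF E(1)] have "insert ?w (C - {?w}) \<in> Q" by simp
      moreover have "insert ?w (C - {?w}) = C" using w by auto
      moreover have "card C = Suc n"
        using E(2) w(1) finQ[OF E(1)] by (metis card_Suc_Diff1 finite_Diff_insert infinite_remove)
      ultimately show ?thesis by simp
    qed
    have dy_supp: "C \<in> Q \<and> card C = n" if nz: "ext_diff V y C \<noteq> 0" for C
    proof -
      obtain x where x: "x \<in> V - C" "y (insert x C) \<noteq> 0"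
        using sum.not_neutral_contains_not_neutral[OF nz[unfolded ext_diff_def]] by force
      have "insert x C \<in> Q" "card (insert x C) = Suc n" using y_supp[OF x(2)] by auto
      moreover have "insert x C - {x} = C" using x by auto
      ultimately show ?thesis using down[of "insert x C" x] finQ[of C] x by auto
    qed
    have dy: "ext_diff V y C = z C" if C: "C \<in> Q" "card (C \<inter> W) \<ge> N" for C
    proof (cases "card (C \<inter> W) = N")
      case False
      have "y (insert x C) = 0" if "x \<in> V - C" for x
      proof -
        have "card (C \<inter> W) \<le> card (insert x C \<inter> W)"
          using finQ[OF C(1)] by (intro card_mono) auto
        then show ?thesis using C(2) False by (auto simp: y_def Let_def)
      qed
      moreover have "z C = 0" using z_bound[of C] C(2) False by auto
      ultimately show ?thesis by (simp add: ext_diff_def)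
    next
      case True
      define w where "w = v (C \<inter> W)"
      have w: "w \<in> V" "w \<notin> W" using cone[OF C(1)] by (auto simp: w_def)
      have finC: "finite C" using finQ C(1) by blast
      have y_W: "y (insert x C) = 0" and z_W: "z (insert x C - {w}) = 0"
        if "x \<in> V - C" "x \<in> W" for x
      proof -
        have 1: "insert x C \<inter> W = insert x (C \<inter> W)" using that by auto
        have 2: "(insert x C - {w}) \<inter> W = insert x (C \<inter> W)" using that w by auto
        have "card (insert x (C \<inter> W)) = Suc N" using True that finC by simp
        then show "y (insert x C) = 0" "z (insert x C - {w}) = 0"
          using z_bound[of "insert x C - {w}"] by (auto simp: y_def Let_def 1 2)
      qed
      have y_ins: "y (insert x C) = (if w \<in> insert x C
          then esign {w} (insert x C - {w}) * z (insert x C - {w}) else 0)"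
        if "x \<in> V - C" for x
      proof (cases "x \<in> W")
        case True
        then show ?thesis using y_W z_W that by simp
      next
        case False
        then have "insert x C \<inter> W = C \<inter> W" by auto
        then show ?thesis using w True by (simp add: y_def Let_def flip: w_def)
      qed
      show ?thesis
      proof (cases "w \<in> C")
        case False
        have "ext_diff V y C = (\<Sum>x\<in>V - C. if x = w then z C else 0)"
          unfolding ext_diff_def
        proof (rule sum.cong[OF refl])
          fix x assume "x \<in> V - C"
          then show "esign {x} C * y (insert x C) = (if x = w then z C else 0)"
            using False by (auto simp: y_ins esign_square_left)
        qed
        then show ?thesis using False w fin by simp
      next
        case True
        define E where "E = C - {w}"
        have E: "C = insert w E" "w \<notin> E" "finite E"
          using True finC by (auto simp: E_def)
        have VE: "V - E = insert w (V - C)" using w E by auto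
        have "0 = ext_diff V z E" using z_cyc by simp
        also have "\<dots> = esign {w} E * z C + (\<Sum>x\<in>V - C. esign {x} E * z (insert x E))"
          unfolding ext_diff_def VE using True fin E(1) by (subst sum.insert) auto
        finally have dz: "(\<Sum>x\<in>V - C. esign {x} E * z (insert x E)) = - (esign {w} E * z C)"
          by (simp add: add_eq_0_iff)
        have "ext_diff V y C = (\<Sum>x\<in>V - C. - (esign {w} E * (esign {x} E * z (insert x E))))"
          unfolding ext_diff_def
        proof (rule sum.cong[OF refl])
          fix x assume x: "x \<in> V - C"
          have ins: "insert x C - {w} = insert x E" using x True by (auto simp: E_def)
          have "x \<notin> E" "x \<noteq> w" using x E by auto
          then have s: "esign {x} C = esign {x} {w} * (esign {x} E :: 'a)"
            "esign {w} (insert x E) = - esign {x} {w} * (esign {w} E :: 'a)"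
            using esign_insert_right[of "{x}" E w] esign_insert_right[of "{w}" E x] E
            by (simp_all add: esign_singletons[of w x])
          show "esign {x} C * y (insert x C) = - (esign {w} E * (esign {x} E * z (insert x E)))"
            unfolding y_ins[OF x] ins s(1) s(2)
            using True by (simp add: s(2) ac_simps esign_square esign_square_left)
        qed
        also have "\<dots> = - (esign {w} E * (\<Sum>x\<in>V - C. esign {x} E * z (insert x E)))"
          by (simp add: sum_distrib_left sum_negf)
        also have "\<dots> = z C"
          unfolding dz by (simp add: esign_square_left)
        finally show ?thesis .
      qed
    qed
    have ddy: "ext_diff V (ext_diff V y) = 0"
      using fin y_supp finQ by (intro ext_diff_diff_0) blast+
    have "\<exists>y'. (\<forall>C. y' C \<noteq> 0 \<longrightarrow> C \<in> Q \<and> card C = Suc n) \<and> ext_diff V y' = z - ext_diff V y"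
    proof (rule Suc.IH)
      fix C assume nz: "(z - ext_diff V y) C \<noteq> 0"
      then show CQ: "C \<in> Q \<and> card C = n"
        using z_supp[of C] dy_supp[of C] by (cases "z C = 0") auto
      show "card (C \<inter> W) < N"
        using dy[of C] nz CQ by (cases "card (C \<inter> W) < N") auto
    next
      have "ext_diff V (z - ext_diff V y + ext_diff V y) = ext_diff V (z - ext_diff V y) + 0"
        unfolding ext_diff_add ddy ..
      then show "ext_diff V (z - ext_diff V y) = 0"
        by (simp only: diff_add_cancel z_cyc add_0_right)
    qed
    then obtain y' where y': "\<And>C. y' C \<noteq> 0 \<Longrightarrow> C \<in> Q \<and> card C = Suc n"
      "ext_diff V y' = z - ext_diff V y" by blast
    show ?case
    proof (intro exI[of _ "y + y'"] conjI allI impI)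
      fix C assume "(y + y') C \<noteq> 0"
      then have "y C \<noteq> 0 \<or> y' C \<noteq> 0" by auto
      then show "C \<in> Q" "card C = Suc n" using y_supp y'(1) by blast+
    next
      show "ext_diff V (y + y') = z" unfolding ext_diff_add y'(2) by simp
    qed
  qed
  from this[of z "Suc (card W + n)"] show ?thesis
  proof (rule, goal_cases)
    case (3 C)
    then have "C \<in> Q" "card C = n" using supp by auto
    then have "card (C \<inter> W) \<le> n" using finQ card_mono[of C "C \<inter> W"] by auto
    then show ?case by simp
  qed (use supp cyc in auto)
qed


section \<open>Gaussian elimination in complexes\<close>

definition mat_op :: "'v set \<Rightarrow> ('v \<Rightarrow> 'v \<Rightarrow> 'a::comm_ring_1) \<Rightarrow> ('v \<Rightarrow> 'a) \<Rightarrow> 'v \<Rightarrow> 'a" where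
  "mat_op K D f \<beta> = (if \<beta> \<in> K then \<Sum>\<alpha>\<in>K. D \<beta> \<alpha> * f \<alpha> else 0)"

definition supported :: "'v set \<Rightarrow> ('v \<Rightarrow> 'a::zero) \<Rightarrow> bool" where
  "supported X f \<longleftrightarrow> (\<forall>\<alpha>. \<alpha> \<notin> X \<longrightarrow> f \<alpha> = 0)"

definition restr :: "'v set \<Rightarrow> ('v \<Rightarrow> 'a::zero) \<Rightarrow> 'v \<Rightarrow> 'a" where
  "restr X f \<alpha> = (if \<alpha> \<in> X then f \<alpha> else 0)"

definition square_zero :: "'v set \<Rightarrow> ('v \<Rightarrow> 'v \<Rightarrow> 'a::comm_ring_1) \<Rightarrow> bool" where
  "square_zero K D \<longleftrightarrow> (\<forall>f. supported K f \<longrightarrow> mat_op K D (mat_op K D f) = 0)"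

text \<open>
  The span of the cells in \<open>X\<close> is a complement of the cycles: it meets them in zero, and every boundary
  is the boundary of one of its elements.
\<close>

definition complements_cycles :: "'v set \<Rightarrow> ('v \<Rightarrow> 'v \<Rightarrow> 'a::comm_ring_1) \<Rightarrow> 'v set \<Rightarrow> bool" where
  "complements_cycles K D X \<longleftrightarrow>
     (\<forall>f. supported X f \<and> mat_op K D f = 0 \<longrightarrow> f = 0) \<and>
     (\<forall>f. supported K f \<longrightarrow> (\<exists>u. supported X u \<and> mat_op K D u = mat_op K D f))"

lemma mat_op_add: "mat_op K D (f + g) = mat_op K D f + mat_op K D g"
  by (rule ext) (simp add: mat_op_def algebra_simps sum.distrib)

lemma mat_op_0: "mat_op K D 0 = 0"
  by (rule ext) (simp add: mat_op_def)

lemma mat_op_diff: "mat_op K D (f - g) = mat_op K D f - mat_op K D g"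
  by (rule ext) (simp add: mat_op_def algebra_simps sum_subtractf)

lemma supported_mat_op: "supported K (mat_op K D f)"
  by (simp add: supported_def mat_op_def)

lemma supported_add:
  "supported X f \<Longrightarrow> supported X g \<Longrightarrow> supported X (f + (g :: 'v \<Rightarrow> 'a::ab_group_add))"
  by (simp add: supported_def)

lemma supported_diff:
  "supported X f \<Longrightarrow> supported X g \<Longrightarrow> supported X (f - (g :: 'v \<Rightarrow> 'a::ab_group_add))"
  by (simp add: supported_def)

lemma supported_mono: "supported X f \<Longrightarrow> X \<subseteq> Y \<Longrightarrow> supported Y f"
  by (auto simp: supported_def)

lemma supported_restr: "supported X (restr X f)"
  by (simp add: supported_def restr_def)

text \<open>
  The cells in \<open>S\<close> and \<open>R\<close> are eliminated, as the sources and the targets of a matching are.  The map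
  \<open>\<Phi>\<close> takes values in the span of \<open>S\<close>.  It is a left inverse of the differential on that span, and a
  right inverse of the differential followed by the projection to the span of \<open>R\<close>.  For a
  matching, both inversion properties come from its acyclicity.
\<close>

locale elimination =
  fixes K :: "'v set" and D \<Phi> :: "'v \<Rightarrow> 'v \<Rightarrow> 'a::comm_ring_1" and S R :: "'v set"
  assumes fin: "finite K" and S_K: "S \<subseteq> K" and R_K: "R \<subseteq> K" and S_R: "S \<inter> R = {}"
    and sq: "square_zero K D"
    and phi_range: "\<And>\<delta> \<gamma>. \<Phi> \<delta> \<gamma> \<noteq> 0 \<Longrightarrow> \<delta> \<in> S"
    and phi_D: "\<And>\<beta> \<delta>. \<beta> \<in> S \<Longrightarrow> \<delta> \<in> K \<Longrightarrow> (\<Sum>\<gamma>\<in>K. \<Phi> \<delta> \<gamma> * D \<gamma> \<beta>) = (if \<delta> = \<beta> then 1 else 0)"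
    and D_phi: "\<And>\<alpha> \<gamma>. \<alpha> \<in> R \<Longrightarrow> \<gamma> \<in> K \<Longrightarrow> (\<Sum>\<delta>\<in>K. D \<alpha> \<delta> * \<Phi> \<delta> \<gamma>) = (if \<alpha> = \<gamma> then 1 else 0)"
begin

abbreviation "d \<equiv> mat_op K D"
abbreviation "\<phi> \<equiv> mat_op K \<Phi>"

definition C :: "'v set" where "C = K - (S \<union> R)"

definition reduced :: "'v \<Rightarrow> 'v \<Rightarrow> 'a" where
  "reduced \<beta> \<alpha> = D \<beta> \<alpha> - (\<Sum>\<gamma>\<in>K. \<Sum>\<delta>\<in>K. D \<beta> \<delta> * \<Phi> \<delta> \<gamma> * D \<gamma> \<alpha>)"

lemma C_K: "C \<subseteq> K" by (auto simp: C_def)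

lemma dd: "supported K f \<Longrightarrow> d (d f) = 0"
  using sq by (simp add: square_zero_def)

lemma phi_supported: "supported S (\<phi> f)"
proof -
  have "\<phi> f \<delta> = 0" if "\<delta> \<notin> S" for \<delta>
  proof -
    have "\<Phi> \<delta> \<gamma> = 0" for \<gamma> using phi_range that by blast
    then show ?thesis by (simp add: mat_op_def)
  qed
  then show ?thesis by (simp add: supported_def)
qed

lemma phi_d:
  assumes "supported S s"
  shows "\<phi> (d s) = s"
proof
  fix \<delta>
  show "\<phi> (d s) \<delta> = s \<delta>"
  proof (cases "\<delta> \<in> K")
    case False
    then have "s \<delta> = 0" using assms S_K by (auto simp: supported_def)
    then show ?thesis using False by (simp add: mat_op_def)
  next
    case True
    have "\<phi> (d s) \<delta> = (\<Sum>\<gamma>\<in>K. \<Sum>\<beta>\<in>K. \<Phi> \<delta> \<gamma> * (D \<gamma> \<beta> * s \<beta>))"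
      using True by (simp add: mat_op_def sum_distrib_left)
    also have "\<dots> = (\<Sum>\<beta>\<in>K. (\<Sum>\<gamma>\<in>K. \<Phi> \<delta> \<gamma> * D \<gamma> \<beta>) * s \<beta>)"
      by (subst sum.swap) (simp add: sum_distrib_right mult.assoc)
    also have "\<dots> = (\<Sum>\<beta>\<in>K. if \<delta> = \<beta> then s \<beta> else 0)"
    proof (rule sum.cong[OF refl])
      fix \<beta> assume "\<beta> \<in> K"
      then show "(\<Sum>\<gamma>\<in>K. \<Phi> \<delta> \<gamma> * D \<gamma> \<beta>) * s \<beta> = (if \<delta> = \<beta> then s \<beta> else 0)"
        using phi_D[of \<beta> \<delta>] True assms by (cases "\<beta> \<in> S") (auto simp: supported_def)
    qed
    also have "\<dots> = s \<delta>" using True fin by simp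
    finally show ?thesis .
  qed
qed

lemma d_phi:
  assumes "supported K x" "\<alpha> \<in> R"
  shows "d (\<phi> x) \<alpha> = x \<alpha>"
proof -
  have \<alpha>: "\<alpha> \<in> K" using assms(2) R_K by auto
  have "d (\<phi> x) \<alpha> = (\<Sum>\<delta>\<in>K. \<Sum>\<gamma>\<in>K. D \<alpha> \<delta> * (\<Phi> \<delta> \<gamma> * x \<gamma>))"
    using \<alpha> by (simp add: mat_op_def sum_distrib_left)
  also have "\<dots> = (\<Sum>\<gamma>\<in>K. (\<Sum>\<delta>\<in>K. D \<alpha> \<delta> * \<Phi> \<delta> \<gamma>) * x \<gamma>)"
    by (subst sum.swap) (simp add: sum_distrib_right mult.assoc)
  also have "\<dots> = (\<Sum>\<gamma>\<in>K. if \<alpha> = \<gamma> then x \<gamma> else 0)"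
  proof (rule sum.cong[OF refl])
    fix \<gamma> assume "\<gamma> \<in> K"
    then show "(\<Sum>\<delta>\<in>K. D \<alpha> \<delta> * \<Phi> \<delta> \<gamma>) * x \<gamma> = (if \<alpha> = \<gamma> then x \<gamma> else 0)"
      using D_phi[OF assms(2)] by auto
  qed
  also have "\<dots> = x \<alpha>" using \<alpha> fin by simp
  finally show ?thesis .
qed

lemma reduced_op:
  assumes "supported C f"
  shows "mat_op C reduced f = restr C (d f - d (\<phi> (d f)))"
proof
  fix \<beta>
  show "mat_op C reduced f \<beta> = restr C (d f - d (\<phi> (d f))) \<beta>"
  proof (cases "\<beta> \<in> C")
    case False
    then show ?thesis by (simp add: mat_op_def restr_def)
  next
    case True
    then have \<beta>: "\<beta> \<in> K" using C_K by auto
    have "(\<Sum>\<alpha>\<in>C. reduced \<beta> \<alpha> * f \<alpha>) = (\<Sum>\<alpha>\<in>K. reduced \<beta> \<alpha> * f \<alpha>)"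
      using fin C_K assms by (intro sum.mono_neutral_left) (auto simp: supported_def)
    also have "\<dots> = (\<Sum>\<alpha>\<in>K. D \<beta> \<alpha> * f \<alpha>)
        - (\<Sum>\<alpha>\<in>K. \<Sum>\<gamma>\<in>K. \<Sum>\<delta>\<in>K. D \<beta> \<delta> * \<Phi> \<delta> \<gamma> * D \<gamma> \<alpha> * f \<alpha>)"
      by (simp add: reduced_def left_diff_distrib sum_subtractf sum_distrib_right)
    also have "(\<Sum>\<alpha>\<in>K. \<Sum>\<gamma>\<in>K. \<Sum>\<delta>\<in>K. D \<beta> \<delta> * \<Phi> \<delta> \<gamma> * D \<gamma> \<alpha> * f \<alpha>)
        = (\<Sum>\<gamma>\<in>K. \<Sum>\<alpha>\<in>K. \<Sum>\<delta>\<in>K. D \<beta> \<delta> * \<Phi> \<delta> \<gamma> * D \<gamma> \<alpha> * f \<alpha>)"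
      by (rule sum.swap)
    also have "\<dots> = (\<Sum>\<gamma>\<in>K. \<Sum>\<delta>\<in>K. \<Sum>\<alpha>\<in>K. D \<beta> \<delta> * \<Phi> \<delta> \<gamma> * D \<gamma> \<alpha> * f \<alpha>)"
      by (intro sum.cong refl sum.swap)
    also have "\<dots> = (\<Sum>\<delta>\<in>K. \<Sum>\<gamma>\<in>K. \<Sum>\<alpha>\<in>K. D \<beta> \<delta> * \<Phi> \<delta> \<gamma> * D \<gamma> \<alpha> * f \<alpha>)"
      by (rule sum.swap)
    also have "\<dots> = d (\<phi> (d f)) \<beta>"
      using \<beta> by (simp add: mat_op_def sum_distrib_left mult.assoc)
    finally show ?thesis
      using True \<beta> by (simp add: mat_op_def restr_def)
  qed
qed

lemma decompose:
  fixes w :: "'v \<Rightarrow> 'a"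
  assumes "supported K w" "\<And>\<alpha>. \<alpha> \<in> R \<Longrightarrow> w \<alpha> = 0"
  shows "w = restr C w + restr S w"
proof
  fix \<alpha>
  show "w \<alpha> = (restr C w + restr S w) \<alpha>"
    using assms S_R by (cases "\<alpha> \<in> K") (auto simp: restr_def C_def supported_def)
qed

lemma eliminated:
  assumes "supported K x"
  shows "supported K (x - d (\<phi> x))" "\<alpha> \<in> R \<Longrightarrow> (x - d (\<phi> x)) \<alpha> = 0"
    "d (x - d (\<phi> x)) = d x"
proof -
  show "supported K (x - d (\<phi> x))" using assms by (intro supported_diff supported_mat_op)
  show "\<alpha> \<in> R \<Longrightarrow> (x - d (\<phi> x)) \<alpha> = 0" using d_phi[OF assms] by simp
  show "d (x - d (\<phi> x)) = d x"
    by (simp add: mat_op_diff dd[OF supported_mat_op])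
qed

text \<open>
  The map \<open>f \<mapsto> f - \<Phi> d f\<close> is injective on the span of \<open>C\<close> and intertwines the reduced differential
  with \<open>d\<close>.
\<close>

lemma reduced_square_zero: "square_zero C reduced"
  unfolding square_zero_def
proof (intro allI impI)
  fix f :: "'v \<Rightarrow> 'a" assume f: "supported C f"
  then have fK: "supported K f" using C_K supported_mono by blast
  define w where "w = d f - d (\<phi> (d f))"
  define e where "e = restr C w"
  have e: "mat_op C reduced f = e" unfolding e_def w_def by (rule reduced_op[OF f])
  have w: "w = e + restr S w"
    unfolding e_def by (rule decompose; unfold w_def; intro eliminated supported_mat_op)
  have dw: "d w = 0"
    unfolding w_def using eliminated(3)[OF supported_mat_op, of D f] dd[OF fK] by simp
  have "0 = \<phi> (d w)" by (simp add: dw mat_op_0)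
  also have "\<dots> = \<phi> (d e) + restr S w"
    by (subst w) (simp add: mat_op_add phi_d[OF supported_restr])
  finally have s: "restr S w = - \<phi> (d e)" by (simp add: add_eq_0_iff)
  have "w = e - \<phi> (d e)" using w s by simp
  then have "d e - d (\<phi> (d e)) = 0" using dw by (simp add: mat_op_diff)
  moreover have "supported C e" by (simp add: e_def supported_restr)
  ultimately show "mat_op C reduced (mat_op C reduced f) = 0"
    unfolding e by (simp add: reduced_op restr_def fun_eq_iff)
qed

text \<open>
  The eliminated sources are exactly what has to be added to a complement of the cycles of the reduced
  complex.  Modulo boundaries \<open>d s\<close> with \<open>s\<close> in the span of \<open>S\<close>, every chain is supported in \<open>C \<union> S\<close>,
  and cycles of the reduced complex extend to cycles by \<open>z \<mapsto> z - \<Phi> d z\<close>.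
\<close>

lemma complements_cycles_lift:
  assumes "complements_cycles C reduced X" "X \<subseteq> C"
  shows "complements_cycles K D (X \<union> S)"
  unfolding complements_cycles_def
proof (intro conjI allI impI; (elim conjE)?)
  fix f :: "'v \<Rightarrow> 'a" assume f: "supported (X \<union> S) f" and df: "d f = 0"
  define u s where "u = restr X f" and "s = restr S f"
  have us: "supported X u" "supported S s" by (simp_all add: u_def s_def supported_restr)
  have XS: "X \<inter> S = {}" using assms(2) by (auto simp: C_def)
  have fus: "f = u + s"
    using f XS by (auto simp: fun_eq_iff u_def s_def restr_def supported_def)
  have "\<phi> (d u) + s = \<phi> (d f)"
    by (simp add: fus mat_op_add phi_d[OF us(2)])
  then have "\<phi> (d u) + s = 0" by (simp add: df mat_op_0)
  then have s: "s = - \<phi> (d u)" by (simp add: add_eq_0_iff2)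
  have ds: "d s = - d u" using df by (simp add: fus mat_op_add add_eq_0_iff)
  have "d (\<phi> (d u)) = d u"
    using ds mat_op_diff[of K D 0 "\<phi> (d u)"] by (simp add: s mat_op_0)
  then have "mat_op C reduced u = 0"
    using reduced_op[of u] supported_mono[OF us(1) assms(2)] by (simp add: restr_def fun_eq_iff)
  then have "u = 0" using assms(1) us(1) by (simp add: complements_cycles_def)
  then show "f = 0" by (simp add: fus s mat_op_0)
next
  fix f :: "'v \<Rightarrow> 'a" assume f: "supported K f"
  define x where "x = f - d (\<phi> f)"
  define c where "c = restr C x"
  have x: "x = c + restr S x"
    unfolding c_def by (rule decompose; unfold x_def; intro eliminated f)
  have c: "supported C c" by (simp add: c_def supported_restr)
  obtain u where u: "supported X u" "mat_op C reduced u = mat_op C reduced c"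
    using assms(1) c unfolding complements_cycles_def by blast
  define z where "z = c - u"
  have z: "supported C z"
    unfolding z_def using c supported_mono[OF u(1) assms(2)] by (rule supported_diff)
  then have zK: "supported K z" using C_K supported_mono by blast
  define w where "w = d z - d (\<phi> (d z))"
  have "restr C w = mat_op C reduced z" unfolding w_def using reduced_op[OF z] by simp
  also have "\<dots> = 0" by (simp add: z_def mat_op_diff u(2))
  finally have "restr C w = 0" .
  moreover have "w = restr C w + restr S w"
    by (rule decompose; unfold w_def; intro eliminated supported_mat_op)
  ultimately have w: "w = restr S w" by simp
  have "d w = 0"
    unfolding w_def using eliminated(3)[OF supported_mat_op, of D z] dd[OF zK] by simp
  then have "w = 0"
    using phi_d[OF supported_restr, of w] w by (simp add: mat_op_0)
  then have dz: "d z = d (\<phi> (d z))" by (simp add: w_def)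
  define v where "v = u + (\<phi> (d z) + restr S x)"
  have "c = u + z" by (simp add: z_def)
  then have "d c = d u + d (\<phi> (d z))" using dz by (simp add: mat_op_add)
  then have "d v = d x"
    by (subst x) (simp add: v_def mat_op_add add.assoc)
  also have "\<dots> = d f" unfolding x_def by (rule eliminated(3)[OF f])
  finally have "d v = d f" .
  moreover have "supported (X \<union> S) v"
    unfolding v_def
    by (intro supported_add supported_mono[OF u(1)] supported_mono[OF phi_supported]
          supported_mono[OF supported_restr]) auto
  ultimately show "\<exists>u. supported (X \<union> S) u \<and> d u = d f" by blast
qed

end


section \<open>Iterated Morse complexes after reduction of the coefficients\<close>

lemma unit_inv_left:
  assumes "c dvd (1 :: 'a::comm_ring_1)"
  shows "unit_inv c * c = 1"
proof -
  obtain k where k: "1 = c * k" using assms by (auto elim: dvdE)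
  have "unit_inv c = k"
    unfolding unit_inv_def
  proof (rule the_equality)
    show "k * c = 1" using k by (simp add: mult.commute)
    fix e assume e: "e * c = 1"
    have "e = e * (c * k)" by (simp flip: k)
    also have "\<dots> = k" using e by (simp flip: mult.assoc)
    finally show "e = k" .
  qed
  then show ?thesis using k by (simp add: mult.commute)
qed

context
  fixes K :: "('v, 'a::comm_ring_1) based_complex" and N :: "('v \<times> 'v) set"
  assumes fin: "finite (bc_cells K)" and mm: "morse_matching K N"
begin

lemma matching_cells: "(\<beta>, \<alpha>) \<in> N \<Longrightarrow> \<beta> \<in> bc_cells K \<and> \<alpha> \<in> bc_cells K"
  using mm by (auto simp: morse_matching_def bc_edges_def)

lemma matching_unit: "(\<beta>, \<alpha>) \<in> N \<Longrightarrow> unit_inv (bc_diff K \<alpha> \<beta>) * bc_diff K \<alpha> \<beta> = 1"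
  using mm by (intro unit_inv_left) (auto simp: morse_matching_def)

lemma matching_disjoint: "Domain N \<inter> Range N = {}"
proof -
  have False if e: "(\<alpha>, \<beta>) \<in> N" "(\<gamma>, \<alpha>) \<in> N" for \<alpha> \<beta> \<gamma>
  proof (cases "(\<alpha>, \<beta>) = (\<gamma>, \<alpha>)")
    case True
    then have "(\<alpha>, \<alpha>) \<in> morse_graph K N" using e by (simp add: morse_graph_def)
    moreover have "acyclic (morse_graph K N)" using mm by (simp add: morse_matching_def)
    ultimately show False unfolding acyclic_def by (meson r_into_trancl)
  next
    case False
    have "\<forall>(a, b)\<in>N. \<forall>(a', b')\<in>N. (a, b) \<noteq> (a', b') \<longrightarrow> {a, b} \<inter> {a', b'} = {}"
      using mm unfolding morse_matching_def by (elim conjE)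
    from this[THEN bspec, OF e(1), unfolded case_prod_conv, THEN bspec, OF e(2), unfolded case_prod_conv,
        THEN mp, OF False]
    show False by simp
  qed
  then show ?thesis by auto
qed

text \<open>
  Induction along the gradient paths, in the form in which the recursion for \<open>morse_phi\<close> uses it.
\<close>

lemma morse_induct:
  assumes "\<And>\<alpha>. (\<nexists>\<beta>. (\<beta>, \<alpha>) \<in> N) \<Longrightarrow> P \<alpha>"
    and "\<And>\<alpha> \<beta>. (\<beta>, \<alpha>) \<in> N \<Longrightarrow> (\<And>\<gamma>. (\<beta>, \<gamma>) \<in> bc_edges K \<Longrightarrow> \<gamma> \<noteq> \<alpha> \<Longrightarrow> P \<gamma>) \<Longrightarrow> P \<alpha>"
  shows "P \<alpha>"
  using wf_morse_graph[OF fin mm]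
proof (induction \<alpha>)
  case (less \<alpha>)
  show ?case
  proof (cases "\<exists>\<beta>. (\<beta>, \<alpha>) \<in> N")
    case False
    then show ?thesis by (rule assms(1))
  next
    case True
    then obtain \<beta> where \<beta>: "(\<beta>, \<alpha>) \<in> N" by blast
    show ?thesis
    proof (rule assms(2)[OF \<beta>])
      fix \<gamma> assume g: "(\<beta>, \<gamma>) \<in> bc_edges K" "\<gamma> \<noteq> \<alpha>"
      have "(\<beta>, \<gamma>) \<notin> N"
        using morse_matching_source_unique[OF mm \<beta>] g(2) by blast
      then have "(\<beta>, \<gamma>) \<in> morse_graph K N" "(\<alpha>, \<beta>) \<in> morse_graph K N"
        using g(1) \<beta> by (auto simp: morse_graph_def)
      then have "(\<gamma>, \<alpha>) \<in> ((morse_graph K N)\<^sup>+)\<inverse>"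
        by (meson converse_iff r_into_trancl trancl_into_trancl2)
      then show "P \<gamma>" by (rule less)
    qed
  qed
qed

lemma morse_phi_matched_sum:
  assumes "(\<beta>, \<alpha>) \<in> N"
  shows "morse_phi K N \<delta> \<alpha> = (if \<delta> = \<beta> then unit_inv (bc_diff K \<alpha> \<beta>) else 0) -
    (\<Sum>\<gamma>\<in>bc_cells K - {\<alpha>}. morse_phi K N \<delta> \<gamma> * bc_diff K \<gamma> \<beta> * unit_inv (bc_diff K \<alpha> \<beta>))"
proof -
  have "(\<Sum>\<gamma> | (\<beta>, \<gamma>) \<in> bc_edges K \<and> \<gamma> \<noteq> \<alpha>.
          morse_phi K N \<delta> \<gamma> * bc_diff K \<gamma> \<beta> * unit_inv (bc_diff K \<alpha> \<beta>))
      = (\<Sum>\<gamma>\<in>bc_cells K - {\<alpha>}. morse_phi K N \<delta> \<gamma> * bc_diff K \<gamma> \<beta> * unit_inv (bc_diff K \<alpha> \<beta>))"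
    using fin matching_cells[OF assms] by (intro sum.mono_neutral_left) (auto simp: bc_edges_def)
  then show ?thesis by (simp add: morse_phi_matched[OF fin mm assms])
qed

lemma morse_phi_range: "morse_phi K N \<delta> \<gamma> \<noteq> 0 \<Longrightarrow> \<delta> \<in> Domain N"
proof (rule ccontr)
  assume "\<delta> \<notin> Domain N"
  moreover have "\<delta> \<notin> Domain N \<longrightarrow> morse_phi K N \<delta> \<gamma> = 0"
  proof (induction rule: morse_induct)
    case (1 \<alpha>)
    then show ?case by (simp add: morse_phi_unmatched[OF fin mm])
  next
    case (2 \<alpha> \<beta>)
    then show ?case by (auto simp: morse_phi_matched[OF fin mm 2(1)])
  qed
  moreover assume "morse_phi K N \<delta> \<gamma> \<noteq> 0"
  ultimately show False by simp
qed

text \<open>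
  This is the defining recursion, solved for the term of the matched cell.
\<close>

lemma morse_phi_diff:
  assumes "\<beta> \<in> Domain N"
  shows "(\<Sum>\<gamma>\<in>bc_cells K. morse_phi K N \<delta> \<gamma> * bc_diff K \<gamma> \<beta>) = (if \<delta> = \<beta> then 1 else 0)"
proof -
  obtain \<alpha> where e: "(\<beta>, \<alpha>) \<in> N" using assms by blast
  let ?c = "unit_inv (bc_diff K \<alpha> \<beta>)"
  let ?s = "\<Sum>\<gamma>\<in>bc_cells K - {\<alpha>}. morse_phi K N \<delta> \<gamma> * bc_diff K \<gamma> \<beta>"
  have "(\<Sum>\<gamma>\<in>bc_cells K. morse_phi K N \<delta> \<gamma> * bc_diff K \<gamma> \<beta>)
      = morse_phi K N \<delta> \<alpha> * bc_diff K \<alpha> \<beta> + ?s"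
    using fin matching_cells[OF e] by (intro sum.remove) auto
  also have "morse_phi K N \<delta> \<alpha> = (if \<delta> = \<beta> then ?c else 0) - ?s * ?c"
    unfolding morse_phi_matched_sum[OF e, of \<delta>] by (simp add: sum_distrib_right)
  also have "((if \<delta> = \<beta> then ?c else 0) - ?s * ?c) * bc_diff K \<alpha> \<beta> + ?s
      = (if \<delta> = \<beta> then 1 else 0)"
    using matching_unit[OF e] by (auto simp: left_diff_distrib mult.assoc)
  finally show ?thesis .
qed

text \<open>
  The dual identity: the value at a matched cell \<open>\<gamma>\<close> is expressed by the recursion through the values
  at the other faces of its partner, where the identity holds by induction.
\<close>

lemma morse_diff_phi:
  assumes "\<alpha> \<in> Range N" "\<gamma> \<in> bc_cells K"
  shows "(\<Sum>\<delta>\<in>bc_cells K. bc_diff K \<alpha> \<delta> * morse_phi K N \<delta> \<gamma>) = (if \<alpha> = \<gamma> then 1 else 0)"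
  using assms(2)
proof (induction \<gamma> rule: morse_induct)
  case (1 \<gamma>)
  then have "\<alpha> \<noteq> \<gamma>" using assms(1) by auto
  then show ?case using 1 by (simp add: morse_phi_unmatched[OF fin mm])
next
  case (2 \<gamma> \<beta>)
  let ?c = "unit_inv (bc_diff K \<gamma> \<beta>)"
  have \<beta>: "\<beta> \<in> bc_cells K" and \<alpha>: "\<alpha> \<in> bc_cells K"
    using matching_cells 2(1) assms(1) by blast+
  have "(\<Sum>\<delta>\<in>bc_cells K. bc_diff K \<alpha> \<delta> * morse_phi K N \<delta> \<gamma>)
      = (\<Sum>\<delta>\<in>bc_cells K. (if \<delta> = \<beta> then bc_diff K \<alpha> \<delta> * ?c else 0) -
          (\<Sum>\<gamma>'\<in>bc_cells K - {\<gamma>}. bc_diff K \<alpha> \<delta> * morse_phi K N \<delta> \<gamma>' * (bc_diff K \<gamma>' \<beta> * ?c)))"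
    by (intro sum.cong refl)
      (auto simp: morse_phi_matched_sum[OF 2(1)] right_diff_distrib sum_distrib_left mult.assoc)
  also have "\<dots> = bc_diff K \<alpha> \<beta> * ?c -
      (\<Sum>\<delta>\<in>bc_cells K. \<Sum>\<gamma>'\<in>bc_cells K - {\<gamma>}. bc_diff K \<alpha> \<delta> * morse_phi K N \<delta> \<gamma>' * (bc_diff K \<gamma>' \<beta> * ?c))"
    using fin \<beta> by (simp add: sum_subtractf)
  also have "(\<Sum>\<delta>\<in>bc_cells K. \<Sum>\<gamma>'\<in>bc_cells K - {\<gamma>}. bc_diff K \<alpha> \<delta> * morse_phi K N \<delta> \<gamma>' * (bc_diff K \<gamma>' \<beta> * ?c))
      = (\<Sum>\<gamma>'\<in>bc_cells K - {\<gamma>}. (\<Sum>\<delta>\<in>bc_cells K. bc_diff K \<alpha> \<delta> * morse_phi K N \<delta> \<gamma>') * (bc_diff K \<gamma>' \<beta> * ?c))"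
    by (subst sum.swap) (simp add: sum_distrib_right)
  also have "\<dots> = (\<Sum>\<gamma>'\<in>bc_cells K - {\<gamma>}. if \<alpha> = \<gamma>' then bc_diff K \<alpha> \<beta> * ?c else 0)"
  proof (rule sum.cong[OF refl])
    fix \<gamma>' assume g: "\<gamma>' \<in> bc_cells K - {\<gamma>}"
    show "(\<Sum>\<delta>\<in>bc_cells K. bc_diff K \<alpha> \<delta> * morse_phi K N \<delta> \<gamma>') * (bc_diff K \<gamma>' \<beta> * ?c)
        = (if \<alpha> = \<gamma>' then bc_diff K \<alpha> \<beta> * ?c else 0)"
    proof (cases "bc_diff K \<gamma>' \<beta> = 0")
      case False
      then have "(\<beta>, \<gamma>') \<in> bc_edges K" using \<beta> g by (simp add: bc_edges_def)
      then show ?thesis using 2(2)[of \<gamma>'] g by simp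
    qed auto
  qed
  also have "bc_diff K \<alpha> \<beta> * ?c - \<dots> = (if \<alpha> = \<gamma> then 1 else 0)"
    using fin \<alpha> matching_unit[OF 2(1)] by (auto simp: mult.commute)
  finally show ?case .
qed

end

text \<open>
  The reduction of the coefficients, later the passage from polynomials to their constant terms.  The
  Morse complexes are formed over the original ring.
\<close>

locale comm_ring_hom_fun =
  fixes \<epsilon> :: "'a::comm_ring_1 \<Rightarrow> 'k::comm_ring_1"
  assumes hom_add: "\<epsilon> (a + b) = \<epsilon> a + \<epsilon> b"
    and hom_mult: "\<epsilon> (a * b) = \<epsilon> a * \<epsilon> b"
    and hom_1: "\<epsilon> 1 = 1"
begin

lemma hom_0: "\<epsilon> 0 = 0"
  using hom_add[of 0 0] by simp

lemma hom_diff: "\<epsilon> (a - b) = \<epsilon> a - \<epsilon> b"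
  using hom_add[of "a - b" b] by simp

lemma hom_uminus: "\<epsilon> (- a) = - \<epsilon> a"
  using hom_diff[of 0 a] by (simp add: hom_0)

lemma hom_sum: "\<epsilon> (sum f A) = (\<Sum>x\<in>A. \<epsilon> (f x))"
  by (induction A rule: infinite_finite_induct) (simp_all add: hom_0 hom_add)

abbreviation "red_diff K \<equiv> \<lambda>\<beta> \<alpha>. \<epsilon> (bc_diff K \<beta> \<alpha>)"

lemma elimination_morse:
  assumes fin: "finite (bc_cells K)" and mm: "morse_matching K N"
    and sq: "square_zero (bc_cells K) (red_diff K)"
  shows "elimination (bc_cells K) (red_diff K) (\<lambda>\<delta> \<gamma>. \<epsilon> (morse_phi K N \<delta> \<gamma>)) (Domain N) (Range N)"
proof
  show "Domain N \<subseteq> bc_cells K" "Range N \<subseteq> bc_cells K"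
    using matching_cells[OF fin mm] by blast+
  show "Domain N \<inter> Range N = {}" by (rule matching_disjoint[OF fin mm])
  show "\<epsilon> (morse_phi K N \<delta> \<gamma>) \<noteq> 0 \<Longrightarrow> \<delta> \<in> Domain N" for \<delta> \<gamma>
    using morse_phi_range[OF fin mm, of \<delta> \<gamma>] by (metis hom_0)
  fix \<beta> \<delta> assume "\<beta> \<in> Domain N" "\<delta> \<in> bc_cells K"
  then show "(\<Sum>\<gamma>\<in>bc_cells K. \<epsilon> (morse_phi K N \<delta> \<gamma>) * red_diff K \<gamma> \<beta>) = (if \<delta> = \<beta> then 1 else 0)"
    using arg_cong[OF morse_phi_diff[OF fin mm, of \<beta> \<delta>], of \<epsilon>]
    by (simp add: hom_sum hom_mult hom_1 hom_0 split: if_splits)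
next
  fix \<alpha> \<gamma> assume "\<alpha> \<in> Range N" "\<gamma> \<in> bc_cells K"
  then show "(\<Sum>\<delta>\<in>bc_cells K. red_diff K \<alpha> \<delta> * \<epsilon> (morse_phi K N \<delta> \<gamma>)) = (if \<alpha> = \<gamma> then 1 else 0)"
    using arg_cong[OF morse_diff_phi[OF fin mm, of \<alpha> \<gamma>], of \<epsilon>]
    by (simp add: hom_sum hom_mult hom_1 hom_0 split: if_splits)
qed (rule fin sq)+

lemma morse_complex_elimination:
  assumes "finite (bc_cells K)" "morse_matching K N" "square_zero (bc_cells K) (red_diff K)"
  shows "bc_cells (morse_complex K N) = elimination.C (bc_cells K) (Domain N) (Range N)"
    "red_diff (morse_complex K N) =
      elimination.reduced (bc_cells K) (red_diff K) (\<lambda>\<delta> \<gamma>. \<epsilon> (morse_phi K N \<delta> \<gamma>))"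
  unfolding elimination.C_def[OF elimination_morse[OF assms]] fun_eq_iff
    elimination.reduced_def[OF elimination_morse[OF assms]]
  by (simp_all add: morse_complex_def Field_def hom_diff hom_sum hom_mult)

text \<open>
  The labels stand for multidegrees.  After reduction, a nonzero entry of the differential joins cells
  of equal multidegree, and Morse complexes inherit this.  This replaces a description of the entries
  as scalar multiples of monomials.
\<close>

lemma morse_phi_label:
  assumes fin: "finite (bc_cells K)" and mm: "morse_matching K N"
    and lab: "\<And>\<alpha> \<beta>. \<alpha> \<in> bc_cells K \<Longrightarrow> \<beta> \<in> bc_cells K \<Longrightarrow> red_diff K \<beta> \<alpha> \<noteq> 0 \<Longrightarrow> lbl \<alpha> = lbl \<beta>"
    and N: "\<And>\<alpha> \<beta>. (\<alpha>, \<beta>) \<in> N \<Longrightarrow> lbl \<alpha> = lbl \<beta>"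
  shows "\<epsilon> (morse_phi K N \<delta> \<gamma>) \<noteq> 0 \<Longrightarrow> lbl \<delta> = lbl \<gamma>"
proof (induction \<gamma> rule: morse_induct[OF fin mm])
  case (1 \<alpha>)
  then show ?case by (simp add: morse_phi_unmatched[OF fin mm] hom_0)
next
  case (2 \<alpha> \<beta>)
  show ?case
  proof (cases "\<delta> = \<beta>")
    case True
    then show ?thesis using N[OF 2(1)] by simp
  next
    case False
    then have "(\<Sum>\<gamma> | (\<beta>, \<gamma>) \<in> bc_edges K \<and> \<gamma> \<noteq> \<alpha>.
        \<epsilon> (morse_phi K N \<delta> \<gamma>) * red_diff K \<gamma> \<beta> * \<epsilon> (unit_inv (bc_diff K \<alpha> \<beta>))) \<noteq> 0"
      using 2(3) by (simp add: morse_phi_matched[OF fin mm 2(1)] hom_diff hom_uminus hom_0 hom_sum hom_mult)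
    then obtain \<gamma> where g: "(\<beta>, \<gamma>) \<in> bc_edges K" "\<gamma> \<noteq> \<alpha>"
      "\<epsilon> (morse_phi K N \<delta> \<gamma>) * red_diff K \<gamma> \<beta> * \<epsilon> (unit_inv (bc_diff K \<alpha> \<beta>)) \<noteq> 0"
      by (rule sum.not_neutral_contains_not_neutral) blast
    then have "\<epsilon> (morse_phi K N \<delta> \<gamma>) \<noteq> 0" "red_diff K \<gamma> \<beta> \<noteq> 0" by auto
    then show ?thesis
      using 2(2)[OF g(1,2)] lab[of \<beta> \<gamma>] N[OF 2(1)] g(1) by (auto simp: bc_edges_def)
  qed
qed

lemma morse_complex_label:
  assumes fin: "finite (bc_cells K)" and mm: "morse_matching K N"
    and lab: "\<And>\<alpha> \<beta>. \<alpha> \<in> bc_cells K \<Longrightarrow> \<beta> \<in> bc_cells K \<Longrightarrow> red_diff K \<beta> \<alpha> \<noteq> 0 \<Longrightarrow> lbl \<alpha> = lbl \<beta>"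
    and N: "\<And>\<alpha> \<beta>. (\<alpha>, \<beta>) \<in> N \<Longrightarrow> lbl \<alpha> = lbl \<beta>"
    and ab: "\<alpha> \<in> bc_cells K" "\<beta> \<in> bc_cells K" and nz: "red_diff (morse_complex K N) \<beta> \<alpha> \<noteq> 0"
  shows "lbl \<alpha> = lbl \<beta>"
proof (rule ccontr)
  assume ne: "lbl \<alpha> \<noteq> lbl \<beta>"
  have phi: "lbl \<delta> = lbl \<gamma>" if "\<epsilon> (morse_phi K N \<delta> \<gamma>) \<noteq> 0" for \<delta> \<gamma>
    by (rule morse_phi_label[where lbl = lbl, OF fin mm lab N that])
  have "red_diff K \<beta> \<delta> * \<epsilon> (morse_phi K N \<delta> \<gamma>) * red_diff K \<gamma> \<alpha> = 0"
    if "\<gamma> \<in> bc_cells K" "\<delta> \<in> bc_cells K" for \<gamma> \<delta>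
    using lab[of \<delta> \<beta>] lab[of \<alpha> \<gamma>] that ab ne phi[of \<delta> \<gamma>] by fastforce
  moreover have "red_diff K \<beta> \<alpha> = 0" using lab[of \<alpha> \<beta>] ab ne by auto
  ultimately have "red_diff (morse_complex K N) \<beta> \<alpha> = 0"
    by (simp add: morse_complex_def hom_diff hom_sum hom_mult)
  with nz show False by simp
qed

text \<open>
  In the final Morse complex the reduced differential is zero: an entry that survives reduction joins
  cells of equal label, and minimality excludes such entries.  There the empty set of cells
  complements the cycles, and every elimination step that is undone adds the sources of one matching.
\<close>

lemma iterated_sources_complement_cycles:
  fixes T :: "('v, 'a) based_complex" and lbl :: "'v \<Rightarrow> 'l"
  assumes fin: "finite (bc_cells T)"
    and sq: "square_zero (bc_cells T) (red_diff T)"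
    and mm: "\<And>i. morse_matching (morse_iter T M i) (M i)"
    and lab: "\<And>\<alpha> \<beta>. \<alpha> \<in> bc_cells T \<Longrightarrow> \<beta> \<in> bc_cells T \<Longrightarrow> red_diff T \<beta> \<alpha> \<noteq> 0 \<Longrightarrow> lbl \<alpha> = lbl \<beta>"
    and M: "\<And>i \<alpha> \<beta>. (\<alpha>, \<beta>) \<in> M i \<Longrightarrow> lbl \<alpha> = lbl \<beta>"
    and minimal: "\<And>\<alpha> \<beta>. (\<alpha>, \<beta>) \<in> bc_edges (morse_iter_all T M) \<Longrightarrow> lbl \<alpha> \<noteq> lbl \<beta>"
  shows "complements_cycles (bc_cells T) (red_diff T) (\<Union>i. Domain (M i))"
proof -
  let ?K = "morse_iter T M"
  have cells_Suc: "bc_cells (?K (Suc i)) = bc_cells (?K i) - Field (M i)" for i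
    by (simp add: morse_complex_def)
  have cells_antimono: "bc_cells (?K j) \<subseteq> bc_cells (?K i)" if "i \<le> j" for i j
    using that
  proof (induction rule: dec_induct)
    case (step n)
    then show ?case using cells_Suc[of n] by blast
  qed simp
  have fin_i: "finite (bc_cells (?K i))" for i
    using finite_subset[OF cells_antimono[of 0 i]] fin by simp
  have M_cells: "Field (M i) \<subseteq> bc_cells (?K i)" for i
    using matching_cells[OF fin_i mm, of _ _ i] unfolding Field_def by blast
  have inv: "square_zero (bc_cells (?K i)) (red_diff (?K i)) \<and>
    (\<forall>\<alpha>\<in>bc_cells (?K i). \<forall>\<beta>\<in>bc_cells (?K i). red_diff (?K i) \<beta> \<alpha> \<noteq> 0 \<longrightarrow> lbl \<alpha> = lbl \<beta>)" for i
  proof (induction i)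
    case 0
    then show ?case using sq lab by simp
  next
    case (Suc i)
    interpret elimination "bc_cells (?K i)" "red_diff (?K i)"
      "\<lambda>\<delta> \<gamma>. \<epsilon> (morse_phi (?K i) (M i) \<delta> \<gamma>)" "Domain (M i)" "Range (M i)"
      using Suc by (intro elimination_morse fin_i mm) simp
    have "square_zero (bc_cells (?K (Suc i))) (red_diff (?K (Suc i)))"
      using reduced_square_zero Suc morse_complex_elimination[OF fin_i mm] by simp
    moreover have "lbl \<alpha> = lbl \<beta>"
      if ab: "\<alpha> \<in> bc_cells (?K (Suc i))" "\<beta> \<in> bc_cells (?K (Suc i))" and nz: "red_diff (?K (Suc i)) \<beta> \<alpha> \<noteq> 0"
      for \<alpha> \<beta>
    proof (rule morse_complex_label[where lbl = lbl, OF fin_i mm])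
      show "red_diff (morse_complex (?K i) (M i)) \<beta> \<alpha> \<noteq> 0" using nz by simp
      show "\<alpha> \<in> bc_cells (?K i)" "\<beta> \<in> bc_cells (?K i)" using ab cells_Suc[of i] by blast+
      show "lbl a = lbl b" if "(a, b) \<in> M i" for a b by (rule M[OF that])
      show "lbl a = lbl b"
        if "a \<in> bc_cells (?K i)" "b \<in> bc_cells (?K i)" "red_diff (?K i) b a \<noteq> 0" for a b
        using conjunct2[OF Suc, THEN bspec, OF that(1), THEN bspec, OF that(2)] that(3) by (rule mp)
    qed
    ultimately show ?case by blast
  qed
  \<comment> \<open>nonempty matchings remove cells, so only finitely many of them are nonempty\<close>
  have "\<exists>n. \<forall>i\<ge>n. M i = {}"
  proof -
    define e where "e = (\<lambda>i. SOME \<alpha>. \<alpha> \<in> Field (M i))"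
    have e: "e i \<in> Field (M i)" if "M i \<noteq> {}" for i
    proof -
      have "\<exists>\<alpha>. \<alpha> \<in> Field (M i)" using that by (auto simp: Field_def)
      then show ?thesis unfolding e_def by (rule someI_ex)
    qed
    have ne: "e i \<noteq> e j" if "i < j" "M i \<noteq> {}" "M j \<noteq> {}" for i j
      using e[OF that(2)] e[OF that(3)] M_cells[of j] cells_antimono[of "Suc i" j] cells_Suc[of i] that(1)
      by auto
    have "inj_on e {i. M i \<noteq> {}}"
    proof (rule inj_onI, rule ccontr)
      fix i j assume "i \<in> {i. M i \<noteq> {}}" "j \<in> {i. M i \<noteq> {}}" "e i = e j" "i \<noteq> j"
      then show False using ne[of i j] ne[of j i] by (cases "i < j") simp_all
    qed
    moreover have "e ` {i. M i \<noteq> {}} \<subseteq> bc_cells T"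
    proof (rule image_subsetI)
      fix i assume "i \<in> {i. M i \<noteq> {}}"
      then have "e i \<in> bc_cells (?K i)" using e[of i] M_cells[of i] by blast
      then show "e i \<in> bc_cells T" using cells_antimono[of 0 i] by (simp add: subset_iff)
    qed
    ultimately have "finite {i. M i \<noteq> {}}"
      using fin by (meson finite_imageD finite_subset)
    then obtain n where n: "\<forall>i\<in>{i. M i \<noteq> {}}. i < n"
      unfolding finite_nat_set_iff_bounded by blast
    have "M i = {}" if "n \<le> i" for i
      using bspec[OF n, of i] that by (cases "M i = {}") simp_all
    then show ?thesis by blast
  qed
  then have n': "\<forall>i\<ge>LEAST n. \<forall>i\<ge>n. M i = {}. M i = {}"
    by (rule LeastI_ex)
  define n where "n = (LEAST n. \<forall>i\<ge>n. M i = {})"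
  have n: "\<forall>i\<ge>n. M i = {}" unfolding n_def by (rule n')
  have all: "morse_iter_all T M = ?K n" by (simp add: morse_iter_all_def n_def)
  have "complements_cycles (bc_cells (?K i)) (red_diff (?K i)) (\<Union>j\<in>{i..}. Domain (M j))"
    if "i \<le> n" for i
    using that
  proof (induction rule: inc_induct)
    case base
    have "red_diff (?K n) \<beta> \<alpha> = 0" if "\<alpha> \<in> bc_cells (?K n)" "\<beta> \<in> bc_cells (?K n)" for \<alpha> \<beta>
    proof (rule ccontr)
      assume nz: "red_diff (?K n) \<beta> \<alpha> \<noteq> 0"
      then have "bc_diff (?K n) \<beta> \<alpha> \<noteq> 0" using hom_0 by metis
      then have "lbl \<alpha> \<noteq> lbl \<beta>"
        using minimal[of \<alpha> \<beta>] that by (simp add: all bc_edges_def)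
      moreover have "lbl \<alpha> = lbl \<beta>"
        using conjunct2[OF inv[of n], THEN bspec, OF that(1), THEN bspec, OF that(2)] nz by (rule mp)
      ultimately show False by simp
    qed
    then have "mat_op (bc_cells (?K n)) (red_diff (?K n)) f = 0" for f
      by (auto simp: mat_op_def fun_eq_iff)
    moreover have "(\<Union>j\<in>{n..}. Domain (M j)) = {}" using n by auto
    moreover have "f = 0" if "supported {} f" for f :: "'v \<Rightarrow> 'k"
      using that by (simp add: supported_def fun_eq_iff)
    moreover have "supported {} (0 :: 'v \<Rightarrow> 'k)" by (simp add: supported_def)
    ultimately show ?case unfolding complements_cycles_def by simp blast
  next
    case (step i)
    interpret elimination "bc_cells (?K i)" "red_diff (?K i)"
      "\<lambda>\<delta> \<gamma>. \<epsilon> (morse_phi (?K i) (M i) \<delta> \<gamma>)" "Domain (M i)" "Range (M i)"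
      using inv[of i] by (intro elimination_morse fin_i mm) simp
    let ?X = "\<Union>j\<in>{Suc i..}. Domain (M j)"
    have "?X \<subseteq> bc_cells (?K (Suc i))"
      using M_cells cells_antimono[of "Suc i"] by (fastforce simp: Field_def)
    then have "complements_cycles (bc_cells (?K i)) (red_diff (?K i)) (?X \<union> Domain (M i))"
      using complements_cycles_lift[of ?X] step.IH inv[of i] morse_complex_elimination[OF fin_i mm]
      by simp
    moreover have "{i..} = insert i {Suc i..}" by auto
    then have "?X \<union> Domain (M i) = (\<Union>j\<in>{i..}. Domain (M j))" by auto
    ultimately show ?case by simp
  qed
  from this[of 0] show ?thesis by (simp add: atLeast_0)
qed

end


section \<open>Monomials and monomial ideals\<close>

abbreviation (input) "lookup \<equiv> Poly_Mapping.lookup"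
abbreviation (input) "keys \<equiv> Poly_Mapping.keys"

lemma single_mult_lookup:
  fixes Q :: "('x, 'k::field) mpoly"
  shows "lookup (Poly_Mapping.single a s * Q) (a + c) = s * lookup Q c"
proof -
  have inner: "(\<Sum>q. lookup Q q when a + c = a + q) = lookup Q c"
    by (simp add: eq_commute[of c])
  have "lookup (Poly_Mapping.single a s * Q) (a + c)
      = (\<Sum>l. (s * (\<Sum>q. lookup Q q when a + c = a + q)) when l = a)"
    unfolding lookup_mult
    by (rule Sum_any.cong) (auto simp: lookup_single when_def)
  also have "\<dots> = s * lookup Q c" unfolding inner by simp
  finally show ?thesis .
qed

lemma lookup_mult_nonzero:
  fixes P Q :: "('x, 'k::field) mpoly"
  assumes "lookup (P * Q) c \<noteq> 0"
  obtains a b where "c = a + b" "lookup P a \<noteq> 0" "lookup Q b \<noteq> 0"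
proof -
  have "c \<in> keys (P * Q)" using assms by (simp add: in_keys_iff)
  then show ?thesis using keys_mult[of P Q] that by (auto simp: in_keys_iff)
qed

lemma mon_add_eq_0:
  fixes a b :: "'x mon"
  assumes "a + b = 0"
  shows "a = 0 \<and> b = 0"
proof -
  have "lookup a x + lookup b x = 0" for x
    using assms by (simp flip: lookup_add)
  then show ?thesis by (auto intro!: poly_mapping_eqI)
qed

text \<open>
  A product of monomials is \<open>1\<close> only if both are, so taking constant terms is multiplicative.
\<close>

lemma lookup_mult_0:
  fixes P Q :: "('x, 'k::field) mpoly"
  shows "lookup (P * Q) 0 = lookup P 0 * lookup Q 0"
proof -
  define P' where "P' = P - Poly_Mapping.single 0 (lookup P 0)"
  have P': "P = Poly_Mapping.single 0 (lookup P 0) + P'" "lookup P' 0 = 0"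
    by (simp_all add: P'_def lookup_minus)
  have "lookup (P' * Q) 0 = 0"
  proof (rule ccontr)
    assume "lookup (P' * Q) 0 \<noteq> 0"
    then obtain a b where "0 = a + b" "lookup P' a \<noteq> 0" "lookup Q b \<noteq> 0" by (rule lookup_mult_nonzero)
    then show False using mon_add_eq_0[of a b] P'(2) by auto
  qed
  then have "lookup (P * Q) 0 = lookup (Poly_Mapping.single 0 (lookup P 0) * Q) (0 + 0)"
    by (subst P'(1)) (simp add: distrib_right lookup_add)
  also have "\<dots> = lookup P 0 * lookup Q 0" by (rule single_mult_lookup)
  finally show ?thesis .
qed

lemma lookup_one_0: "lookup (1 :: ('x, 'k::field) mpoly) 0 = 1"
  by (simp flip: single_one)

definition mon_le :: "'x mon \<Rightarrow> 'x mon \<Rightarrow> bool" where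
  "mon_le a b \<longleftrightarrow> (\<forall>x. lookup a x \<le> lookup b x)"

lemma mon_le_refl: "mon_le a a"
  by (simp add: mon_le_def)

lemma mon_le_trans: "mon_le a b \<Longrightarrow> mon_le b c \<Longrightarrow> mon_le a c"
  unfolding mon_le_def using order_trans by blast

lemma mon_le_antisym: "mon_le a b \<Longrightarrow> mon_le b a \<Longrightarrow> a = b"
  by (intro poly_mapping_eqI) (simp add: mon_le_def order_antisym)

lemma mon_le_add: "mon_le a c \<Longrightarrow> mon_le b e \<Longrightarrow> mon_le (a + b) (c + e)"
  by (simp add: mon_le_def lookup_add add_mono)

lemma mon_le_add_self: "mon_le a (a + b)"
  by (simp add: mon_le_def lookup_add)

lemma mon_le_iff: "mon_le a b \<longleftrightarrow> (\<exists>c. b = a + c)"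
proof
  assume "mon_le a b"
  then have "b = a + (b - a)"
    by (intro poly_mapping_eqI) (simp add: mon_le_def lookup_add lookup_minus)
  then show "\<exists>c. b = a + c" ..
qed (auto simp: mon_le_add_self)

lemma lookup_mon_lcm: "lookup (mon_lcm \<mu> J) x = Max (insert 0 ((\<lambda>j. lookup (\<mu> j) x) ` J))"
  by transfer simp

lemma lookup_mon_gcd: "lookup (mon_gcd a b) x = min (lookup a x) (lookup b x)"
  by transfer simp

lemma mon_lcm_le_iff:
  assumes "finite J"
  shows "mon_le (mon_lcm \<mu> J) a \<longleftrightarrow> (\<forall>j\<in>J. mon_le (\<mu> j) a)"
  using assms by (auto simp: mon_le_def lookup_mon_lcm)

lemma mon_lcm_mono:
  assumes "finite J" "L \<subseteq> J"
  shows "mon_le (mon_lcm \<mu> L) (mon_lcm \<mu> J)"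
  using assms mon_lcm_le_iff[of J \<mu> "mon_lcm \<mu> J"] mon_lcm_le_iff[of L \<mu> "mon_lcm \<mu> J"]
    finite_subset[of L J] by (auto simp: mon_le_refl)

lemma lookup_mon_lcm_union:
  assumes "finite J" "finite L"
  shows "lookup (mon_lcm \<mu> (J \<union> L)) x = max (lookup (mon_lcm \<mu> J) x) (lookup (mon_lcm \<mu> L) x)"
proof -
  let ?f = "\<lambda>j. lookup (\<mu> j) x"
  have "insert 0 (?f ` (J \<union> L)) = insert 0 (?f ` J) \<union> insert 0 (?f ` L)" by auto
  then show ?thesis unfolding lookup_mon_lcm using assms by (simp only: Max_Un finite_insert finite_imageI insert_not_empty not_False_eq_True)
qed

lemma mon_gcd_eq_0_iff: "mon_gcd a b = 0 \<longleftrightarrow> (\<forall>x. lookup a x = 0 \<or> lookup b x = 0)"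
proof
  assume "mon_gcd a b = 0"
  then have "min (lookup a x) (lookup b x) = 0" for x
    by (simp flip: lookup_mon_gcd)
  then show "\<forall>x. lookup a x = 0 \<or> lookup b x = 0" by (metis min_def)
next
  assume "\<forall>x. lookup a x = 0 \<or> lookup b x = 0"
  then have "lookup (mon_gcd a b) x = lookup 0 x" for x
    by (metis lookup_mon_gcd lookup_zero min_0L min_0R)
  then show "mon_gcd a b = 0" by (rule poly_mapping_eqI)
qed

lemma mon_lcm_union_eq_add_iff:
  assumes "finite J" "finite L"
  shows "mon_lcm \<mu> (J \<union> L) = mon_lcm \<mu> J + mon_lcm \<mu> L \<longleftrightarrow> mon_gcd (mon_lcm \<mu> J) (mon_lcm \<mu> L) = 0"
proof -
  have "mon_lcm \<mu> (J \<union> L) = mon_lcm \<mu> J + mon_lcm \<mu> L \<longleftrightarrow>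
    (\<forall>x. lookup (mon_lcm \<mu> (J \<union> L)) x = lookup (mon_lcm \<mu> J + mon_lcm \<mu> L) x)"
    by (metis poly_mapping_eqI)
  also have "\<dots> \<longleftrightarrow> (\<forall>x. lookup (mon_lcm \<mu> J) x = 0 \<or> lookup (mon_lcm \<mu> L) x = 0)"
  proof -
    have "max p q = p + q \<longleftrightarrow> p = 0 \<or> q = 0" for p q :: nat by auto
    then show ?thesis by (simp only: lookup_mon_lcm_union[OF assms] lookup_add)
  qed
  finally show ?thesis unfolding mon_gcd_eq_0_iff .
qed

lemma mon_lcm_union_le_add:
  assumes "finite J" "finite L"
  shows "mon_le (mon_lcm \<mu> (J \<union> L)) (mon_lcm \<mu> J + mon_lcm \<mu> L)"
  unfolding mon_le_def lookup_add lookup_mon_lcm_union[OF assms] by simp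

text \<open>
  Division by the monomial \<open>a\<close>; the terms that are not divisible by \<open>a\<close> are dropped.
\<close>

definition mon_div :: "'x mon \<Rightarrow> ('x, 'k::field) mpoly \<Rightarrow> ('x, 'k) mpoly" where
  "mon_div a P = Poly_Mapping.map_key ((+) a) P"

lemma lookup_mon_div: "lookup (mon_div a P) b = lookup P (a + b)"
  unfolding mon_div_def by (subst map_key.rep_eq) (simp_all add: inj_on_def)

lemma mon_div_add: "mon_div a (P + Q) = mon_div a P + mon_div a Q"
  by (intro poly_mapping_eqI) (simp add: lookup_mon_div lookup_add)

lemma mon_div_0: "mon_div a 0 = 0"
  by (intro poly_mapping_eqI) (simp add: lookup_mon_div)

lemma mon_div_uminus: "mon_div a (- P) = - mon_div a P"
  by (intro poly_mapping_eqI) (simp add: lookup_mon_div)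

lemma mon_div_sum: "mon_div a (sum f X) = (\<Sum>x\<in>X. mon_div a (f x))"
  by (induction X rule: infinite_finite_induct) (simp_all add: mon_div_0 mon_div_add)

lemma mon_div_mult_cancel: "mon_div a (mon_poly a * P) = P"
  by (intro poly_mapping_eqI) (simp add: lookup_mon_div mon_poly_def single_mult_lookup)

lemma mon_poly_mult_div:
  assumes "\<And>c. lookup P c \<noteq> 0 \<Longrightarrow> mon_le a c"
  shows "mon_poly a * mon_div a P = P"
proof (intro poly_mapping_eqI)
  fix c
  show "lookup (mon_poly a * mon_div a P) c = lookup P c"
  proof (cases "mon_le a c")
    case True
    then obtain b where "c = a + b" by (auto simp: mon_le_iff)
    then show ?thesis by (simp add: mon_poly_def single_mult_lookup lookup_mon_div)
  next
    case False
    have "lookup (mon_poly a * mon_div a P) c = 0"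
    proof (rule ccontr)
      assume "lookup (mon_poly a * mon_div a P) c \<noteq> 0"
      then obtain b e where "c = b + e" "lookup (mon_poly a :: ('a, 'b) mpoly) b \<noteq> 0"
          "lookup (mon_div a P) e \<noteq> 0"
        by (rule lookup_mult_nonzero)
      then have "c = a + e" by (auto simp: mon_poly_def lookup_single when_def split: if_splits)
      then show False using False by (auto simp: mon_le_add_self)
    qed
    then show ?thesis using assms[of c] False by auto
  qed
qed

lemma mon_poly_mult: "mon_poly a * mon_poly b = mon_poly (a + b)"
  by (simp add: mon_poly_def mult_single)

lemma mon_div_mult:
  assumes "\<And>c. lookup P c \<noteq> 0 \<Longrightarrow> mon_le a c" "\<And>c. lookup Q c \<noteq> 0 \<Longrightarrow> mon_le b c"
  shows "mon_div (a + b) (P * Q) = mon_div a P * mon_div b Q"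
proof -
  have "mon_poly a * mon_div a P = P" "mon_poly b * mon_div b Q = Q"
    by (intro mon_poly_mult_div assms; assumption)+
  then have "P * Q = (mon_poly a * mon_div a P) * (mon_poly b * mon_div b Q)"
    by simp
  also have "\<dots> = mon_poly (a + b) * (mon_div a P * mon_div b Q)"
    by (simp add: ac_simps flip: mon_poly_mult)
  finally show ?thesis by (simp only: mon_div_mult_cancel)
qed

lemma poly_ring_simps [simp]:
  "carrier poly_ring = UNIV" "mult poly_ring = (*)" "one poly_ring = 1" "zero poly_ring = 0"
  "add poly_ring = (+)"
  by (simp_all add: poly_ring_def)

lemma cring_poly_ring: "cring (poly_ring :: ('x::{finite,linorder}, 'k::field) mpoly ring)"
proof (rule cringI)
  show "abelian_group (poly_ring :: ('x, 'k) mpoly ring)"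
  proof (rule abelian_groupI)
    fix x :: "('x, 'k) mpoly"
    show "\<exists>y\<in>carrier poly_ring. y \<oplus>\<^bsub>poly_ring\<^esub> x = \<zero>\<^bsub>poly_ring\<^esub>"
      by (auto intro!: exI[of _ "- x"])
  qed (auto simp: algebra_simps)
  show "comm_monoid (poly_ring :: ('x, 'k) mpoly ring)"
    by (rule comm_monoidI) (auto simp: algebra_simps)
qed (auto simp: algebra_simps)

lemma ideal_mon_ideal: "ideal (mon_ideal r \<mu>) poly_ring"
  unfolding mon_ideal_def by (intro ring.genideal_ideal cring.axioms(1) cring_poly_ring) simp

lemma in_ideal_sum:
  assumes "ideal J poly_ring" "\<And>x. x \<in> X \<Longrightarrow> f x \<in> J"
  shows "sum f X \<in> J"
proof -
  interpret ideal J poly_ring by fact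
  show ?thesis
    using assms(2)
  proof (induction X rule: infinite_finite_induct)
    case (insert x F)
    then have "f x \<oplus>\<^bsub>poly_ring\<^esub> sum f F \<in> J"
      by (intro additive_subgroup.a_closed[OF additive_subgroup_axioms]) auto
    then show ?case using insert.hyps by simp
  qed (use additive_subgroup.zero_closed[OF additive_subgroup_axioms] in simp_all)
qed

text \<open>
  The polynomials satisfying the condition on the right form an ideal containing the generators.
  Conversely, each of their terms is a multiple of a generator.
\<close>

lemma mon_ideal_iff:
  fixes P :: "('x::{finite,linorder}, 'k::field) mpoly"
  shows "P \<in> mon_ideal r \<mu> \<longleftrightarrow> (\<forall>b. lookup P b \<noteq> 0 \<longrightarrow> (\<exists>j\<in>{1..r}. mon_le (\<mu> j) b))"
proof
  define J where "J = {P :: ('x, 'k) mpoly. \<forall>b. lookup P b \<noteq> 0 \<longrightarrow> (\<exists>j\<in>{1..r}. mon_le (\<mu> j) b)}"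
  interpret S: cring "poly_ring :: ('x, 'k) mpoly ring" by (rule cring_poly_ring)
  have mult_J: "P * Q \<in> J" if "P \<in> J" for P Q
  proof -
    have "\<exists>j\<in>{1..r}. mon_le (\<mu> j) c" if "lookup (P * Q) c \<noteq> 0" for c
    proof -
      from that obtain a b where "c = a + b" "lookup P a \<noteq> 0" "lookup Q b \<noteq> 0"
        by (rule lookup_mult_nonzero)
      then show ?thesis
        using \<open>P \<in> J\<close> mon_le_trans mon_le_add_self unfolding J_def by blast
    qed
    then show ?thesis by (simp add: J_def)
  qed
  have add_J: "P + Q \<in> J" if "P \<in> J" "Q \<in> J" for P Q
  proof -
    have "lookup P b \<noteq> 0 \<or> lookup Q b \<noteq> 0" if "lookup (P + Q) b \<noteq> 0" for b
      using that by (auto simp: lookup_add)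
    then show ?thesis using that unfolding J_def by blast
  qed
  have "ideal J poly_ring"
  proof (rule idealI)
    show "ring (poly_ring :: ('x, 'k) mpoly ring)" by (rule S.ring_axioms)
    show "subgroup J (add_monoid poly_ring)"
    proof (rule S.add.subgroupI)
      show "J \<noteq> {}" by (auto simp: J_def intro!: exI[of _ 0])
      fix P assume P: "P \<in> J"
      have "\<ominus>\<^bsub>poly_ring\<^esub> P = - P"
        by (rule S.minus_equality) auto
      then show "\<ominus>\<^bsub>poly_ring\<^esub> P \<in> J"
        using P by (simp add: J_def)
    qed (auto intro: add_J)
    fix P Q :: "('x, 'k) mpoly" assume "P \<in> J" "Q \<in> carrier poly_ring"
    then show "Q \<otimes>\<^bsub>poly_ring\<^esub> P \<in> J" "P \<otimes>\<^bsub>poly_ring\<^esub> Q \<in> J"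
      using mult_J[of P Q] by (simp_all add: mult.commute)
  qed
  moreover have "(\<lambda>j. mon_poly (\<mu> j)) ` {1..r} \<subseteq> J"
    by (auto simp: J_def mon_poly_def lookup_single when_def mon_le_refl intro!: bexI split: if_splits)
  ultimately have "mon_ideal r \<mu> \<subseteq> J"
    unfolding mon_ideal_def by (rule S.genideal_minimal)
  moreover assume "P \<in> mon_ideal r \<mu>"
  ultimately show "\<forall>b. lookup P b \<noteq> 0 \<longrightarrow> (\<exists>j\<in>{1..r}. mon_le (\<mu> j) b)"
    by (auto simp: J_def)
next
  interpret S: cring "poly_ring :: ('x, 'k) mpoly ring" by (rule cring_poly_ring)
  interpret ideal "mon_ideal r \<mu> :: ('x, 'k) mpoly set" poly_ring by (rule ideal_mon_ideal)
  assume P: "\<forall>b. lookup P b \<noteq> 0 \<longrightarrow> (\<exists>j\<in>{1..r}. mon_le (\<mu> j) b)"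
  have gen: "(mon_poly (\<mu> j) :: ('x, 'k) mpoly) \<in> mon_ideal r \<mu>" if "j \<in> {1..r}" for j
  proof -
    have "(\<lambda>j. mon_poly (\<mu> j) :: ('x, 'k) mpoly) ` {1..r} \<subseteq> mon_ideal r \<mu>"
      unfolding mon_ideal_def by (rule S.genideal_self) simp
    then show ?thesis using that by blast
  qed
  have "(\<Sum>b\<in>keys P. Poly_Mapping.single b (lookup P b)) \<in> mon_ideal r \<mu>"
  proof (rule in_ideal_sum[OF ideal_mon_ideal])
    fix b assume "b \<in> keys P"
    then obtain j where j: "j \<in> {1..r}" "mon_le (\<mu> j) b"
      using P by (auto simp: in_keys_iff)
    then obtain c where "b = \<mu> j + c" by (auto simp: mon_le_iff)
    then have "Poly_Mapping.single b (lookup P b) = mon_poly (\<mu> j) * Poly_Mapping.single c (lookup P b)"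
      by (simp add: mon_poly_def mult_single)
    then show "Poly_Mapping.single b (lookup P b) \<in> mon_ideal r \<mu>"
      using I_r_closed[OF gen[OF j(1)], of "Poly_Mapping.single c (lookup P b)"] by simp
  qed
  moreover have "(\<Sum>b\<in>keys P. Poly_Mapping.single b (lookup P b)) = P"
    by (intro poly_mapping_eqI)
      (auto simp: lookup_sum lookup_single when_def in_keys_iff)
  ultimately show "P \<in> mon_ideal r \<mu>" by simp
qed


section \<open>The tensor product of the Taylor and the Koszul resolution\<close>

text \<open>
  \<open>Gen j\<close> is the vertex of the generator \<open>m\<^sub>j\<close> and \<open>Var x\<close> the vertex of the variable \<open>x\<close>.  The order puts
  the generators first, as in a tensor product \<open>T \<otimes> K\<^sub>S\<close>.
\<close>

datatype 'x vertex = Gen nat | Var 'x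

instantiation vertex :: (linorder) linorder
begin

fun less_eq_vertex :: "'a vertex \<Rightarrow> 'a vertex \<Rightarrow> bool" where
  "less_eq_vertex (Gen i) (Gen j) \<longleftrightarrow> i \<le> j"
| "less_eq_vertex (Gen i) (Var y) \<longleftrightarrow> True"
| "less_eq_vertex (Var x) (Gen j) \<longleftrightarrow> False"
| "less_eq_vertex (Var x) (Var y) \<longleftrightarrow> x \<le> y"

definition less_vertex :: "'a vertex \<Rightarrow> 'a vertex \<Rightarrow> bool" where
  "less_vertex u v \<longleftrightarrow> u \<le> v \<and> \<not> v \<le> u"

instance
proof
  fix u v w :: "'a vertex"
  show "u < v \<longleftrightarrow> u \<le> v \<and> \<not> v \<le> u" by (simp add: less_vertex_def)
  show "u \<le> u" by (cases u) auto
  show "u \<le> v \<Longrightarrow> v \<le> w \<Longrightarrow> u \<le> w" by (cases u; cases v; cases w) auto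
  show "u \<le> v \<Longrightarrow> v \<le> u \<Longrightarrow> u = v" by (cases u; cases v) auto
  show "u \<le> v \<or> v \<le> u" by (cases u; cases v) auto
qed

end

lemma vertex_less_simps [simp]: "Gen i < Gen j \<longleftrightarrow> i < j" "Var x < Var y \<longleftrightarrow> x < y"
  by (auto simp: less_vertex_def)

definition vertices :: "nat \<Rightarrow> 'x vertex set" where
  "vertices r = Gen ` {1..r} \<union> range Var"

definition gens :: "'x vertex set \<Rightarrow> nat set" where "gens C = Gen -` C"

definition vars :: "'x vertex set \<Rightarrow> 'x set" where "vars C = Var -` C"

lemma finite_vertices: "finite (vertices r :: 'x::finite vertex set)"
  by (simp add: vertices_def)

lemma finite_gens: "finite C \<Longrightarrow> finite (gens C)"
  unfolding gens_def by (rule finite_vimageI) (auto simp: inj_on_def)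

lemma gens_vars_simps [simp]:
  "gens (A \<union> B) = gens A \<union> gens B" "vars (A \<union> B) = vars A \<union> vars B"
  "gens (insert (Gen j) C) = insert j (gens C)" "vars (insert (Gen j) C) = vars C"
  "gens (insert (Var x) C) = gens C" "vars (insert (Var x) C) = insert x (vars C)"
  "gens (C \<inter> range Gen) = gens C" "vars (C \<inter> range Var) = vars C"
  "gens (Gen ` J) = J" "vars (Gen ` J) = {}" "gens (Var ` X) = {}" "vars (Var ` X) = X"
  "gens (C - {Gen j}) = gens C - {j}" "gens (C - {Var x}) = gens C"
  "vars (C - {Gen j}) = vars C" "vars (C - {Var x}) = vars C - {x}"
  by (auto simp: gens_def vars_def)

lemma gens_mono: "A \<subseteq> B \<Longrightarrow> gens A \<subseteq> gens B" and vars_mono: "A \<subseteq> B \<Longrightarrow> vars A \<subseteq> vars B"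
  by (auto simp: gens_def vars_def)

text \<open>
  The product of the variables in \<open>A\<close>, which is the multidegree of \<open>e\<^sub>A\<close>.
\<close>

lift_definition sqfree :: "'x::finite set \<Rightarrow> 'x mon" is "\<lambda>A x. if x \<in> A then 1 else 0"
  by simp

lemma lookup_sqfree: "lookup (sqfree A) x = (if x \<in> A then 1 else 0)"
  by transfer simp

definition label :: "(nat \<Rightarrow> 'x::finite mon) \<Rightarrow> 'x vertex set \<Rightarrow> 'x mon" where
  "label \<mu> C = mon_lcm \<mu> (gens C) + sqfree (vars C)"

lemma label_mono:
  assumes "finite B" "A \<subseteq> B"
  shows "mon_le (label \<mu> A) (label \<mu> B)"
  unfolding label_def
  by (intro mon_le_add mon_lcm_mono finite_gens gens_mono assms)
     (use vars_mono[OF assms(2)] in \<open>auto simp: mon_le_def lookup_sqfree\<close>)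

lemma label_union_le:
  assumes "finite A" "finite B"
  shows "mon_le (label \<mu> (A \<union> B)) (label \<mu> A + label \<mu> B)"
proof -
  have "mon_le (sqfree (vars A \<union> vars B)) (sqfree (vars A) + sqfree (vars B))"
    by (simp add: mon_le_def lookup_sqfree lookup_add)
  from mon_le_add[OF mon_lcm_union_le_add[OF finite_gens finite_gens, OF assms] this]
  show ?thesis by (simp add: label_def ac_simps)
qed

lemma lookup_esign_mult:
  fixes P :: "('x, 'k::field) mpoly"
  shows "lookup (esign A B * P) c = esign A B * lookup P c"
  by (simp add: esign_def minus_one_power_iff)

text \<open>
  The part of degree \<open>n\<close> of \<open>T \<otimes>\<^sub>S K\<^sub>S\<close>, where \<open>u\<^sub>J \<otimes> e\<^sub>A\<close> is the exterior monomial on \<open>J\<close> and \<open>A\<close> times its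
  own multidegree \<open>label\<close>.  In this normalization the coefficients \<open>m\<^sub>J / m\<^sub>L\<close> of the Taylor resolution,
  the variables in the Koszul differential and the monomial factors in the Taylor product disappear:
  differential and product are those of the exterior algebra.
\<close>

definition taylor_koszul :: "nat \<Rightarrow> (nat \<Rightarrow> 'x::{finite,linorder} mon) \<Rightarrow> nat \<Rightarrow>
    ('x vertex set \<Rightarrow> ('x, 'k::field) mpoly) set" where
  "taylor_koszul r \<mu> n =
     {f. \<forall>C a. lookup (f C) a \<noteq> 0 \<longrightarrow> C \<subseteq> vertices r \<and> card C = n \<and> mon_le (label \<mu> C) a}"

lemma taylor_koszulD:
  assumes "f \<in> taylor_koszul r \<mu> n" "lookup (f C) a \<noteq> 0"
  shows "C \<subseteq> vertices r" "card C = n" "mon_le (label \<mu> C) a" "finite C"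
proof -
  have "C \<subseteq> vertices r \<and> card C = n \<and> mon_le (label \<mu> C) a"
    using assms unfolding taylor_koszul_def by blast
  then show "C \<subseteq> vertices r" "card C = n" "mon_le (label \<mu> C) a" "finite C"
    using finite_subset[OF _ finite_vertices, of C r] by simp_all
qed

lemma taylor_koszul_nonzero:
  assumes "f \<in> taylor_koszul r \<mu> n" "f C \<noteq> 0"
  shows "C \<subseteq> vertices r" "card C = n" "finite C"
proof -
  obtain a where a: "lookup (f C) a \<noteq> 0"
    using assms(2) by (metis keys_eq_empty all_not_in_conv in_keys_iff)
  show "C \<subseteq> vertices r" "card C = n" "finite C" using taylor_koszulD[OF assms(1) a] by simp_all
qed

lemma lookup_sum_nonzero:
  assumes "lookup (sum f X) a \<noteq> (0 :: 'k::field)"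
  obtains x where "x \<in> X" "lookup (f x) a \<noteq> 0"
  using assms unfolding lookup_sum by (rule sum.not_neutral_contains_not_neutral)

lemma lookup_ext_mult_nonzero:
  fixes f g :: "'v::linorder set \<Rightarrow> ('x, 'k::field) mpoly"
  assumes "lookup (ext_mult f g C) c \<noteq> 0"
  obtains A a b where "A \<subseteq> C" "finite C" "c = a + b" "lookup (f A) a \<noteq> 0" "lookup (g (C - A)) b \<noteq> 0"
proof -
  have "finite C" using assms by (cases "finite C") (auto simp: ext_mult_def)
  obtain A where A: "A \<in> Pow C" "lookup (esign A (C - A) * (f A * g (C - A))) c \<noteq> 0"
    using assms unfolding ext_mult_def by (rule lookup_sum_nonzero)
  then have "lookup (f A * g (C - A)) c \<noteq> 0" by (auto simp: lookup_esign_mult)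
  then obtain a b where "c = a + b" "lookup (f A) a \<noteq> 0" "lookup (g (C - A)) b \<noteq> 0"
    by (rule lookup_mult_nonzero)
  with A(1) \<open>finite C\<close> show ?thesis by (intro that[of A a b]) auto
qed

lemma lookup_ext_diff:
  fixes f :: "'v::linorder set \<Rightarrow> ('x, 'k::field) mpoly"
  shows "lookup (ext_diff V f C) a = ext_diff V (\<lambda>C. lookup (f C) a) C"
  by (simp add: ext_diff_def lookup_sum lookup_esign_mult)

interpretation TK: graded_dga "taylor_koszul r \<mu>" ext_mult "ext_diff (vertices r)" for r \<mu>
proof
  fix f g :: "'a vertex set \<Rightarrow> ('a, 'b) mpoly" and m n
  show "0 \<in> taylor_koszul r \<mu> n" by (simp add: taylor_koszul_def)
  show "f + g \<in> taylor_koszul r \<mu> n" if fg: "f \<in> taylor_koszul r \<mu> n" "g \<in> taylor_koszul r \<mu> n"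
  proof -
    have "lookup (f C) a \<noteq> 0 \<or> lookup (g C) a \<noteq> 0" if "lookup ((f + g) C) a \<noteq> 0" for C a
      using that by (auto simp: lookup_add)
    then show ?thesis using fg unfolding taylor_koszul_def by blast
  qed
  show "- f \<in> taylor_koszul r \<mu> n" if "f \<in> taylor_koszul r \<mu> n"
    using that by (simp add: taylor_koszul_def)
  show "ext_mult f g \<in> taylor_koszul r \<mu> (m + n)"
    if f: "f \<in> taylor_koszul r \<mu> m" and g: "g \<in> taylor_koszul r \<mu> n"
    unfolding taylor_koszul_def
  proof (intro CollectI allI impI)
    fix C c assume "lookup (ext_mult f g C) c \<noteq> 0"
    then obtain A a b where A: "A \<subseteq> C" "finite C" "c = a + b"
      and fa: "lookup (f A) a \<noteq> 0" and gb: "lookup (g (C - A)) b \<noteq> 0"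
      by (rule lookup_ext_mult_nonzero)
    note fa = taylor_koszulD[OF f fa] and gb = taylor_koszulD[OF g gb]
    have C: "C = A \<union> (C - A)" using A(1) by auto
    have "card C = card A + card (C - A)"
      using A(1,2) by (metis card_Diff_subset card_mono finite_subset le_add_diff_inverse)
    moreover have "mon_le (label \<mu> (A \<union> (C - A))) (a + b)"
      using label_union_le[OF fa(4) gb(4)] mon_le_add[OF fa(3) gb(3)] by (rule mon_le_trans)
    ultimately show "C \<subseteq> vertices r \<and> card C = m + n \<and> mon_le (label \<mu> C) c"
      using A fa gb C by auto
  qed
  show "ext_diff (vertices r) f \<in> taylor_koszul r \<mu> n" if f: "f \<in> taylor_koszul r \<mu> (Suc n)"
    unfolding taylor_koszul_def
  proof (intro CollectI allI impI)
    fix C a assume "lookup (ext_diff (vertices r) f C) a \<noteq> 0"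
    then obtain x where x: "x \<in> vertices r - C" "lookup (esign {x} C * f (insert x C)) a \<noteq> 0"
      unfolding ext_diff_def by (rule lookup_sum_nonzero)
    then have "lookup (f (insert x C)) a \<noteq> 0" by (auto simp: lookup_esign_mult)
    note fx = taylor_koszulD[OF f this]
    then show "C \<subseteq> vertices r \<and> card C = n \<and> mon_le (label \<mu> C) a"
      using x(1) mon_le_trans[OF label_mono[OF fx(4)] fx(3)] by auto
  qed
  show "ext_diff (vertices r) (ext_diff (vertices r) f) = 0" if "f \<in> taylor_koszul r \<mu> n"
    using taylor_koszul_nonzero[OF that] by (intro ext_diff_diff_0 finite_vertices)
  show "ext_diff (vertices r) (ext_mult f g)
      = ext_mult (ext_diff (vertices r) f) g + sign_by m (ext_mult f (ext_diff (vertices r) g))"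
    if f: "f \<in> taylor_koszul r \<mu> m" "g \<in> taylor_koszul r \<mu> n"
  proof
    fix C
    show "ext_diff (vertices r) (ext_mult f g) C
      = (ext_mult (ext_diff (vertices r) f) g + sign_by m (ext_mult f (ext_diff (vertices r) g))) C"
    proof (cases "finite C")
      case True
      have "ext_diff (vertices r) (ext_mult f g) C
          = ext_mult (ext_diff (vertices r) f) g C + (-1) ^ m * ext_mult f (ext_diff (vertices r) g) C"
        by (rule ext_diff_mult[OF finite_vertices True]) (rule taylor_koszul_nonzero(2)[OF f(1)])
      then show ?thesis by (simp add: sign_by_def minus_one_power_iff)
    next
      case False
      then show ?thesis by (simp add: ext_diff_def ext_mult_def sign_by_def)
    qed
  qed
qed (rule ext_mult_add_left ext_mult_add_right ext_mult_assoc ext_diff_add)+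

text \<open>
  The differential does not change exponents, so a chain with polynomial coefficients may be treated
  one exponent at a time.  Only finitely many exponents occur, hence the bounding chains for the
  individual exponents can be put together again.
\<close>

lemma exponentwise_cone_acyclic:
  fixes z :: "'x::{finite,linorder} vertex set \<Rightarrow> ('x, 'k::field) mpoly"
  assumes sub: "\<And>C a. Q C a \<Longrightarrow> C \<subseteq> vertices r"
    and down: "\<And>C a x. Q C a \<Longrightarrow> Q (C - {x}) a"
    and cone: "\<And>C a. Q C a \<Longrightarrow> v a (C \<inter> W) \<in> vertices r - W \<and> Q (insert (v a (C \<inter> W)) C) a"
    and supp: "\<And>C a. lookup (z C) a \<noteq> 0 \<Longrightarrow> Q C a \<and> card C = n"
    and cyc: "ext_diff (vertices r) z = 0"
  shows "\<exists>y. (\<forall>C a. lookup (y C) a \<noteq> 0 \<longrightarrow> Q C a \<and> card C = Suc n) \<and> ext_diff (vertices r) y = z"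
proof -
  have "\<exists>y. (\<forall>C. y C \<noteq> 0 \<longrightarrow> C \<in> {C. Q C a} \<and> card C = Suc n) \<and>
      ext_diff (vertices r) y = (\<lambda>C. lookup (z C) a)" for a
  proof (rule cone_acyclic[where v = "v a" and W = W and Q = "{C. Q C a}" and V = "vertices r"])
    show "ext_diff (vertices r) (\<lambda>C. lookup (z C) a) = 0"
    proof
      fix C
      show "ext_diff (vertices r) (\<lambda>C. lookup (z C) a) C = 0 C"
        unfolding lookup_ext_diff[symmetric] cyc by simp
    qed
    show "finite (vertices r :: 'x vertex set)" by (rule finite_vertices)
    fix C
    show "C \<subseteq> vertices r" if "C \<in> {C. Q C a}" using sub that by simp
    show "C - {x} \<in> {C. Q C a}" if "C \<in> {C. Q C a}" for x using down that by simp
    show "v a (C \<inter> W) \<in> vertices r - W \<and> insert (v a (C \<inter> W)) C \<in> {C. Q C a}"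
      if "C \<in> {C. Q C a}" using cone[of C a] that by simp
    show "C \<in> {C. Q C a} \<and> card C = n" if "lookup (z C) a \<noteq> 0" using supp[OF that] by simp
  qed
  then have "\<forall>a. \<exists>y. (\<forall>C. y C \<noteq> 0 \<longrightarrow> Q C a \<and> card C = Suc n) \<and>
      ext_diff (vertices r) y = (\<lambda>C. lookup (z C) a)" by simp
  from choice[OF this] obtain Y where Y0: "\<forall>a. (\<forall>C. Y a C \<noteq> 0 \<longrightarrow> Q C a \<and> card C = Suc n) \<and>
      ext_diff (vertices r) (Y a) = (\<lambda>C. lookup (z C) a)" ..
  have Y: "Y a C \<noteq> 0 \<Longrightarrow> Q C a \<and> card C = Suc n"
    "ext_diff (vertices r) (Y a) = (\<lambda>C. lookup (z C) a)" for a C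
    using Y0 by simp_all
  define F where "F = (\<Union>C\<in>Pow (vertices r). keys (z C))"
  have finF: "finite F" unfolding F_def by (simp add: finite_vertices)
  define y where "y = (\<lambda>C. \<Sum>a\<in>F. Poly_Mapping.single a (Y a C))"
  have ly: "lookup (y C) a = (if a \<in> F then Y a C else 0)" for C a
    using finF by (simp add: y_def lookup_sum lookup_single when_def)
  have "ext_diff (vertices r) y = z"
  proof (rule ext, rule poly_mapping_eqI)
    fix C a
    have "lookup (ext_diff (vertices r) y C) a = (if a \<in> F then ext_diff (vertices r) (Y a) C else 0)"
      unfolding lookup_ext_diff ly by (simp add: ext_diff_def)
    also have "\<dots> = lookup (z C) a"
      using sub[of C a] supp[of C a] by (auto simp: Y(2) F_def in_keys_iff)
    finally show "lookup (ext_diff (vertices r) y C) a = lookup (z C) a" .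
  qed
  moreover have "Q C a \<and> card C = Suc n" if "lookup (y C) a \<noteq> 0" for C a
    using that Y(1)[of a C] by (simp add: ly split: if_splits)
  ultimately show ?thesis by blast
qed


section \<open>The kernels of the two projections are acyclic\<close>

text \<open>
  The kernel of the projection to the Koszul dga of \<open>S/I\<close>.  In multidegree \<open>a\<close> it is spanned by the
  simplices \<open>(J, A)\<close> for which some \<open>m\<^sub>j\<close> divides \<open>a / x\<^sup>A\<close>: if \<open>J\<close> is nonempty, any \<open>j\<close> in \<open>J\<close> will do, and
  otherwise this is the condition that the coefficient lies in \<open>I\<close>.  The vertex of such a \<open>j\<close>, chosen
  in dependence of \<open>A\<close> only, is a cone vertex.
\<close>

lemma kernel_quotient_acyclic:
  fixes z :: "'x::{finite,linorder} vertex set \<Rightarrow> ('x, 'k::field) mpoly"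
  assumes z: "z \<in> taylor_koszul r \<mu> n" and cyc: "ext_diff (vertices r) z = 0"
    and I: "\<And>A. mon_div (sqfree A) (z (Var ` A)) \<in> mon_ideal r \<mu>"
  shows "\<exists>y\<in>taylor_koszul r \<mu> (Suc n). (\<forall>A. mon_div (sqfree A) (y (Var ` A)) \<in> mon_ideal r \<mu>) \<and>
    ext_diff (vertices r) y = z"
proof -
  define Q where "Q = (\<lambda>C a. C \<subseteq> vertices r \<and> mon_le (label \<mu> C) a \<and>
    (\<exists>j\<in>{1..r}. mon_le (\<mu> j + sqfree (vars C)) a))"
  define v where "v = (\<lambda>a (B :: 'x vertex set). Gen (SOME j. j \<in> {1..r} \<and> mon_le (\<mu> j + sqfree (vars B)) a) :: 'x vertex)"
  have finQ: "finite C" if "Q C a" for C a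
    using that finite_subset[OF _ finite_vertices] unfolding Q_def by blast
  have ex_v: "\<exists>j\<in>{1..r}. v a (C \<inter> range Var) = Gen j \<and> mon_le (\<mu> j + sqfree (vars C)) a"
    if "Q C a" for C a
  proof -
    have "\<exists>j. j \<in> {1..r} \<and> mon_le (\<mu> j + sqfree (vars C)) a" using that by (auto simp: Q_def)
    from someI_ex[OF this] show ?thesis by (auto simp: v_def)
  qed
  have le_div: "mon_le (a + b) c" if "mon_le a c'" "c = c' + b" for a b c c' :: "'x mon"
    using that by (auto intro: mon_le_add mon_le_refl)
  have "\<exists>y. (\<forall>C a. lookup (y C) a \<noteq> 0 \<longrightarrow> Q C a \<and> card C = Suc n) \<and> ext_diff (vertices r) y = z"
  proof (rule exponentwise_cone_acyclic[where v = v and W = "range Var"])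
    fix C a assume Q: "Q C a"
    then show "C \<subseteq> vertices r" by (simp add: Q_def)
    obtain j where j: "j \<in> {1..r}" "v a (C \<inter> range Var) = Gen j" "mon_le (\<mu> j + sqfree (vars C)) a"
      using ex_v[OF Q] by blast
    have "mon_le (label \<mu> (insert (Gen j) C)) a"
    proof -
      have "mon_lcm \<mu> (insert j (gens C)) = mon_lcm \<mu> ({j} \<union> gens C)" by simp
      then have "lookup (label \<mu> (insert (Gen j) C)) x =
          max (lookup (\<mu> j) x) (lookup (mon_lcm \<mu> (gens C)) x) + lookup (sqfree (vars C)) x" for x
        using lookup_mon_lcm_union[OF _ finite_gens[OF finQ[OF Q]], of "{j}" \<mu> x]
        by (simp add: label_def lookup_add) (simp add: lookup_mon_lcm)
      then show ?thesis
        using Q j(3) by (auto simp: mon_le_def lookup_add Q_def label_def max_def)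
    qed
    then show "v a (C \<inter> range Var) \<in> vertices r - range Var \<and> Q (insert (v a (C \<inter> range Var)) C) a"
      using Q j by (auto simp: Q_def vertices_def)
    fix x
    have "mon_le (sqfree (vars (C - {x}))) (sqfree (vars C))"
      using vars_mono[of "C - {x}" C] by (auto simp: mon_le_def lookup_sqfree)
    then have "mon_le (\<mu> j + sqfree (vars (C - {x}))) a"
      using mon_le_trans[OF mon_le_add[OF mon_le_refl] j(3)] by blast
    then show "Q (C - {x}) a"
      using Q j(1) mon_le_trans[OF label_mono[OF finQ[OF Q]], of "C - {x}" \<mu> a]
      by (auto simp: Q_def)
  next
    fix C a assume nz: "lookup (z C) a \<noteq> 0"
    note zC = taylor_koszulD[OF z nz]
    have "\<exists>j\<in>{1..r}. mon_le (\<mu> j + sqfree (vars C)) a"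
    proof (cases "gens C = {}")
      case True
      then have "C = Var ` vars C"
      proof -
        have "c \<in> Var ` vars C" if "c \<in> C" for c
          using that True by (cases c) (auto simp: gens_def vars_def)
        then show ?thesis by (auto simp: vars_def)
      qed
      then have "lookup (z (Var ` vars C)) a \<noteq> 0" using nz by simp
      moreover have "mon_le (sqfree (vars C)) a"
        using zC(3) unfolding label_def mon_le_def lookup_add by (meson add_leE)
      then obtain b where b: "a = sqfree (vars C) + b" by (auto simp: mon_le_iff)
      ultimately have "lookup (mon_div (sqfree (vars C)) (z (Var ` vars C))) b \<noteq> 0"
        by (simp add: lookup_mon_div)
      then obtain j where "j \<in> {1..r}" "mon_le (\<mu> j) b"
        using I[of "vars C"] unfolding mon_ideal_iff by blast
      then show ?thesis using le_div[of "\<mu> j" b a "sqfree (vars C)"] b by (auto simp: add.commute)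
    next
      case False
      then obtain j where j: "j \<in> gens C" by blast
      then have "j \<in> {1..r}" using zC(1) by (auto simp: gens_def vertices_def)
      moreover have "mon_le (\<mu> j) (mon_lcm \<mu> (gens C))"
        using mon_lcm_le_iff[OF finite_gens[OF zC(4)], of \<mu> "mon_lcm \<mu> (gens C)"] j
        by (auto simp: mon_le_refl)
      then have "mon_le (\<mu> j + sqfree (vars C)) (label \<mu> C)"
        unfolding label_def by (intro mon_le_add mon_le_refl)
      ultimately show ?thesis using mon_le_trans zC(3) by blast
    qed
    then show "Q C a \<and> card C = n" using zC by (simp add: Q_def)
  qed (rule cyc)
  then obtain y where y: "\<And>C a. lookup (y C) a \<noteq> 0 \<Longrightarrow> Q C a \<and> card C = Suc n"
    "ext_diff (vertices r) y = z" by blast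
  have "y \<in> taylor_koszul r \<mu> (Suc n)" using y(1) by (auto simp: taylor_koszul_def Q_def)
  moreover have "mon_div (sqfree A) (y (Var ` A)) \<in> mon_ideal r \<mu>" for A
    unfolding mon_ideal_iff
  proof (intro allI impI)
    fix b assume "lookup (mon_div (sqfree A) (y (Var ` A))) b \<noteq> 0"
    then obtain j where "j \<in> {1..r}" "mon_le (\<mu> j + sqfree A) (sqfree A + b)"
      using y(1)[of "Var ` A" "sqfree A + b"] by (auto simp: lookup_mon_div Q_def)
    then show "\<exists>j\<in>{1..r}. mon_le (\<mu> j) b"
      by (auto simp: mon_le_def lookup_add add.commute)
  qed
  ultimately show ?thesis using y(2) by blast
qed

text \<open>
  The kernel of the projection to \<open>T \<otimes> k\<close>.  In multidegree \<open>a\<close> it is spanned by the simplices \<open>(J, A)\<close>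
  with \<open>m\<^sub>J \<noteq> a\<close>; if \<open>A\<close> is nonempty, this is automatic.  A variable dividing \<open>a / m\<^sub>J\<close>, chosen in dependence
  of \<open>J\<close> only, is a cone vertex.
\<close>

lemma kernel_taylor_acyclic:
  fixes z :: "'x::{finite,linorder} vertex set \<Rightarrow> ('x, 'k::field) mpoly"
  assumes z: "z \<in> taylor_koszul r \<mu> n" and cyc: "ext_diff (vertices r) z = 0"
    and q: "\<And>J. lookup (z (Gen ` J)) (mon_lcm \<mu> J) = 0"
  shows "\<exists>y\<in>taylor_koszul r \<mu> (Suc n). (\<forall>J. lookup (y (Gen ` J)) (mon_lcm \<mu> J) = 0) \<and>
    ext_diff (vertices r) y = z"
proof -
  define Q where "Q = (\<lambda>C a. C \<subseteq> vertices r \<and> mon_le (label \<mu> C) a \<and> a \<noteq> mon_lcm \<mu> (gens C))"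
  define v where "v = (\<lambda>a (B :: 'x vertex set). Var (SOME x. lookup (mon_lcm \<mu> (gens B)) x < lookup a x) :: 'x vertex)"
  have finQ: "finite C" if "Q C a" for C a
    using that finite_subset[OF _ finite_vertices] unfolding Q_def by blast
  have lcm_le: "mon_le (mon_lcm \<mu> (gens C)) a" if "mon_le (label \<mu> C) a" for C a
    using that unfolding label_def mon_le_def lookup_add by (meson add_leE)
  have "\<exists>y. (\<forall>C a. lookup (y C) a \<noteq> 0 \<longrightarrow> Q C a \<and> card C = Suc n) \<and> ext_diff (vertices r) y = z"
  proof (rule exponentwise_cone_acyclic[where v = v and W = "range Gen"])
    fix C a assume Q: "Q C a"
    then show "C \<subseteq> vertices r" by (simp add: Q_def)
    have le: "mon_le (mon_lcm \<mu> (gens C)) a" using Q lcm_le by (simp add: Q_def)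
    have "\<exists>x. lookup (mon_lcm \<mu> (gens C)) x < lookup a x"
    proof (rule ccontr)
      assume "\<nexists>x. lookup (mon_lcm \<mu> (gens C)) x < lookup a x"
      then have "mon_le a (mon_lcm \<mu> (gens C))" by (auto simp: mon_le_def not_less)
      then show False using Q mon_le_antisym[OF le] by (simp add: Q_def)
    qed
    from someI_ex[OF this] obtain x where x: "v a (C \<inter> range Gen) = Var x"
      "lookup (mon_lcm \<mu> (gens C)) x < lookup a x"
      by (auto simp: v_def)
    have "mon_le (label \<mu> (insert (Var x) C)) a"
      unfolding mon_le_def
    proof
      fix y
      have "lookup (label \<mu> C) y \<le> lookup a y" using Q by (simp add: Q_def mon_le_def)
      then show "lookup (label \<mu> (insert (Var x) C)) y \<le> lookup a y"
        using x(2) by (cases "y = x") (simp_all add: label_def lookup_add lookup_sqfree)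
    qed
    then show "v a (C \<inter> range Gen) \<in> vertices r - range Gen \<and> Q (insert (v a (C \<inter> range Gen)) C) a"
      using Q x by (auto simp: Q_def vertices_def)
    fix y
    have "a \<noteq> mon_lcm \<mu> (gens (C - {y}))"
    proof
      assume "a = mon_lcm \<mu> (gens (C - {y}))"
      then have "mon_le a (mon_lcm \<mu> (gens C))"
        using mon_lcm_mono[OF finite_gens[OF finQ[OF Q]] gens_mono, of "C - {y}" \<mu>] by auto
      then show False using Q mon_le_antisym[OF le] by (simp add: Q_def)
    qed
    then show "Q (C - {y}) a"
      using Q mon_le_trans[OF label_mono[OF finQ[OF Q]], of "C - {y}" \<mu> a]
      by (auto simp: Q_def)
  next
    fix C a assume nz: "lookup (z C) a \<noteq> 0"
    note zC = taylor_koszulD[OF z nz]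
    have "a \<noteq> mon_lcm \<mu> (gens C)"
    proof
      assume a: "a = mon_lcm \<mu> (gens C)"
      have "x \<notin> vars C" for x
        using zC(3) unfolding a by (auto simp: mon_le_def label_def lookup_add lookup_sqfree dest!: spec[of _ x])
      then have "c \<in> Gen ` gens C" if "c \<in> C" for c
        using that by (cases c) (auto simp: gens_def vars_def)
      then have "C = Gen ` gens C" by (auto simp: gens_def)
      then show False using q[of "gens C"] nz a by simp
    qed
    then show "Q C a \<and> card C = n" using zC by (simp add: Q_def)
  qed (rule cyc)
  then obtain y where y: "\<And>C a. lookup (y C) a \<noteq> 0 \<Longrightarrow> Q C a \<and> card C = Suc n"
    "ext_diff (vertices r) y = z" by blast
  have "y \<in> taylor_koszul r \<mu> (Suc n)" using y(1) by (auto simp: taylor_koszul_def Q_def)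
  moreover have "lookup (y (Gen ` J)) (mon_lcm \<mu> J) = 0" for J
    using y(1)[of "Gen ` J" "mon_lcm \<mu> J"] by (auto simp: Q_def)
  ultimately show ?thesis using y(2) by blast
qed


section \<open>The Taylor resolution modulo the variables\<close>

text \<open>
  The projection from \<open>T \<otimes>\<^sub>S K\<^sub>S\<close> to \<open>T \<otimes> k\<close>: the coefficient of \<open>u\<^sub>J\<close> modulo the variables.
\<close>

definition top_coeff :: "(nat \<Rightarrow> 'x::{finite,linorder} mon) \<Rightarrow> ('x vertex set \<Rightarrow> ('x, 'k::field) mpoly) \<Rightarrow> nat set \<Rightarrow> 'k" where
  "top_coeff \<mu> f J = lookup (f (Gen ` J)) (mon_lcm \<mu> J)"

lemma top_coeff_add: "top_coeff \<mu> (f + g) = top_coeff \<mu> f + top_coeff \<mu> g"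
  by (rule ext) (simp add: top_coeff_def lookup_add)

lemma top_coeff_uminus: "top_coeff \<mu> (- f) = - top_coeff \<mu> f"
  by (rule ext) (simp add: top_coeff_def)

lemma label_Gen: "label \<mu> (Gen ` J) = mon_lcm \<mu> J"
proof -
  have "sqfree {} = (0 :: 'a mon)" by (rule poly_mapping_eqI) (simp add: lookup_sqfree)
  then show ?thesis by (simp add: label_def)
qed

lemma top_coeff_nonzero:
  fixes f :: "'x::{finite,linorder} vertex set \<Rightarrow> ('x, 'k::field) mpoly"
  assumes "f \<in> taylor_koszul r \<mu> n" "top_coeff \<mu> f J \<noteq> 0"
  shows "J \<subseteq> {1..r}" "card J = n" "finite J"
proof -
  have C: "Gen ` J \<subseteq> (vertices r :: 'x vertex set)" "card (Gen ` J :: 'x vertex set) = n"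
    using taylor_koszulD(1,2)[OF assms(1) assms(2)[unfolded top_coeff_def]] by simp_all
  show "J \<subseteq> {1..r}" using C(1) by (auto simp: vertices_def)
  then show "finite J" by (rule finite_subset) simp
  show "card J = n" using C(2) by (subst (asm) card_image) (auto simp: inj_on_def)
qed

text \<open>
  A contribution to the coefficient of \<open>m\<^sub>J\<close> comes from terms of multidegrees at least \<open>m\<^bsub>J1\<^esub>\<close> and \<open>m\<^bsub>J2\<^esub>\<close>
  that multiply to \<open>m\<^sub>J\<close>.  As \<open>m\<^sub>J\<close> divides \<open>m\<^bsub>J1\<^esub> m\<^bsub>J2\<^esub>\<close>, equality holds throughout.
\<close>

lemma top_coeff_mult:
  assumes f: "f \<in> taylor_koszul r \<mu> m" and g: "g \<in> taylor_koszul r \<mu> n"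
    and nz: "top_coeff \<mu> (ext_mult f g) J \<noteq> 0"
  obtains J1 J2 where "J = J1 \<union> J2" "mon_gcd (mon_lcm \<mu> J1) (mon_lcm \<mu> J2) = 0"
    "top_coeff \<mu> f J1 \<noteq> 0" "top_coeff \<mu> g J2 \<noteq> 0"
proof -
  obtain A a b where A: "A \<subseteq> Gen ` J" "finite (Gen ` J :: 'a vertex set)" "mon_lcm \<mu> J = a + b"
    and fa: "lookup (f A) a \<noteq> 0" and gb: "lookup (g (Gen ` J - A)) b \<noteq> 0"
    using nz unfolding top_coeff_def by (rule lookup_ext_mult_nonzero)
  define J1 J2 where "J1 = gens A" and "J2 = J - J1"
  have A1: "A = Gen ` J1" using A(1) by (auto simp: J1_def gens_def)
  have A2: "Gen ` J - A = Gen ` J2" unfolding A1 J2_def by (auto simp: image_iff)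
  have J: "J = J1 \<union> J2" using A(1) by (auto simp: A1 J2_def)
  have "finite J" using A(2) by (rule finite_imageD) (simp add: inj_on_def)
  then have fin: "finite J1" "finite J2" by (simp_all add: J)
  have le: "mon_le (mon_lcm \<mu> J1) a" "mon_le (mon_lcm \<mu> J2) b"
    using taylor_koszulD(3)[OF f fa] taylor_koszulD(3)[OF g gb] unfolding A2 unfolding A1
    by (simp_all add: label_Gen)
  have ge: "mon_le (a + b) (mon_lcm \<mu> J1 + mon_lcm \<mu> J2)"
    using mon_lcm_union_le_add[OF fin, of \<mu>] A(3) by (simp add: J)
  have eq: "lookup a x = lookup (mon_lcm \<mu> J1) x \<and> lookup b x = lookup (mon_lcm \<mu> J2) x" for x
  proof -
    have "lookup a x + lookup b x \<le> lookup (mon_lcm \<mu> J1) x + lookup (mon_lcm \<mu> J2) x"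
      using ge by (simp add: mon_le_def lookup_add)
    moreover have "lookup (mon_lcm \<mu> J1) x \<le> lookup a x" "lookup (mon_lcm \<mu> J2) x \<le> lookup b x"
      using le by (simp_all add: mon_le_def)
    ultimately show ?thesis by linarith
  qed
  have ab: "a = mon_lcm \<mu> J1" "b = mon_lcm \<mu> J2"
    using eq by (auto intro!: poly_mapping_eqI)
  show ?thesis
  proof (rule that[OF J])
    show "mon_gcd (mon_lcm \<mu> J1) (mon_lcm \<mu> J2) = 0"
      using mon_lcm_union_eq_add_iff[OF fin, of \<mu>] A(3) by (simp add: J ab)
    show "top_coeff \<mu> f J1 \<noteq> 0" using fa by (simp add: top_coeff_def A1 ab)
    show "top_coeff \<mu> g J2 \<noteq> 0" using gb by (simp add: top_coeff_def A2 ab)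
  qed
qed

interpretation const_coeff: comm_ring_hom_fun "\<lambda>P :: ('x, 'k::field) mpoly. lookup P 0"
  by unfold_locales (simp_all add: lookup_add lookup_mult_0 lookup_one_0)

text \<open>
  The matrix of the differential of \<open>T \<otimes> k\<close>.
\<close>

definition taylor_red :: "(nat \<Rightarrow> 'x::{finite,linorder} mon) \<Rightarrow> nat set \<Rightarrow> nat set \<Rightarrow> 'k::field" where
  "taylor_red \<mu> L J = lookup (simplicial_coeff \<mu> L J) 0"

lemma mon_diff_eq_0_iff: "a - b = (0 :: 'x mon) \<longleftrightarrow> mon_le a b"
proof
  assume "a - b = 0"
  then have "lookup a x - lookup b x = 0" for x by (simp flip: lookup_minus)
  then show "mon_le a b" by (simp add: mon_le_def)
next
  assume "mon_le a b"
  then show "a - b = 0" by (intro poly_mapping_eqI) (simp add: mon_le_def lookup_minus)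
qed

lemma taylor_red_sum:
  fixes \<mu> :: "nat \<Rightarrow> 'x::{finite,linorder} mon"
  shows "(taylor_red \<mu> L J :: 'k::field) = (\<Sum>j | j \<in> J \<and> L = J - {j}.
     (-1) ^ card {l \<in> J. l < j} * (if mon_le (mon_lcm \<mu> J) (mon_lcm \<mu> L) then 1 else 0))"
proof -
  have "lookup ((-1) ^ k * mon_poly a :: ('x, 'k) mpoly) 0 = (-1) ^ k * (if a = 0 then 1 else 0)"
    for k and a :: "'x mon"
    by (simp add: minus_one_power_iff mon_poly_def lookup_single when_def)
  then show ?thesis
    unfolding taylor_red_def simplicial_coeff_def
    by (simp add: lookup_sum mon_diff_eq_0_iff)
qed

lemma taylor_red_nonzero:
  fixes \<mu> :: "nat \<Rightarrow> 'x::{finite,linorder} mon"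
  assumes "taylor_red \<mu> L J \<noteq> (0 :: 'k::field)" "finite J"
  shows "card J = Suc (card L)" "mon_lcm \<mu> J = mon_lcm \<mu> L"
proof -
  obtain j where j: "j \<in> {j. j \<in> J \<and> L = J - {j}}"
    and nz: "(-1) ^ card {l \<in> J. l < j} * (if mon_le (mon_lcm \<mu> J) (mon_lcm \<mu> L) then 1 else 0) \<noteq> (0 :: 'k)"
    by (rule sum.not_neutral_contains_not_neutral[OF assms(1)[unfolded taylor_red_sum]])
  have j: "j \<in> J" "L = J - {j}" "mon_le (mon_lcm \<mu> J) (mon_lcm \<mu> L)"
    using j nz by (simp_all split: if_splits)
  show "card J = Suc (card L)" unfolding j(2) using card_Suc_Diff1[OF assms(2) j(1)] by simp
  show "mon_lcm \<mu> J = mon_lcm \<mu> L"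
    using j(3) mon_lcm_mono[OF assms(2), of L \<mu>] j(2) by (intro mon_le_antisym) auto
qed

text \<open>
  The projection to \<open>T \<otimes> k\<close> is a chain map.  The vertices of variables contribute nothing, since a
  simplex containing \<open>Var x\<close> has a multidegree that does not divide \<open>m\<^sub>L\<close>.
\<close>

lemma top_coeff_diff:
  fixes f :: "'x::{finite,linorder} vertex set \<Rightarrow> ('x, 'k::field) mpoly"
  assumes f: "f \<in> taylor_koszul r \<mu> n"
  shows "top_coeff \<mu> (ext_diff (vertices r) f) = mat_op (Pow {1..r}) (taylor_red \<mu>) (top_coeff \<mu> f)"
proof
  fix L
  let ?F = "\<lambda>j. esign {Gen j :: 'x vertex} (Gen ` L) * lookup (f (insert (Gen j) (Gen ` L))) (mon_lcm \<mu> L)"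
  have lhs: "top_coeff \<mu> (ext_diff (vertices r) f) L
      = (\<Sum>x\<in>vertices r - Gen ` L. esign {x} (Gen ` L) * lookup (f (insert x (Gen ` L))) (mon_lcm \<mu> L))"
    unfolding top_coeff_def lookup_ext_diff by (simp add: ext_diff_def)
  have var0: "lookup (f (insert (Var x) (Gen ` L))) (mon_lcm \<mu> L) = 0" for x
  proof (rule ccontr)
    assume "lookup (f (insert (Var x) (Gen ` L))) (mon_lcm \<mu> L) \<noteq> 0"
    from taylor_koszulD(3)[OF f this] have "lookup (mon_lcm \<mu> L) x + 1 \<le> lookup (mon_lcm \<mu> L) x"
      by (auto simp: mon_le_def label_def lookup_add lookup_sqfree dest: spec[of _ x])
    then show False by simp
  qed
  have gen: "lookup (f (insert (Gen j) (Gen ` L))) (mon_lcm \<mu> L)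
      = (if mon_le (mon_lcm \<mu> (insert j L)) (mon_lcm \<mu> L) then top_coeff \<mu> f (insert j L) else 0)" for j
  proof (cases "f (Gen ` insert j L) = 0")
    case True
    then show ?thesis by (simp add: top_coeff_def)
  next
    case False
    have "finite (insert j L)"
      using taylor_koszul_nonzero(3)[OF f False] by (rule finite_imageD) (simp add: inj_on_def)
    then have le: "mon_le (mon_lcm \<mu> L) (mon_lcm \<mu> (insert j L))"
      by (rule mon_lcm_mono) auto
    show ?thesis
    proof (cases "mon_le (mon_lcm \<mu> (insert j L)) (mon_lcm \<mu> L)")
      case True
      then show ?thesis using mon_le_antisym[OF le] by (simp add: top_coeff_def)
    next
      case False
      then have "lookup (f (Gen ` insert j L)) (mon_lcm \<mu> L) = 0"
        using taylor_koszulD(3)[OF f, of "Gen ` insert j L" "mon_lcm \<mu> L"]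
        unfolding label_Gen by blast
      then show ?thesis using False by simp
    qed
  qed
  show "top_coeff \<mu> (ext_diff (vertices r) f) L = mat_op (Pow {1..r}) (taylor_red \<mu>) (top_coeff \<mu> f) L"
  proof (cases "L \<subseteq> {1..r}")
    case False
    have "f (insert x (Gen ` L)) = 0" for x
    proof (rule ccontr)
      assume "f (insert x (Gen ` L)) \<noteq> 0"
      from taylor_koszul_nonzero(1)[OF f this] have "Gen ` L \<subseteq> (vertices r :: 'x vertex set)" by simp
      then show False using False by (auto simp: vertices_def)
    qed
    then show ?thesis using False by (simp add: lhs mat_op_def)
  next
    case True
    have "finite L" using True by (rule finite_subset) simp
    have "top_coeff \<mu> (ext_diff (vertices r) f) L = (\<Sum>x\<in>Gen ` ({1..r} - L).
        esign {x} (Gen ` L) * lookup (f (insert x (Gen ` L))) (mon_lcm \<mu> L))"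
      unfolding lhs using var0
      by (intro sum.mono_neutral_right) (auto simp: finite_vertices vertices_def)
    also have "\<dots> = (\<Sum>j\<in>{1..r} - L. ?F j)"
      by (subst sum.reindex) (auto simp: inj_on_def)
    also have "\<dots> = (\<Sum>j\<in>{1..r} - L. (-1) ^ card {l \<in> insert j L. l < j} *
        (if mon_le (mon_lcm \<mu> (insert j L)) (mon_lcm \<mu> L) then 1 else 0) * top_coeff \<mu> f (insert j L))"
    proof (rule sum.cong[OF refl])
      fix j
      have "{b \<in> Gen ` L. b < (Gen j :: 'x vertex)} = Gen ` {l \<in> insert j L. l < j}" by auto
      then have "esign {Gen j} (Gen ` L :: 'x vertex set) = ((-1) ^ card {l \<in> insert j L. l < j} :: 'k)"
        by (simp add: esign_def koszul_inv_singleton_left card_image inj_on_def)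
      then show "?F j = (-1) ^ card {l \<in> insert j L. l < j} *
        (if mon_le (mon_lcm \<mu> (insert j L)) (mon_lcm \<mu> L) then 1 else 0) * top_coeff \<mu> f (insert j L)"
        by (simp add: gen)
    qed
    also have "\<dots> = (\<Sum>(J, j)\<in>Sigma (Pow {1..r}) (\<lambda>J. {j. j \<in> J \<and> L = J - {j}}).
        (-1) ^ card {l \<in> J. l < j} *
        (if mon_le (mon_lcm \<mu> J) (mon_lcm \<mu> L) then 1 else 0) * top_coeff \<mu> f J)"
      by (rule sum.reindex_bij_witness[of _ "\<lambda>(J, j). j" "\<lambda>j. (insert j L, j)"])
        (use True in \<open>auto simp: insert_absorb\<close>)
    also have "\<dots> = (\<Sum>J\<in>Pow {1..r}. taylor_red \<mu> L J * top_coeff \<mu> f J)"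
      unfolding taylor_red_sum sum_distrib_right
      by (rule sum.Sigma[symmetric]) (auto intro: finite_subset)
    finally show ?thesis using True by (simp add: mat_op_def)
  qed
qed

lemma mat_op_taylor_red_restr:
  fixes g :: "nat set \<Rightarrow> 'k::field"
  shows "mat_op (Pow {1..r}) (taylor_red \<mu>) (restr {J. card J = Suc n} g)
    = restr {J. card J = n} (mat_op (Pow {1..r}) (taylor_red \<mu>) g)"
proof
  fix L
  have "taylor_red \<mu> L J * restr {J. card J = Suc n} g J
      = (if card L = n then taylor_red \<mu> L J * g J else 0)" if "J \<in> Pow {1..r}" for J
  proof -
    have "finite J" using that finite_subset by auto
    then show ?thesis
      using taylor_red_nonzero(1)[of \<mu> L J] by (cases "taylor_red \<mu> L J = (0 :: 'k)") (auto simp: restr_def)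
  qed
  then have sum: "(\<Sum>J\<in>Pow {1..r}. taylor_red \<mu> L J * restr {J. card J = Suc n} g J)
      = (\<Sum>J\<in>Pow {1..r}. if card L = n then taylor_red \<mu> L J * g J else 0)"
    by (intro sum.cong refl)
  show "mat_op (Pow {1..r}) (taylor_red \<mu>) (restr {J. card J = Suc n} g) L
    = restr {J. card J = n} (mat_op (Pow {1..r}) (taylor_red \<mu>) g) L"
    unfolding mat_op_def sum by (simp add: restr_def)
qed

lemma top_coeff_lift:
  fixes g :: "nat set \<Rightarrow> 'k::field" and \<mu> :: "nat \<Rightarrow> 'x::{finite,linorder} mon"
  assumes "supported (Pow {1..r}) g" "\<And>J. g J \<noteq> 0 \<Longrightarrow> card J = n"
  shows "\<exists>f\<in>taylor_koszul r \<mu> n. top_coeff \<mu> f = g"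
proof -
  define f :: "'x vertex set \<Rightarrow> ('x, 'k) mpoly" where
    "f = (\<lambda>C. if vars C = {} then Poly_Mapping.single (mon_lcm \<mu> (gens C)) (g (gens C)) else 0)"
  have "top_coeff \<mu> f = g"
    by (rule ext) (simp add: top_coeff_def f_def)
  moreover have "f \<in> taylor_koszul r \<mu> n"
    unfolding taylor_koszul_def
  proof (intro CollectI allI impI)
    fix C a assume "lookup (f C) a \<noteq> 0"
    then have C: "vars C = {}" "a = mon_lcm \<mu> (gens C)" "g (gens C) \<noteq> 0"
      by (auto simp: f_def lookup_single when_def split: if_splits)
    have "c \<in> Gen ` gens C" if "c \<in> C" for c
      using that C(1) by (cases c) (auto simp: gens_def vars_def)
    then have CG: "C = Gen ` gens C" by (auto simp: gens_def)
    have "gens C \<subseteq> {1..r}" using assms(1) C(3) by (auto simp: supported_def)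
    then have "Gen ` gens C \<subseteq> (vertices r :: 'x vertex set)" by (auto simp: vertices_def)
    then have "C \<subseteq> vertices r" by (subst CG)
    moreover have "card (Gen ` gens C :: 'x vertex set) = card (gens C)"
      by (rule card_image) (simp add: inj_on_def)
    then have "card C = n" using assms(2)[OF C(3)] by (subst CG) simp
    moreover have "label \<mu> (Gen ` gens C) = a" by (simp add: label_Gen C(2))
    then have "mon_le (label \<mu> C) a" by (subst CG) (simp add: mon_le_refl)
    ultimately show "C \<subseteq> vertices r \<and> card C = n \<and> mon_le (label \<mu> C) a" by simp
  qed
  ultimately show ?thesis by blast
qed

text \<open>
  Inherited from the exterior algebra, after lifting one homogeneous component at a time.
\<close>

lemma taylor_red_square_zero:
  "square_zero (Pow {1..r}) (taylor_red \<mu> :: nat set \<Rightarrow> nat set \<Rightarrow> 'k::field)"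
  unfolding square_zero_def
proof (intro allI impI ext)
  fix g :: "nat set \<Rightarrow> 'k" and L :: "nat set" assume g: "supported (Pow {1..r}) g"
  let ?d = "mat_op (Pow {1..r}) (taylor_red \<mu>) :: (nat set \<Rightarrow> 'k) \<Rightarrow> _"
  define h where "h = restr {J. card J = Suc (Suc (card L))} g"
  have "supported (Pow {1..r}) h" "\<And>J. h J \<noteq> 0 \<Longrightarrow> card J = Suc (Suc (card L))"
    using g by (auto simp: h_def supported_def restr_def split: if_splits)
  then obtain f where f: "f \<in> taylor_koszul r \<mu> (Suc (Suc (card L)))" "top_coeff \<mu> f = h"
    using top_coeff_lift by blast
  have "?d (?d h) = top_coeff \<mu> (ext_diff (vertices r) (ext_diff (vertices r) f))"
    using f TK.part_d[OF f(1)] by (simp add: top_coeff_diff)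
  also have "\<dots> = 0" unfolding TK.d_d[OF f(1)] by (rule ext) (simp add: top_coeff_def)
  finally have "restr {J. card J = card L} (?d (?d g)) = 0"
    unfolding h_def mat_op_taylor_red_restr .
  from fun_cong[OF this, of L] show "?d (?d g) L = 0 L" by (simp add: restr_def)
qed

lemma standard_matching_sources:
  fixes \<mu> :: "nat \<Rightarrow> 'x::{finite,linorder} mon"
  assumes "standard_matching TYPE('k::field) r \<mu> M"
  shows "complements_cycles (Pow {1..r}) (taylor_red \<mu> :: nat set \<Rightarrow> nat set \<Rightarrow> 'k) (\<Union>i. Domain (M i))"
    and "(\<Union>i. Domain (M i)) \<subseteq> Pow {1..r}"
proof -
  let ?T = "taylor_res r \<mu> :: (nat set, ('x, 'k) mpoly) based_complex"
  have cells: "bc_cells ?T = Pow {1..r}" by (simp add: simplicial_res_def)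
  have red: "(\<lambda>L J. lookup (bc_diff ?T L J) 0) = taylor_red \<mu>"
    by (simp add: simplicial_res_def taylor_red_def fun_eq_iff)
  note sm = assms[unfolded standard_matching_def Let_def]
  note sm1 = conjunct1[OF sm] and sm2 = conjunct1[OF conjunct2[OF sm]]
    and sm3 = conjunct1[OF conjunct2[OF conjunct2[OF sm]]]
  have "complements_cycles (bc_cells ?T) (\<lambda>L J. lookup (bc_diff ?T L J) 0) (\<Union>i. Domain (M i))"
  proof (rule const_coeff.iterated_sources_complement_cycles[where lbl = "mon_lcm \<mu>"])
    show "finite (bc_cells ?T)" unfolding cells by simp
    show "square_zero (bc_cells ?T) (\<lambda>L J. lookup (bc_diff ?T L J) 0)"
      unfolding cells red by (rule taylor_red_square_zero)
    show "morse_matching (morse_iter ?T M i) (M i)" for i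
      by (rule spec[OF sm3])
    show "mon_lcm \<mu> J = mon_lcm \<mu> L"
      if "J \<in> bc_cells ?T" "L \<in> bc_cells ?T" "lookup (bc_diff ?T L J) 0 \<noteq> 0" for J L
    proof (rule taylor_red_nonzero(2))
      show "taylor_red \<mu> L J \<noteq> (0 :: 'k)" using that(3) by (simp add: taylor_red_def simplicial_res_def)
      show "finite J" using that(1) unfolding cells by (auto intro: finite_subset)
    qed
    show "mon_lcm \<mu> u = mon_lcm \<mu> v" if "(u, v) \<in> M i" for i u v
      using bspec[OF spec[OF sm1, of i] that] by simp
    show "mon_lcm \<mu> u \<noteq> mon_lcm \<mu> v" if "(u, v) \<in> bc_edges (morse_iter_all ?T M)" for u v
      using bspec[OF sm2 that] by simp
  qed
  then show "complements_cycles (Pow {1..r}) (taylor_red \<mu> :: nat set \<Rightarrow> nat set \<Rightarrow> 'k) (\<Union>i. Domain (M i))"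
    unfolding cells red .
  show "(\<Union>i. Domain (M i)) \<subseteq> Pow {1..r}"
  proof (rule UN_least)
    fix i
    have "bc_cells (morse_iter ?T M i) \<subseteq> bc_cells ?T"
    proof (induction i)
      case (Suc i)
      have "bc_cells (morse_iter ?T M (Suc i)) \<subseteq> bc_cells (morse_iter ?T M i)"
        by (simp add: morse_complex_def)
      then show ?case using Suc by (rule order_trans)
    qed simp
    moreover have "morse_matching (morse_iter ?T M i) (M i)"
      by (rule spec[OF sm3])
    then have "M i \<subseteq> bc_edges (morse_iter ?T M i)" by (simp add: morse_matching_def)
    ultimately show "Domain (M i) \<subseteq> Pow {1..r}"
      unfolding cells by (auto simp: bc_edges_def)
  qed
qed

lemma mon_gcd_commute: "mon_gcd a b = mon_gcd b a"
  by (rule poly_mapping_eqI) (simp add: lookup_mon_gcd min.commute)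

lemma coprime_union_iff:
  assumes "finite J" "finite L"
  shows "mon_gcd (mon_lcm \<mu> (J \<union> L)) a = 0 \<longleftrightarrow>
    mon_gcd (mon_lcm \<mu> J) a = 0 \<and> mon_gcd (mon_lcm \<mu> L) a = 0"
proof -
  have "max p q = 0 \<or> s = 0 \<longleftrightarrow> (p = 0 \<or> s = 0) \<and> (q = 0 \<or> s = 0)" for p q s :: nat by auto
  then show ?thesis
    unfolding mon_gcd_eq_0_iff lookup_mon_lcm_union[OF assms] by (simp only: all_conj_distrib)
qed

text \<open>
  An arrow arises from one in \<open>\<B>\<^sub>i\<close> by adding a coprime cell \<open>z\<close>.  If \<open>w\<close> is coprime to its source, then
  \<open>z \<union> w\<close> is coprime to the source of the arrow in \<open>\<B>\<^sub>i\<close>, so adding \<open>w\<close> leads to an arrow again.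
\<close>

lemma standard_matching_union:
  assumes sm: "standard_matching TYPE('k::field) r \<mu> M"
    and u: "u \<in> (\<Union>i. Domain (M i))" and w: "w \<subseteq> {1..r}" and cop: "mon_gcd (mon_lcm \<mu> u) (mon_lcm \<mu> w) = 0"
  shows "u \<union> w \<in> (\<Union>i. Domain (M i))"
proof -
  obtain i v where e: "(u, v) \<in> M i" using u by blast
  have "finite u" "finite w"
    using standard_matching_sources(2)[OF sm] u w by (auto intro: finite_subset)
  obtain B where B: "B \<subseteq> M i" "M i = B \<union> {(u \<union> w, v \<union> w) | u v w.
      w \<subseteq> {1..r} \<and> mon_gcd (mon_lcm \<mu> u) (mon_lcm \<mu> w) = 0 \<and> (u, v) \<in> B}"
    using spec[OF conjunct2[OF conjunct2[OF conjunct2[OF conjunct2[OF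
      sm[unfolded standard_matching_def Let_def]]]]], of i]
    by (elim exE conjE) (rule that)
  have grow: "(x \<union> y, v \<union> y) \<in> M i"
    if "(x, v) \<in> B" "y \<subseteq> {1..r}" "mon_gcd (mon_lcm \<mu> x) (mon_lcm \<mu> y) = 0" for x y v
    unfolding B(2) by (rule UnI2) (use that in blast)
  have "(u, v) \<in> B \<or> (\<exists>x y z. u = x \<union> z \<and> v = y \<union> z \<and>
      z \<subseteq> {1..r} \<and> mon_gcd (mon_lcm \<mu> x) (mon_lcm \<mu> z) = 0 \<and> (x, y) \<in> B)"
    using e[unfolded B(2)] by (elim UnE CollectE exE conjE) (blast, simp, blast)
  then have "\<exists>v'. (u \<union> w, v') \<in> M i"
  proof
    assume "(u, v) \<in> B"
    from grow[OF this w cop] show ?thesis by blast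
  next
    assume "\<exists>x y z. u = x \<union> z \<and> v = y \<union> z \<and>
      z \<subseteq> {1..r} \<and> mon_gcd (mon_lcm \<mu> x) (mon_lcm \<mu> z) = 0 \<and> (x, y) \<in> B"
    then obtain x y z where xyz: "u = x \<union> z" "z \<subseteq> {1..r}"
      "mon_gcd (mon_lcm \<mu> x) (mon_lcm \<mu> z) = 0" "(x, y) \<in> B" by blast
    have fin: "finite x" "finite z" using \<open>finite u\<close> by (simp_all add: xyz(1))
    have "mon_gcd (mon_lcm \<mu> x) (mon_lcm \<mu> w) = 0"
      using cop coprime_union_iff[OF fin, of \<mu> "mon_lcm \<mu> w"] by (simp add: xyz(1))
    then have "mon_gcd (mon_lcm \<mu> x) (mon_lcm \<mu> (z \<union> w)) = 0"
      using xyz(3) coprime_union_iff[OF fin(2) \<open>finite w\<close>, of \<mu> "mon_lcm \<mu> x"]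
      by (simp add: mon_gcd_commute)
    from grow[OF xyz(4) _ this] w xyz(2) have "(x \<union> (z \<union> w), y \<union> (z \<union> w)) \<in> M i" by simp
    then show ?thesis by (auto simp: xyz(1) Un_assoc)
  qed
  then show ?thesis by blast
qed

text \<open>
  The preimage in \<open>T \<otimes>\<^sub>S K\<^sub>S\<close> of the span of \<open>X\<close> in \<open>T \<otimes> k\<close>; here \<open>X\<close> is the set of sources.
\<close>

definition source_ideal :: "(nat \<Rightarrow> 'x::{finite,linorder} mon) \<Rightarrow> nat set set \<Rightarrow>
    ('x vertex set \<Rightarrow> ('x, 'k::field) mpoly) set" where
  "source_ideal \<mu> X = {f. supported X (top_coeff \<mu> f)}"

lemma source_ideal_mult:
  assumes union: "\<And>u w. u \<in> X \<Longrightarrow> w \<subseteq> {1..r} \<Longrightarrow> mon_gcd (mon_lcm \<mu> u) (mon_lcm \<mu> w) = 0 \<Longrightarrow> u \<union> w \<in> X"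
    and f: "f \<in> taylor_koszul r \<mu> m" and g: "g \<in> taylor_koszul r \<mu> n"
    and fg: "f \<in> source_ideal \<mu> X \<or> g \<in> source_ideal \<mu> X"
  shows "ext_mult f g \<in> source_ideal \<mu> X"
proof -
  have "J \<in> X" if nz: "top_coeff \<mu> (ext_mult f g) J \<noteq> 0" for J
  proof -
    obtain J1 J2 where J: "J = J1 \<union> J2" "mon_gcd (mon_lcm \<mu> J1) (mon_lcm \<mu> J2) = 0"
      "top_coeff \<mu> f J1 \<noteq> 0" "top_coeff \<mu> g J2 \<noteq> 0"
      by (rule top_coeff_mult[OF f g nz])
    have sub: "J1 \<subseteq> {1..r}" "J2 \<subseteq> {1..r}"
      using top_coeff_nonzero(1)[OF f J(3)] top_coeff_nonzero(1)[OF g J(4)] .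
    have "J1 \<in> X \<or> J2 \<in> X" using fg J(3,4) by (auto simp: source_ideal_def supported_def)
    then show ?thesis
      using union[of J1 J2] union[of J2 J1] J(1,2) sub by (auto simp: mon_gcd_commute Un_commute)
  qed
  then show ?thesis by (auto simp: source_ideal_def supported_def)
qed

context
  fixes \<mu> :: "nat \<Rightarrow> 'x::{finite,linorder} mon" and r :: nat and X :: "nat set set"
  assumes compl: "complements_cycles (Pow {1..r}) (taylor_red \<mu> :: nat set \<Rightarrow> nat set \<Rightarrow> 'k::field) X"
    and X: "X \<subseteq> Pow {1..r}"
begin

text \<open>
  In \<open>T \<otimes> k\<close> the image of \<open>e\<close> may be replaced by an element of the span of \<open>X\<close> with the same boundary.
  A lift of the latter has the right boundary up to a cycle in the kernel of the projection, and that
  kernel is acyclic.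
\<close>

lemma source_ideal_boundary:
  fixes e :: "'x vertex set \<Rightarrow> ('x, 'k) mpoly"
  assumes e: "e \<in> taylor_koszul r \<mu> (Suc n)"
  shows "\<exists>b\<in>taylor_koszul r \<mu> (Suc n) \<inter> source_ideal \<mu> X. ext_diff (vertices r) b = ext_diff (vertices r) e"
proof -
  let ?d = "mat_op (Pow {1..r}) (taylor_red \<mu>) :: (nat set \<Rightarrow> 'k) \<Rightarrow> _"
  let ?D = "ext_diff (vertices r) :: ('x vertex set \<Rightarrow> ('x, 'k) mpoly) \<Rightarrow> _"
  have "supported (Pow {1..r}) (top_coeff \<mu> e)"
    using top_coeff_nonzero(1)[OF e] by (auto simp: supported_def)
  then obtain u where u: "supported X u" "?d u = ?d (top_coeff \<mu> e)"
    using compl unfolding complements_cycles_def by blast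
  \<comment> \<open>keep only the homogeneous component of degree \<open>n + 1\<close>\<close>
  define u' where "u' = restr {J. card J = Suc n} u"
  have top_e: "restr {J. card J = Suc n} (top_coeff \<mu> e) = top_coeff \<mu> e"
    using top_coeff_nonzero(2)[OF e] by (fastforce simp: restr_def fun_eq_iff)
  have "?d u' = restr {J. card J = n} (?d (top_coeff \<mu> e))"
    unfolding u'_def mat_op_taylor_red_restr u(2) ..
  also have "\<dots> = ?d (top_coeff \<mu> e)"
    unfolding mat_op_taylor_red_restr[symmetric] top_e ..
  finally have du': "?d u' = ?d (top_coeff \<mu> e)" .
  have "supported (Pow {1..r}) u'" "\<And>J. u' J \<noteq> 0 \<Longrightarrow> card J = Suc n"
    using u(1) X by (auto simp: u'_def supported_def restr_def split: if_splits)
  then obtain b0 where b0: "b0 \<in> taylor_koszul r \<mu> (Suc n)" "top_coeff \<mu> b0 = u'"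
    using top_coeff_lift by blast
  define z where "z = ?D e - ?D b0"
  have z: "z \<in> taylor_koszul r \<mu> n"
    unfolding z_def by (intro TK.part_diff TK.part_d e b0)
  have dz: "?D z = 0"
    unfolding z_def TK.d_diff TK.d_d[OF e] TK.d_d[OF b0(1)] by simp
  have "top_coeff \<mu> z = top_coeff \<mu> (?D e) - top_coeff \<mu> (?D b0)"
    unfolding z_def by (simp add: top_coeff_def fun_eq_iff lookup_minus)
  also have "\<dots> = 0"
    unfolding top_coeff_diff[OF e] top_coeff_diff[OF b0(1)] b0(2) du' by simp
  finally have "lookup (z (Gen ` J)) (mon_lcm \<mu> J) = 0" for J
    by (simp add: top_coeff_def fun_eq_iff)
  from kernel_taylor_acyclic[OF z dz this] obtain y where y: "y \<in> taylor_koszul r \<mu> (Suc n)"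
    "\<forall>J. lookup (y (Gen ` J)) (mon_lcm \<mu> J) = 0" "?D y = z" by blast
  have "top_coeff \<mu> (b0 + y) = u'"
    unfolding top_coeff_add b0(2) using y(2) by (simp add: top_coeff_def fun_eq_iff)
  then have "b0 + y \<in> source_ideal \<mu> X"
    using u(1) by (simp add: source_ideal_def supported_def u'_def restr_def)
  moreover have "?D (b0 + y) = ?D e" by (simp add: TK.d_add y(3) z_def)
  ultimately show ?thesis using TK.part_add[OF b0(1) y(1)] by blast
qed

text \<open>
  The image of \<open>z\<close> in \<open>T \<otimes> k\<close> is a cycle in the span of \<open>X\<close>, hence zero, and the kernel is acyclic.
\<close>

lemma source_ideal_cycle:
  fixes z :: "'x vertex set \<Rightarrow> ('x, 'k) mpoly"
  assumes z: "z \<in> taylor_koszul r \<mu> n" "z \<in> source_ideal \<mu> X" and dz: "ext_diff (vertices r) z = 0"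
  shows "\<exists>y\<in>taylor_koszul r \<mu> (Suc n) \<inter> source_ideal \<mu> X. ext_diff (vertices r) y = z"
proof -
  have "mat_op (Pow {1..r}) (taylor_red \<mu>) (top_coeff \<mu> z) = top_coeff \<mu> (ext_diff (vertices r) z)"
    by (rule top_coeff_diff[OF z(1), symmetric])
  also have "\<dots> = 0" unfolding dz by (simp add: top_coeff_def fun_eq_iff)
  finally have "top_coeff \<mu> z = 0"
    using compl z(2) unfolding complements_cycles_def source_ideal_def by blast
  then have "lookup (z (Gen ` J)) (mon_lcm \<mu> J) = 0" for J
    by (simp add: top_coeff_def fun_eq_iff)
  from kernel_taylor_acyclic[OF z(1) dz this] obtain y where y: "y \<in> taylor_koszul r \<mu> (Suc n)"
    "\<forall>J. lookup (y (Gen ` J)) (mon_lcm \<mu> J) = 0" "ext_diff (vertices r) y = z" by blast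
  then have "y \<in> source_ideal \<mu> X" by (simp add: source_ideal_def supported_def top_coeff_def)
  then show ?thesis using y by blast
qed

end


section \<open>The projection to the Koszul dga\<close>

definition residue :: "('x::{finite,linorder}, 'k::field) mpoly set \<Rightarrow> ('x, 'k) mpoly \<Rightarrow> ('x, 'k) mpoly set" where
  "residue I P = I +>\<^bsub>poly_ring\<^esub> P"

text \<open>
  The map \<open>T \<otimes>\<^sub>S K\<^sub>S \<rightarrow> S/I \<otimes>\<^sub>S K\<^sub>S\<close>: only the cell \<open>J = {}\<close> survives, and the division undoes the
  normalization of \<open>e\<^sub>A\<close>.
\<close>

definition to_koszul :: "('x::{finite,linorder}, 'k::field) mpoly set \<Rightarrow>
    ('x vertex set \<Rightarrow> ('x, 'k) mpoly) \<Rightarrow> 'x set \<Rightarrow> ('x, 'k) mpoly set" where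
  "to_koszul I f A = residue I (mon_div (sqfree A) (f (Var ` A)))"

lemma koszul_quot_simps:
  "carrier (koszul_quot I) = {f. \<forall>A. f A \<in> carrier (poly_ring Quot I)}"
  "mult (koszul_quot I) = (\<lambda>f g C. \<Oplus>\<^bsub>poly_ring Quot I\<^esub>A\<in>Pow C. sign_power (poly_ring Quot I)
     (koszul_inv A (C - A)) (f A \<otimes>\<^bsub>poly_ring Quot I\<^esub> g (C - A)))"
  "zero (koszul_quot I) = (\<lambda>A. \<zero>\<^bsub>poly_ring Quot I\<^esub>)"
  "add (koszul_quot I) = (\<lambda>f g A. f A \<oplus>\<^bsub>poly_ring Quot I\<^esub> g A)"
  "dg_part (koszul_quot I) n =
     {f. (\<forall>A. f A \<in> carrier (poly_ring Quot I)) \<and> (\<forall>A. card A \<noteq> n \<longrightarrow> f A = \<zero>\<^bsub>poly_ring Quot I\<^esub>)}"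
  "dg_diff (koszul_quot I) = (\<lambda>f B. \<Oplus>\<^bsub>poly_ring Quot I\<^esub>x\<in>- B. sign_power (poly_ring Quot I)
     (card {b \<in> B. b < x}) (residue I (var x) \<otimes>\<^bsub>poly_ring Quot I\<^esub> f (insert x B)))"
  by (simp_all add: koszul_quot_def koszul_dga_def residue_def)

locale quotient_ideal = ideal I poly_ring
  for I :: "('x::{finite,linorder}, 'k::field) mpoly set"
begin

abbreviation "R \<equiv> poly_ring Quot I"

sublocale Q: ring R by (rule quotient_is_ring)

lemma residue_carrier: "residue I P \<in> carrier R"
  unfolding residue_def using ring_hom_closed[OF rcos_ring_hom, of P] by simp

lemma residue_add: "residue I (P + P') = residue I P \<oplus>\<^bsub>R\<^esub> residue I P'"
  unfolding residue_def using ring_hom_add[OF rcos_ring_hom, of P P'] by simp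

lemma residue_mult: "residue I (P * P') = residue I P \<otimes>\<^bsub>R\<^esub> residue I P'"
  unfolding residue_def using ring_hom_mult[OF rcos_ring_hom, of P P'] by simp

lemma residue_0: "residue I 0 = \<zero>\<^bsub>R\<^esub>"
  using residue_add[of 0 0] residue_carrier[of 0] Q.add.l_cancel_one'[of "residue I 0" "residue I 0"]
  by simp

lemma residue_uminus: "residue I (- P) = \<ominus>\<^bsub>R\<^esub> residue I P"
  using residue_add[of "- P" P] by (intro Q.minus_equality[symmetric] residue_carrier) (simp add: residue_0)

lemma residue_eq_0_iff: "residue I P = \<zero>\<^bsub>R\<^esub> \<longleftrightarrow> P \<in> I"
proof
  assume "residue I P = \<zero>\<^bsub>R\<^esub>"
  then have "I +>\<^bsub>poly_ring\<^esub> P = I" by (simp add: residue_def FactRing_def)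
  then show "P \<in> I" using rcos_const_imp_mem[of P] by simp
next
  assume "P \<in> I"
  then show "residue I P = \<zero>\<^bsub>R\<^esub>" by (simp add: residue_def FactRing_def a_rcos_const)
qed

lemma residue_sum: "finite X \<Longrightarrow> residue I (sum f X) = (\<Oplus>\<^bsub>R\<^esub>x\<in>X. residue I (f x))"
  by (induction X rule: finite_induct) (simp_all add: residue_0 residue_add residue_carrier Q.finsum_insert)

lemma residue_surj: "c \<in> carrier R \<Longrightarrow> \<exists>P. residue I P = c"
  by (auto simp: residue_def FactRing_def A_RCOSETS_def')

lemma residue_esign: "residue I (esign A B * P) = sign_power R (koszul_inv A B) (residue I P)"
  by (simp add: esign_def sign_power_def minus_one_power_iff residue_uminus)

lemma abelian_group_koszul: "abelian_group (koszul_quot I)"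
proof (rule abelian_groupI)
  fix f assume f: "f \<in> carrier (koszul_quot I)"
  show "\<exists>g\<in>carrier (koszul_quot I). g \<oplus>\<^bsub>koszul_quot I\<^esub> f = \<zero>\<^bsub>koszul_quot I\<^esub>"
    by (rule bexI[of _ "\<lambda>A. \<ominus>\<^bsub>R\<^esub> f A"]) (use f in \<open>auto simp: koszul_quot_simps Q.l_neg\<close>)
qed (simp_all add: koszul_quot_simps fun_eq_iff Q.a_ac)

sublocale K: abelian_group "koszul_quot I" by (rule abelian_group_koszul)

lemma to_koszul_carrier: "to_koszul I f \<in> carrier (koszul_quot I)"
  by (simp add: koszul_quot_simps to_koszul_def residue_carrier)

lemma to_koszul_add: "to_koszul I (f + g) = to_koszul I f \<oplus>\<^bsub>koszul_quot I\<^esub> to_koszul I g"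
  by (rule ext) (simp add: to_koszul_def koszul_quot_simps mon_div_add residue_add)

lemma to_koszul_0: "to_koszul I 0 = \<zero>\<^bsub>koszul_quot I\<^esub>"
  by (rule ext) (simp add: to_koszul_def koszul_quot_simps mon_div_0 residue_0)

lemma to_koszul_uminus: "to_koszul I (- f) = \<ominus>\<^bsub>koszul_quot I\<^esub> to_koszul I f"
  using to_koszul_add[of "- f" f]
  by (intro K.minus_equality[symmetric] to_koszul_carrier) (simp add: to_koszul_0)

lemma to_koszul_sum:
  "finite X \<Longrightarrow> to_koszul I (sum f X) = (\<Oplus>\<^bsub>koszul_quot I\<^esub>x\<in>X. to_koszul I (f x))"
proof (induction X rule: finite_induct)
  case empty
  show ?case by (simp only: sum.empty to_koszul_0 K.finsum_empty)
next
  case (insert x X)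
  have "to_koszul I (sum f (insert x X))
      = to_koszul I (f x) \<oplus>\<^bsub>koszul_quot I\<^esub> (\<Oplus>\<^bsub>koszul_quot I\<^esub>x\<in>X. to_koszul I (f x))"
    by (simp only: sum.insert[OF insert.hyps] to_koszul_add insert.IH)
  also have "\<dots> = (\<Oplus>\<^bsub>koszul_quot I\<^esub>x\<in>insert x X. to_koszul I (f x))"
    using insert.hyps by (intro K.finsum_insert[symmetric]) (auto intro: to_koszul_carrier)
  finally show ?case .
qed

lemma to_koszul_sign_by: "to_koszul I (sign_by n f) = sign_power (koszul_quot I) n (to_koszul I f)"
  by (simp add: sign_by_def sign_power_def to_koszul_uminus)

lemma sqfree_union: "A \<inter> B = {} \<Longrightarrow> sqfree (A \<union> B) = sqfree A + sqfree B"
  by (rule poly_mapping_eqI) (auto simp: lookup_sqfree lookup_add)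

lemma koszul_inv_Var: "koszul_inv (Var ` A) (Var ` B) = koszul_inv A (B :: 'x set)"
proof -
  have "{(a, b). a \<in> Var ` A \<and> b \<in> Var ` B \<and> b < a}
      = map_prod Var Var ` {(a, b). a \<in> A \<and> b \<in> B \<and> b < a}"
    by auto
  then show ?thesis
    unfolding koszul_inv_def by (simp add: card_image inj_on_def)
qed

lemma label_Var: "label \<mu> (Var ` A) = sqfree A"
proof -
  have "mon_lcm \<mu> {} = 0" by (rule poly_mapping_eqI) (simp add: lookup_mon_lcm)
  then show ?thesis by (simp add: label_def)
qed

lemma taylor_koszul_Var:
  assumes "f \<in> taylor_koszul r \<mu> n" "lookup (f (Var ` A)) c \<noteq> 0"
  shows "mon_le (sqfree A) c"
  using taylor_koszulD(3)[OF assms] by (simp only: label_Var)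

lemma to_koszul_part:
  assumes f: "f \<in> taylor_koszul r \<mu> n"
  shows "to_koszul I f \<in> dg_part (koszul_quot I) n"
proof -
  have "to_koszul I f A = \<zero>\<^bsub>R\<^esub>" if A: "card A \<noteq> n" for A
  proof -
    have "card (Var ` A) = card A" by (rule card_image) (simp add: inj_on_def)
    then have "f (Var ` A) = 0" using taylor_koszul_nonzero(2)[OF f, of "Var ` A"] A by auto
    then show ?thesis by (simp add: to_koszul_def mon_div_0 residue_0)
  qed
  then show ?thesis by (auto simp: koszul_quot_simps to_koszul_def residue_carrier)
qed

lemma to_koszul_mult:
  assumes f: "f \<in> taylor_koszul r \<mu> m" and g: "g \<in> taylor_koszul r \<mu> n"
  shows "to_koszul I (ext_mult f g) = to_koszul I f \<otimes>\<^bsub>koszul_quot I\<^esub> to_koszul I g"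
proof
  fix C :: "'x set"
  have img: "Var ` C - Var ` A = Var ` (C - A)" for A by auto
  have "ext_mult f g (Var ` C) = (\<Sum>A\<in>Pow C. esign (Var ` A) (Var ` C - Var ` A) * (f (Var ` A) * g (Var ` C - Var ` A)))"
    unfolding ext_mult_def
    by (subst image_Pow_surj[OF refl, symmetric], subst sum.reindex)
      (auto simp: inj_on_def inj_image_eq_iff)
  also have "\<dots> = (\<Sum>A\<in>Pow C. esign A (C - A) * (f (Var ` A) * g (Var ` (C - A))))"
    unfolding img esign_def koszul_inv_Var ..
  finally have e: "ext_mult f g (Var ` C) = \<dots>" .
  have "mon_div (sqfree C) (esign A (C - A) * (f (Var ` A) * g (Var ` (C - A))))
      = esign A (C - A) * (mon_div (sqfree A) (f (Var ` A)) * mon_div (sqfree (C - A)) (g (Var ` (C - A))))"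
    if "A \<in> Pow C" for A
  proof -
    have "sqfree C = sqfree A + sqfree (C - A)"
      using sqfree_union[of A "C - A"] that by (simp add: Un_absorb1)
    then have "mon_div (sqfree C) (f (Var ` A) * g (Var ` (C - A)))
      = mon_div (sqfree A) (f (Var ` A)) * mon_div (sqfree (C - A)) (g (Var ` (C - A)))"
      using mon_div_mult[OF taylor_koszul_Var[OF f] taylor_koszul_Var[OF g]] by simp
    then show ?thesis by (simp add: esign_def minus_one_power_iff mon_div_uminus)
  qed
  then have sum: "(\<Sum>A\<in>Pow C. mon_div (sqfree C) (esign A (C - A) * (f (Var ` A) * g (Var ` (C - A)))))
      = (\<Sum>A\<in>Pow C. esign A (C - A) *
          (mon_div (sqfree A) (f (Var ` A)) * mon_div (sqfree (C - A)) (g (Var ` (C - A)))))"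
    by (intro sum.cong refl)
  have "to_koszul I (ext_mult f g) C = residue I (\<Sum>A\<in>Pow C. esign A (C - A) *
      (mon_div (sqfree A) (f (Var ` A)) * mon_div (sqfree (C - A)) (g (Var ` (C - A)))))"
    unfolding to_koszul_def e mon_div_sum sum ..
  also have "\<dots> = (\<Oplus>\<^bsub>R\<^esub>A\<in>Pow C. sign_power R (koszul_inv A (C - A))
      (to_koszul I f A \<otimes>\<^bsub>R\<^esub> to_koszul I g (C - A)))"
    unfolding residue_sum[OF finite] residue_esign unfolding residue_mult to_koszul_def ..
  also have "\<dots> = (to_koszul I f \<otimes>\<^bsub>koszul_quot I\<^esub> to_koszul I g) C"
    by (simp add: koszul_quot_simps)
  finally show "to_koszul I (ext_mult f g) C = (to_koszul I f \<otimes>\<^bsub>koszul_quot I\<^esub> to_koszul I g) C" .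
qed

end

lemma quotient_mon_ideal: "quotient_ideal (mon_ideal r \<mu>)"
  by (intro quotient_ideal.intro ideal_mon_ideal)

context
  fixes r :: nat and \<mu> :: "nat \<Rightarrow> 'x::{finite,linorder} mon" and I :: "('x, 'k::field) mpoly set"
  assumes I: "I = mon_ideal r \<mu>"
begin

interpretation quotient_ideal I unfolding I by (rule quotient_mon_ideal)

abbreviation (input) "D \<equiv> (taylor_koszul r \<mu> :: nat \<Rightarrow> ('x vertex set \<Rightarrow> ('x, 'k) mpoly) set)"
abbreviation (input) "del \<equiv> (ext_diff (vertices r) :: ('x vertex set \<Rightarrow> ('x, 'k) mpoly) \<Rightarrow> _)"
abbreviation (input) "K \<equiv> koszul_quot I"

text \<open>
  Contracting \<open>Var x\<close> gives the factor \<open>x\<close> of the Koszul differential because of the normalization.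
  Contracting \<open>Gen j\<close> leaves a multiple of \<open>m\<^sub>j\<close>, which vanishes in \<open>S/I\<close>.
\<close>

lemma to_koszul_diff:
  assumes f: "f \<in> D n"
  shows "to_koszul I (del f) = dg_diff K (to_koszul I f)"
proof
  fix B :: "'x set"
  let ?t = "\<lambda>x. residue I (mon_div (sqfree B) (esign {x} (Var ` B) * f (insert x (Var ` B))))"
  have gen: "?t (Gen j) = \<zero>\<^bsub>R\<^esub>" for j
  proof -
    have "mon_div (sqfree B) (esign {Gen j} (Var ` B) * f (insert (Gen j) (Var ` B))) \<in> I"
      unfolding I mon_ideal_iff
    proof (intro allI impI)
      fix b assume "lookup (mon_div (sqfree B) (esign {Gen j} (Var ` B) * f (insert (Gen j) (Var ` B)))) b \<noteq> 0"
      then have "lookup (f (insert (Gen j) (Var ` B))) (sqfree B + b) \<noteq> 0"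
        by (auto simp: lookup_mon_div lookup_esign_mult)
      note fj = taylor_koszulD(1,3)[OF f this]
      have "j \<in> {1..r}" using fj(1) by (auto simp: vertices_def)
      moreover have "mon_le (\<mu> j) (mon_lcm \<mu> {j})"
        using mon_lcm_le_iff[of "{j}" \<mu> "mon_lcm \<mu> {j}"] by (simp add: mon_le_refl)
      have "mon_le (mon_lcm \<mu> {j} + sqfree B) (sqfree B + b)"
        using fj(2) by (simp add: label_def)
      then have "mon_le (mon_lcm \<mu> {j}) b" by (simp add: mon_le_def lookup_add add.commute)
      with \<open>mon_le (\<mu> j) (mon_lcm \<mu> {j})\<close> have "mon_le (\<mu> j) b" by (rule mon_le_trans)
      ultimately show "\<exists>j\<in>{1..r}. mon_le (\<mu> j) b" by blast
    qed
    then show ?thesis by (simp add: residue_eq_0_iff)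
  qed
  have var: "?t (Var x) = sign_power R (card {b \<in> B. b < x}) (residue I (var x) \<otimes>\<^bsub>R\<^esub> to_koszul I f (insert x B))"
    if x: "x \<notin> B" for x
  proof -
    have ins: "insert (Var x) (Var ` B) = Var ` insert x B" by simp
    have sq: "sqfree (insert x B) = sqfree {x} + sqfree B"
      using sqfree_union[of "{x}" B] x by simp
    define P where "P = mon_div (sqfree (insert x B)) (f (Var ` insert x B))"
    have "f (Var ` insert x B) = mon_poly (sqfree (insert x B)) * P"
      unfolding P_def by (rule mon_poly_mult_div[symmetric]) (rule taylor_koszul_Var[OF f])
    also have "\<dots> = mon_poly (sqfree B) * (mon_poly (sqfree {x}) * P)"
      unfolding sq by (simp add: ac_simps flip: mon_poly_mult)
    finally have "mon_div (sqfree B) (f (Var ` insert x B)) = mon_poly (sqfree {x}) * P"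
      by (simp add: mon_div_mult_cancel)
    also have "sqfree {x} = Poly_Mapping.single x 1"
      by (rule poly_mapping_eqI) (simp add: lookup_sqfree lookup_single when_def)
    finally have P: "mon_div (sqfree B) (f (Var ` insert x B)) = var x * P"
      by (simp add: var_def)
    have ki: "koszul_inv {Var x} (Var ` B) = card {b \<in> B. b < x}"
      using koszul_inv_Var[of "{x}" B] by (simp add: koszul_inv_singleton_left)
    have md: "mon_div (sqfree B) (esign {Var x} (Var ` B) * f (Var ` insert x B))
        = esign {Var x} (Var ` B) * (var x * P)"
      unfolding P[symmetric] by (simp add: esign_def minus_one_power_iff mon_div_uminus)
    show ?thesis
      unfolding ins unfolding md residue_esign ki unfolding residue_mult to_koszul_def P_def ..
  qed
  have "to_koszul I (del f) B = (\<Oplus>\<^bsub>R\<^esub>x\<in>vertices r - Var ` B. ?t x)"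
    unfolding to_koszul_def ext_diff_def mon_div_sum by (intro residue_sum finite_Diff finite_vertices)
  also have "\<dots> = (\<Oplus>\<^bsub>R\<^esub>x\<in>Var ` (- B). ?t x)"
    by (rule Q.add.finprod_mono_neutral_cong_right[simplified])
      (use gen in \<open>auto simp: finite_vertices vertices_def residue_carrier\<close>)
  also have "\<dots> = (\<Oplus>\<^bsub>R\<^esub>x\<in>- B. ?t (Var x))"
    by (rule Q.finsum_reindex) (auto simp: inj_on_def residue_carrier)
  also have "\<dots> = dg_diff K (to_koszul I f) B"
    unfolding koszul_quot_simps
  proof (rule Q.finsum_cong')
    show "(\<lambda>x. sign_power R (card {b \<in> B. b < x}) (residue I (var x) \<otimes>\<^bsub>R\<^esub> to_koszul I f (insert x B)))
        \<in> - B \<rightarrow> carrier R"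
      by (simp add: sign_power_def to_koszul_def residue_carrier)
  qed (simp_all add: var)
  finally show "to_koszul I (del f) B = dg_diff K (to_koszul I f) B" .
qed

lemma to_koszul_surj:
  assumes "g \<in> dg_part K n"
  shows "\<exists>f\<in>D n. to_koszul I f = g"
proof -
  have g: "\<And>A. g A \<in> carrier R" "\<And>A. card A \<noteq> n \<Longrightarrow> g A = \<zero>\<^bsub>R\<^esub>"
    using assms by (auto simp: koszul_quot_simps)
  have "\<forall>A. \<exists>P. residue I P = g A" using residue_surj g(1) by blast
  from choice[OF this] obtain P where P: "\<forall>A. residue I (P A) = g A" ..
  define f :: "'x vertex set \<Rightarrow> ('x, 'k) mpoly" where
    "f = (\<lambda>C. if gens C = {} \<and> card (vars C) = n then mon_poly (sqfree (vars C)) * P (vars C) else 0)"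
  have "to_koszul I f = g"
    by (rule ext) (simp add: to_koszul_def f_def mon_div_mult_cancel P mon_div_0 residue_0 g(2))
  moreover have "f \<in> D n"
    unfolding taylor_koszul_def
  proof (intro CollectI allI impI)
    fix C a assume nz: "lookup (f C) a \<noteq> 0"
    then have C: "gens C = {}" "card (vars C) = n"
      by (auto simp: f_def split: if_splits)
    have "c \<in> Var ` vars C" if "c \<in> C" for c
      using that C(1) by (cases c) (auto simp: gens_def vars_def)
    then have CV: "C = Var ` vars C" by (auto simp: vars_def)
    have "lookup (mon_poly (sqfree (vars C)) * P (vars C)) a \<noteq> 0"
      using nz by (simp add: f_def C)
    then obtain b c where "a = b + c" "lookup (mon_poly (sqfree (vars C)) :: ('x, 'k) mpoly) b \<noteq> 0"
      "lookup (P (vars C)) c \<noteq> 0"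
      by (rule lookup_mult_nonzero)
    then have "mon_le (sqfree (vars C)) a"
      by (auto simp: mon_poly_def lookup_single when_def mon_le_add_self split: if_splits)
    moreover have "card (Var ` vars C) = card (vars C)" by (rule card_image) (simp add: inj_on_def)
    moreover have "label \<mu> C = sqfree (vars C)" using label_Var[of \<mu> "vars C"] CV by simp
    ultimately show "C \<subseteq> vertices r \<and> card C = n \<and> mon_le (label \<mu> C) a"
      using CV C(2) by (auto simp: vertices_def)
  qed
  ultimately show ?thesis by blast
qed

lemma to_koszul_kernel:
  assumes z: "z \<in> D n" "del z = 0" "to_koszul I z = \<zero>\<^bsub>K\<^esub>"
  shows "\<exists>y\<in>D (Suc n). to_koszul I y = \<zero>\<^bsub>K\<^esub> \<and> del y = z"
proof -
  have zero: "to_koszul I f = \<zero>\<^bsub>K\<^esub> \<longleftrightarrow> (\<forall>A. mon_div (sqfree A) (f (Var ` A)) \<in> mon_ideal r \<mu>)" for f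
    unfolding fun_eq_iff koszul_quot_simps to_koszul_def residue_eq_0_iff unfolding I ..
  show ?thesis
    using kernel_quotient_acyclic[OF z(1,2)] z(3) unfolding zero by blast
qed

text \<open>
  The boundary of an arbitrary lift is a cycle in the kernel, hence the boundary of an element of the
  kernel, by which the lift is corrected.
\<close>

lemma lift_cycle:
  assumes "c \<in> dg_cycles K n"
  shows "\<exists>f\<in>D n. del f = 0 \<and> to_koszul I f = c"
proof -
  obtain f where f: "f \<in> D n" "to_koszul I f = c"
    using assms to_koszul_surj by (auto simp: dg_cycles_def)
  show ?thesis
  proof (cases n)
    case 0
    have "del f = 0"
      using taylor_koszul_nonzero(2,3)[OF f(1)] unfolding 0
      by (intro ext) (force simp: ext_diff_def intro!: sum.neutral)
    then show ?thesis using f by blast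
  next
    case (Suc n')
    have df: "del f \<in> D n'" using f(1) unfolding Suc by (rule TK.part_d)
    have "to_koszul I (del f) = \<zero>\<^bsub>K\<^esub>"
      using assms by (simp add: to_koszul_diff[OF f(1)] f(2) dg_cycles_def)
    from to_koszul_kernel[OF df TK.d_d[OF f(1)] this] obtain y
      where y: "y \<in> D n" "to_koszul I y = \<zero>\<^bsub>K\<^esub>" "del y = del f" unfolding Suc by blast
    have "to_koszul I (f - y) = c"
      using to_koszul_add[of f "- y"] f(2) y(2) to_koszul_carrier[of f]
      by (simp add: to_koszul_uminus)
    then show ?thesis
      using TK.part_diff[OF f(1) y(1)] TK.d_diff[of r f y] y(3) by (intro bexI[of _ "f - y"]) auto
  qed
qed

lemma boundaries_image: "dg_boundaries K n = to_koszul I ` del ` D (Suc n)"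
proof -
  have "dg_part K (Suc n) = to_koszul I ` D (Suc n)"
  proof (intro equalityI subsetI)
    fix g assume "g \<in> dg_part K (Suc n)"
    from to_koszul_surj[OF this] show "g \<in> to_koszul I ` D (Suc n)" by auto
  qed (auto intro: to_koszul_part)
  then show ?thesis
    unfolding dg_boundaries_def by (simp add: image_image to_koszul_diff cong: image_cong)
qed

lemma lift_boundary:
  assumes z: "z \<in> D n" "del z = 0" and b: "to_koszul I z \<in> dg_boundaries K n"
  shows "z \<in> del ` D (Suc n)"
proof -
  obtain g where g: "g \<in> D (Suc n)" "to_koszul I z = to_koszul I (del g)"
    using b unfolding boundaries_image by blast
  have "to_koszul I (z - del g) = \<zero>\<^bsub>K\<^esub>"
    using to_koszul_add[of z "- del g"] to_koszul_carrier[of "del g"]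
    by (simp add: to_koszul_uminus g(2) K.r_neg)
  moreover have "del (z - del g) = 0" by (simp add: TK.d_diff z(2) TK.d_d[OF g(1)])
  ultimately obtain y where y: "y \<in> D (Suc n)" "del y = z - del g"
    using to_koszul_kernel[OF TK.part_diff[OF z(1) TK.part_d[OF g(1)]]] by blast
  have "z = del (g + y)" by (simp add: TK.d_add y(2))
  then show ?thesis using TK.part_add[OF g(1) y(1)] by blast
qed

lemma class_elements: "dg_class K n (to_koszul I c) = {to_koszul I (del x + c) | x. x \<in> D (Suc n)}"
  unfolding dg_class_def boundaries_image by (auto simp: a_r_coset_def' to_koszul_add)

lemma class_boundary:
  assumes "e \<in> D (Suc n)"
  shows "dg_class K n (to_koszul I (del e)) = dg_class K n \<zero>\<^bsub>K\<^esub>"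
proof -
  have "{to_koszul I (del x + del e) | x. x \<in> D (Suc n)} = {to_koszul I (del x + 0) | x. x \<in> D (Suc n)}"
  proof safe
    fix x assume "x \<in> D (Suc n)"
    then show "\<exists>y. to_koszul I (del x + del e) = to_koszul I (del y + 0) \<and> y \<in> D (Suc n)"
      by (intro exI[of _ "x + e"]) (simp add: TK.d_add TK.part_add assms)
  next
    fix x assume "x \<in> D (Suc n)"
    then show "\<exists>y. to_koszul I (del x + 0) = to_koszul I (del y + del e) \<and> y \<in> D (Suc n)"
      by (intro exI[of _ "x - e"]) (simp add: TK.d_diff TK.part_diff assms)
  qed
  then show ?thesis using class_elements[of n 0] class_elements[of n "del e"] by (simp add: to_koszul_0)
qed

lemma boundary_if_class_0:
  assumes "dg_class K n (to_koszul I z) = dg_class K n \<zero>\<^bsub>K\<^esub>"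
  shows "to_koszul I z \<in> dg_boundaries K n"
proof -
  have "to_koszul I (del 0 + z) \<in> dg_class K n (to_koszul I z)"
    unfolding class_elements using TK.part_0 by blast
  then have "to_koszul I z \<in> dg_class K n (to_koszul I 0)"
    unfolding assms to_koszul_0 by (simp add: TK.d_0)
  then show ?thesis unfolding class_elements boundaries_image by auto
qed

lemma massey_sum_to_koszul:
  assumes "\<And>l. i < l \<Longrightarrow> l < j \<Longrightarrow> a i l \<in> D (massey_elem_deg p i l)"
    and "\<And>l. i < l \<Longrightarrow> l < j \<Longrightarrow> a l j \<in> D (massey_elem_deg p l j)"
  shows "massey_sum K p (\<lambda>i j. to_koszul I (a i j)) i j = to_koszul I (TK.msum p a i j)"
proof -
  have "to_koszul I (TK.msum p a i j)
      = (\<Oplus>\<^bsub>K\<^esub>l\<in>{i<..<j}. to_koszul I (ext_mult (sign_by (massey_elem_deg p i l + 1) (a i l)) (a l j)))"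
    unfolding TK.msum_def by (rule to_koszul_sum) simp
  also have "\<dots> = massey_sum K p (\<lambda>i j. to_koszul I (a i j)) i j"
    unfolding massey_sum_def
  proof (rule K.finsum_cong'[symmetric])
    fix l assume "l \<in> {i<..<j}"
    then show "sign_power K (massey_elem_deg p i l + 1) (to_koszul I (a i l)) \<otimes>\<^bsub>K\<^esub> to_koszul I (a l j)
        = to_koszul I (ext_mult (sign_by (massey_elem_deg p i l + 1) (a i l)) (a l j))"
      using to_koszul_mult[OF TK.part_sign_by[OF assms(1)] assms(2), of l l]
      by (simp add: to_koszul_sign_by)
  qed (auto simp: to_koszul_carrier)
  finally show ?thesis ..
qed

end


section \<open>Triviality of the higher Massey products\<close>

theorem theorem2:
  fixes r :: nat
    and \<mu> :: "nat \<Rightarrow> 'x::{finite,linorder} mon"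
    and I :: "('x, 'k::field) mpoly set"
  assumes I: "I = mon_ideal r \<mu>"
    and resolvable: "simplicially_resolvable TYPE('k) r \<mu>"
    and standard: "\<exists>M. standard_matching TYPE('k) r \<mu> M"
  shows "\<forall>n\<ge>3. \<forall>p \<alpha>.
           (\<forall>i\<in>{1..n}. \<alpha> i \<in> dg_homology (koszul_quot I) (p i)) \<and>
           massey_defined (koszul_quot I) p \<alpha> 0 n \<longrightarrow>
           massey_trivial (koszul_quot I) p \<alpha> 0 n"
proof (intro allI impI, elim conjE)
  fix n p \<alpha>
  assume n: "3 \<le> (n :: nat)" and \<alpha>: "\<forall>i\<in>{1..n}. \<alpha> i \<in> dg_homology (koszul_quot I) (p i)"
    and def: "massey_defined (koszul_quot I) p \<alpha> 0 n"
  interpret quotient_ideal I unfolding I by (rule quotient_mon_ideal)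
  let ?K = "koszul_quot I"
  let ?D = "taylor_koszul r \<mu> :: nat \<Rightarrow> ('x vertex set \<Rightarrow> ('x, 'k) mpoly) set"
  let ?d = "ext_diff (vertices r) :: ('x vertex set \<Rightarrow> ('x, 'k) mpoly) \<Rightarrow> _"
  obtain M where M: "standard_matching TYPE('k) r \<mu> M" using standard by blast
  define X where "X = (\<Union>i. Domain (M i))"
  note compl = standard_matching_sources[OF M, folded X_def]
  note union = standard_matching_union[OF M, folded X_def]
  \<comment> \<open>cycles of the tensor product that represent the given classes\<close>
  have "\<exists>c. c \<in> ?D (p (Suc i)) \<and> ?d c = 0 \<and> dg_class ?K (p (Suc i)) (to_koszul I c) = \<alpha> (Suc i)"
    if "i \<in> {..<n}" for i
  proof -
    have "\<alpha> (Suc i) \<in> dg_homology ?K (p (Suc i))" using \<alpha> that by auto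
    then obtain \<zeta> where z: "\<zeta> \<in> dg_cycles ?K (p (Suc i))" "dg_class ?K (p (Suc i)) \<zeta> = \<alpha> (Suc i)"
      unfolding dg_homology_def by auto
    from lift_cycle[OF I z(1)] z(2) show ?thesis by auto
  qed
  then have "\<forall>i\<in>{..<n}. \<exists>c. c \<in> ?D (p (Suc i)) \<and> ?d c = 0 \<and>
      dg_class ?K (p (Suc i)) (to_koszul I c) = \<alpha> (Suc i)" by (rule ballI)
  from bchoice[OF this] obtain c where c0: "\<forall>i\<in>{..<n}. c i \<in> ?D (p (Suc i)) \<and> ?d (c i) = 0 \<and>
      dg_class ?K (p (Suc i)) (to_koszul I (c i)) = \<alpha> (Suc i)" ..
  have c: "c i \<in> ?D (p (Suc i))" "?d (c i) = 0"
    "dg_class ?K (p (Suc i)) (to_koszul I (c i)) = \<alpha> (Suc i)" if "i < n" for i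
    using c0 that by auto
  \<comment> \<open>the length two products of consecutive classes contain zero, and the kernel of the
    projection is acyclic\<close>
  have prod: "ext_mult (c i) (c (Suc i)) \<in> ?d ` ?D (Suc (p (Suc i) + p (Suc (Suc i))))" if i: "Suc i < n" for i
  proof -
    let ?N = "p (Suc i) + p (Suc (Suc i))"
    have "massey_trivial ?K p \<alpha> i (i + 2)"
      using def
    proof cases
      case massey_defined_2
      then show ?thesis using n by simp
    next
      case massey_defined_higher
      have "(i, i + 2) \<noteq> (0, n)" using n by auto
      from massey_defined_higher(2)[OF _ _ _ this] show ?thesis using i by simp
    qed
    moreover have "massey_deg p i (i + 2) = ?N"
    proof -
      have "{i<..i + 2} = {Suc i, Suc (Suc i)}" by auto
      then show ?thesis by (simp add: massey_deg_def)
    qed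
    ultimately obtain a b where ab: "a \<in> \<alpha> (Suc i)" "b \<in> \<alpha> (Suc (Suc i))"
      "dg_class ?K ?N (a \<otimes>\<^bsub>?K\<^esub> b) = dg_class ?K ?N \<zero>\<^bsub>?K\<^esub>"
      by (auto simp: massey_trivial_def massey_product_def)
    have "a \<in> dg_class ?K (p (Suc i)) (to_koszul I (c i))"
      "b \<in> dg_class ?K (p (Suc (Suc i))) (to_koszul I (c (Suc i)))"
      using ab(1,2) c(3)[of i] c(3)[of "Suc i"] i by simp_all
    note ab_elements = this[unfolded class_elements[OF I]]
    obtain x where x: "x \<in> ?D (Suc (p (Suc i)))" "a = to_koszul I (?d x + c i)"
      using ab_elements(1) by blast
    obtain y where y: "y \<in> ?D (Suc (p (Suc (Suc i))))" "b = to_koszul I (?d y + c (Suc i))"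
      using ab_elements(2) by blast
    have xy: "?d x + c i \<in> ?D (p (Suc i))" "?d y + c (Suc i) \<in> ?D (p (Suc (Suc i)))"
      using c(1)[of i] c(1)[of "Suc i"] i by (auto intro!: TK.part_add TK.part_d x(1) y(1))
    have cyc: "?d (?d x + c i) = 0" "?d (?d y + c (Suc i)) = 0"
      using c(2)[of i] c(2)[of "Suc i"] i by (simp_all add: TK.d_add TK.d_d[OF x(1)] TK.d_d[OF y(1)])
    let ?P = "ext_mult (?d x + c i) (?d y + c (Suc i))"
    have "to_koszul I ?P \<in> dg_boundaries ?K ?N"
      using ab(3) unfolding x(2) y(2) to_koszul_mult[OF xy, symmetric] by (rule boundary_if_class_0[OF I])
    moreover have "?d ?P = 0"
      unfolding TK.leibniz[OF xy] cyc by (simp add: TK.mult_0_left TK.mult_0_right sign_by_def)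
    ultimately have P: "?P \<in> ?d ` ?D (Suc ?N)"
      by (intro lift_boundary[OF I] TK.part_mult xy)
    note ci = c(1,2)[OF Suc_lessD[OF i]] and cj = c(1,2)[OF i]
    show ?thesis
      by (rule TK.boundary_mult_cong[OF ci(1) cj(1) ci(2) cj(2) x(1) y(1) P])
  qed
  \<comment> \<open>\<open>a 0 n\<close> will show that the Massey product of the projected system bounds\<close>
  have "\<exists>a. (\<forall>i<n. a i (Suc i) = c i) \<and>
    (\<forall>i j. i < j \<and> j \<le> n \<longrightarrow> a i j \<in> ?D (massey_elem_deg p i j)) \<and>
    (\<forall>i j. i + 1 < j \<and> j \<le> n \<longrightarrow> ?d (a i j) = TK.msum p a i j)"
  proof (rule TK.massey_system_exists[where U = "source_ideal \<mu> X"])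
    show "0 \<in> source_ideal \<mu> X"
      by (simp add: source_ideal_def supported_def top_coeff_def)
    show "f + g \<in> source_ideal \<mu> X" if "f \<in> source_ideal \<mu> X" "g \<in> source_ideal \<mu> X" for f g
      using that by (simp add: source_ideal_def supported_def top_coeff_add)
    show "- f \<in> source_ideal \<mu> X" if "f \<in> source_ideal \<mu> X" for f
      using that by (simp add: source_ideal_def supported_def top_coeff_uminus)
    show "ext_mult f g \<in> source_ideal \<mu> X"
      if "f \<in> ?D m" "g \<in> ?D m'" "f \<in> source_ideal \<mu> X" for f g m m'
      using source_ideal_mult[OF union that(1,2)] that(3) by blast
    show "ext_mult f g \<in> source_ideal \<mu> X"
      if "f \<in> ?D m" "g \<in> ?D m'" "g \<in> source_ideal \<mu> X" for f g m m'
      using source_ideal_mult[OF union that(1,2)] that(3) by blast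
    show "\<exists>b\<in>?D (Suc m) \<inter> source_ideal \<mu> X. ?d b = ?d e" if "e \<in> ?D (Suc m)" for e m
      by (rule source_ideal_boundary[OF compl that])
    show "\<exists>y\<in>?D (Suc m) \<inter> source_ideal \<mu> X. ?d y = z"
      if "z \<in> ?D m" "z \<in> source_ideal \<mu> X" "?d z = 0" for z m
      by (rule source_ideal_cycle[OF compl that])
    show "c i \<in> ?D (p (Suc i))" if "i < n" for i by (rule c(1)[OF that])
    show "?d (c i) = 0" if "i < n" for i by (rule c(2)[OF that])
    show "ext_mult (c i) (c (Suc i)) \<in> ?d ` ?D (Suc (p (Suc i) + p (Suc (Suc i))))" if "Suc i < n" for i
      by (rule prod[OF that])
  qed
  then obtain a where a: "\<forall>i<n. a i (Suc i) = c i"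
    "\<forall>i j. i < j \<and> j \<le> n \<longrightarrow> a i j \<in> ?D (massey_elem_deg p i j)"
    "\<forall>i j. i + 1 < j \<and> j \<le> n \<longrightarrow> ?d (a i j) = TK.msum p a i j"
    by (elim exE conjE) (rule that)
  have a_deg: "a i j \<in> ?D (massey_elem_deg p i j)" if "i < j" "j \<le> n" for i j
    using a(2) that by simp
  have a_sum: "to_koszul I (?d (a i j)) = massey_sum ?K p (\<lambda>i j. to_koszul I (a i j)) i j"
    if "i + 1 < j" "j \<le> n" for i j
  proof -
    have "massey_sum ?K p (\<lambda>i j. to_koszul I (a i j)) i j = to_koszul I (TK.msum p a i j)"
      by (rule massey_sum_to_koszul[OF I]) (use that in \<open>auto intro!: a_deg\<close>)
    then show ?thesis using a(3) that by simp
  qed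
  have "defining_system ?K p \<alpha> 0 n (\<lambda>i j. to_koszul I (a i j))"
    unfolding defining_system_def
  proof (intro conjI ballI allI impI; (elim conjE)?)
    fix i assume "i \<in> {0<..n}"
    then obtain i' where i: "i = Suc i'" "i' < n" by (cases i) auto
    then have ai: "a (i - 1) i = c i'" using a(1) by simp
    have "dg_diff ?K (to_koszul I (c i')) = \<zero>\<^bsub>?K\<^esub>"
      using to_koszul_diff[OF I c(1)[OF i(2)]] c(2)[OF i(2)] by (simp only: to_koszul_0)
    then show "to_koszul I (a (i - 1) i) \<in> dg_cycles ?K (p i)"
      unfolding ai using to_koszul_part[OF c(1)[OF i(2)]] by (simp add: dg_cycles_def i(1))
    show "dg_class ?K (p i) (to_koszul I (a (i - 1) i)) = \<alpha> i"
      unfolding ai using c(3)[OF i(2)] by (simp add: i(1))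
  next
    fix i j assume ij: "i + 1 < j" "j \<le> n"
    have aij: "a i j \<in> ?D (massey_elem_deg p i j)" using ij by (intro a_deg) auto
    show "to_koszul I (a i j) \<in> dg_part ?K (massey_elem_deg p i j)" by (rule to_koszul_part[OF aij])
    show "dg_diff ?K (to_koszul I (a i j)) = massey_sum ?K p (\<lambda>i j. to_koszul I (a i j)) i j"
      using to_koszul_diff[OF I aij] a_sum[OF ij] by simp
  qed
  moreover have "dg_class ?K (massey_deg p 0 n) \<zero>\<^bsub>?K\<^esub>
      = dg_class ?K (massey_deg p 0 n) (massey_sum ?K p (\<lambda>i j. to_koszul I (a i j)) 0 n)"
  proof -
    have "massey_elem_deg p 0 n = Suc (massey_deg p 0 n)"
      using n by (simp add: massey_elem_deg_def massey_deg_def)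
    then have "a 0 n \<in> ?D (Suc (massey_deg p 0 n))" using a_deg[of 0 n] n by simp
    from class_boundary[OF I this] show ?thesis using a_sum[of 0 n] n by simp
  qed
  ultimately show "massey_trivial ?K p \<alpha> 0 n"
    using n unfolding massey_trivial_def massey_product_def by auto
qed

end
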